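(* Let $\mathcal{V}$ be a subbundle of a natural vector bundle over a manifold $M$, which is conserved by an integrable system $(X_1,\ldots,X_p,F_1,\ldots,F_q)$ on $M$ (i.e. preserved by the flows of $X_1,\ldots,X_p$), or by the vector field $X_1$ of the system where $X_1$ is completely irrational. Then the Liouville torus action near any Liouville torus of the system preserves $\mathcal{V}$.
   Context: All objects are smooth. A natural vector bundle over $M$ is a vector bundle obtained from $TM$, $T^*M$ and the trivial line bundle $\mathbb{R}\times M$ by taking direct sums and tensor products; (local) diffeomorphisms of $M$ act naturally on such bundles. An integrable system of type $(p,q)$ ($p\ge1$, $q\ge0$) on a manifold $M$ of dimension $m=p+q$ is a tuple $(X_1,\ldots,X_p,F_1,\ldots,F_q)$ of vector fields $X_i$ and functions $F_j$ on $M$ such that $[X_i,X_j]=0$ for all $i,j$; $X_i(F_j)=0$ for all $i,j$; and $X_1\wedge\cdots\wedge X_p\ne0$, $dF_1\wedge\cdots\wedge dF_q\neq0$ almost everywhere on $M$. A level set is a connected component $N$ of a joint level set $\{F_1=\mathrm{const},\ldots,F_q=\mathrm{const}\}$; the system is regular at $N$ if $X_1\wedge\cdots\wedge X_p\neq0$ and $dF_1\wedge\cdots\wedge dF_q\neq0$ everywhere on $N$. A Liouville torus is a compact level set at which the system is regular. By Liouville's theorem, a tubular neighborhood $\mathcal{U}(N)$ of a Liouville torus $N$ carries a free $\mathbb{T}^p$-action, unique up to automorphisms of $\mathbb{T}^p$, which preserves every $X_i$ and every $F_j$ and whose orbits are regular level sets of the system; it is called the Liouville torus action. Moreover $\mathcal{U}(N)\cong\mathbb{T}^p\times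 B^q$ ($B^q$ a $q$-dimensional ball) with coordinates $(\theta_1 \bmod 1,\ldots,\theta_p \bmod 1,z_1,\ldots,z_q)$ in which the action is generated by $\partial/\partial\theta_1,\ldots,\partial/\partial\theta_p$, the $F_j$ depend only on $z$, and $X_i=\sum_j a_{ij}(z)\,\partial/\partial\theta_j$. $X_1$ is completely irrational near $N$ if, in a tubular neighborhood $\mathcal{U}(N)\cong\mathbb{T}^p\times B^q$ of $N$ with the coordinates $(\theta_1 \bmod 1,\ldots,\theta_p \bmod 1,z_1,\ldots,z_q)$ given by Liouville's theorem (so that the tori $\mathbb{T}^p\times\{\mathbf{z}\}$ are the orbits of the Liouville torus action), the set of $\mathbf{z}\in B^q$ such that the orbits of $X_1$ on $\mathbb{T}^p\times\{\mathbf{z}\}$ are dense in that torus is a dense subset of $B^q$. *)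

theory Defs
  imports "HOL-Analysis.Analysis"
begin

section \<open>Smooth manifolds\<close>

text \<open>C^k and smooth maps on an open set of a normed space.\<close>

primrec Ck_on :: "nat \<Rightarrow> 'a::real_normed_vector set \<Rightarrow> ('a \<Rightarrow> 'b::real_normed_vector) \<Rightarrow> bool" where
  "Ck_on 0 S f \<longleftrightarrow> continuous_on S f"
| "Ck_on (Suc k) S f \<longleftrightarrow> (\<forall>x\<in>S. f differentiable (at x)) \<and>
     (\<forall>v. Ck_on k S (\<lambda>x. frechet_derivative f (at x) v))"

definition smooth_on :: "'a::real_normed_vector set \<Rightarrow> ('a \<Rightarrow> 'b::real_normed_vector) \<Rightarrow> bool" where
  "smooth_on S f \<longleftrightarrow> (\<forall>k. Ck_on k S f)"

text \<open>The manifold \<open>M\<close> is the whole type \<open>'a\<close>; its dimension is \<open>CARD('n)\<close>. A chart is a pair of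
  a domain and a coordinate map; the coordinate map is meaningless outside the domain.\<close>

type_synonym ('a, 'n) chart = "'a set \<times> ('a \<Rightarrow> real ^ 'n)"

abbreviation chart_inv :: "('a, 'n) chart \<Rightarrow> real ^ 'n \<Rightarrow> 'a" where
  "chart_inv c \<equiv> inv_into (fst c) (snd c)"

definition charts_at :: "('a, 'n) chart set \<Rightarrow> 'a \<Rightarrow> ('a, 'n) chart set" where
  "charts_at A x = {c \<in> A. x \<in> fst c}"

definition local_rep :: "('a, 'n) chart \<Rightarrow> ('a, 'n) chart \<Rightarrow> ('a \<Rightarrow> 'a) \<Rightarrow> real ^ 'n \<Rightarrow> real ^ 'n" where
  "local_rep c d f = (\<lambda>u. snd d (f (chart_inv c u)))"

definition chart_jacobian ::
  "('a, 'n::finite) chart \<Rightarrow> ('a, 'n) chart \<Rightarrow> ('a \<Rightarrow> 'a) \<Rightarrow> 'a \<Rightarrow> real ^ 'n ^ 'n" where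
  "chart_jacobian c d f x = jacobian (local_rep c d f) (at (snd c x))"

definition smooth_atlas :: "('a::topological_space, 'n::finite) chart set \<Rightarrow> bool" where
  "smooth_atlas A \<longleftrightarrow>
     (\<forall>c\<in>A. open (fst c) \<and> open (snd c ` fst c) \<and>
        homeomorphism (fst c) (snd c ` fst c) (snd c) (chart_inv c)) \<and>
     (\<Union>c\<in>A. fst c) = UNIV \<and>
     (\<forall>c\<in>A. \<forall>d\<in>A. smooth_on (snd c ` (fst c \<inter> fst d)) (local_rep c d id))"

definition smooth_function :: "('a, 'n::finite) chart set \<Rightarrow> ('a \<Rightarrow> real) \<Rightarrow> bool" where
  "smooth_function A f \<longleftrightarrow> (\<forall>c\<in>A. smooth_on (snd c ` fst c) (\<lambda>u. f (chart_inv c u)))"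

section \<open>Natural vector bundles\<close>

datatype natural_bundle =
    Tangent
  | Cotangent
  | Trivial_Line
  | Direct_Sum natural_bundle natural_bundle
  | Tensor_Product natural_bundle natural_bundle

text \<open>Indices of the components of an element of a fibre with respect to the basis that a chart
  induces. The representation of \<open>GL\<close> on the model fibre is given by its matrix entries.\<close>

datatype 'n comp_index =
    Coord 'n
  | Scalar
  | In_Left "'n comp_index"
  | In_Right "'n comp_index"
  | In_Pair "'n comp_index" "'n comp_index"

primrec indices :: "natural_bundle \<Rightarrow> 'n comp_index set" where
  "indices Tangent = range Coord"
| "indices Cotangent = range Coord"
| "indices Trivial_Line = {Scalar}"
| "indices (Direct_Sum E E') = In_Left ` indices E \<union> In_Right ` indices E'"
| "indices (Tensor_Product E E') = {In_Pair a b | a b. a \<in> indices E \<and> b \<in> indices E'}"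

fun rep_entry :: "natural_bundle \<Rightarrow> real ^ 'n ^ 'n \<Rightarrow> 'n::finite comp_index \<Rightarrow> 'n comp_index \<Rightarrow> real" where
  "rep_entry Tangent L (Coord i) (Coord j) = L $ i $ j"
| "rep_entry Cotangent L (Coord i) (Coord j) = matrix_inv L $ j $ i"
| "rep_entry Trivial_Line L Scalar Scalar = 1"
| "rep_entry (Direct_Sum E E') L (In_Left a) (In_Left b) = rep_entry E L a b"
| "rep_entry (Direct_Sum E E') L (In_Right a) (In_Right b) = rep_entry E' L a b"
| "rep_entry (Tensor_Product E E') L (In_Pair a a') (In_Pair b b') =
     rep_entry E L a b * rep_entry E' L a' b'"
| "rep_entry _ _ _ _ = 0"

definition rep :: "natural_bundle \<Rightarrow> real ^ 'n ^ 'n \<Rightarrow> ('n::finite comp_index \<Rightarrow> real) \<Rightarrow> 'n comp_index \<Rightarrow> real" where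
  "rep E L v = (\<lambda>a. \<Sum>b\<in>indices E. rep_entry E L a b * v b)"

text \<open>An element of a fibre over \<open>x\<close> is the family of its components in all charts around \<open>x\<close>, related
  by the transition law; the family is \<open>0\<close> where it carries no information.\<close>

type_synonym ('a, 'n) fibre_elem = "('a, 'n) chart \<Rightarrow> 'n comp_index \<Rightarrow> real"

definition fibre :: "('a, 'n::finite) chart set \<Rightarrow> natural_bundle \<Rightarrow> 'a \<Rightarrow> ('a, 'n) fibre_elem set" where
  "fibre A E x = {v.
     (\<forall>c a. c \<notin> charts_at A x \<or> a \<notin> indices E \<longrightarrow> v c a = 0) \<and>
     (\<forall>c\<in>charts_at A x. \<forall>d\<in>charts_at A x. v d = rep E (chart_jacobian c d id x) (v c))}"

text \<open>The natural action of a local diffeomorphism \<open>f\<close>, from the fibre over \<open>x\<close> to the one over \<open>f x\<close>.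
  By the chain rule the choice of the chart around \<open>x\<close> does not matter.\<close>

definition pushforward ::
  "('a, 'n::finite) chart set \<Rightarrow> natural_bundle \<Rightarrow> ('a \<Rightarrow> 'a) \<Rightarrow> 'a \<Rightarrow> ('a, 'n) fibre_elem \<Rightarrow> ('a, 'n) fibre_elem" where
  "pushforward A E f x v =
     (let c = (SOME c. c \<in> charts_at A x) in
      (\<lambda>d. if d \<in> charts_at A (f x) then rep E (chart_jacobian c d f x) (v c) else (\<lambda>a. 0)))"

definition smooth_section_on ::
  "('a, 'n::finite) chart set \<Rightarrow> natural_bundle \<Rightarrow> 'a set \<Rightarrow> ('a \<Rightarrow> ('a, 'n) fibre_elem) \<Rightarrow> bool" where
  "smooth_section_on A E W s \<longleftrightarrow>
     (\<forall>x\<in>W. s x \<in> fibre A E x) \<and>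
     (\<forall>c\<in>A. \<forall>a\<in>indices E. smooth_on (snd c ` (W \<inter> fst c)) (\<lambda>u. s (chart_inv c u) c a))"

definition lin_comb :: "nat \<Rightarrow> (nat \<Rightarrow> real) \<Rightarrow> (nat \<Rightarrow> ('a, 'n) fibre_elem) \<Rightarrow> ('a, 'n) fibre_elem" where
  "lin_comb r k v = (\<lambda>c a. \<Sum>i<r. k i * v i c a)"

text \<open>Local smooth frames; the rank is locally constant.\<close>

definition subbundle ::
  "('a::topological_space, 'n::finite) chart set \<Rightarrow> natural_bundle \<Rightarrow> ('a \<Rightarrow> ('a, 'n) fibre_elem set) \<Rightarrow> bool" where
  "subbundle A E V \<longleftrightarrow>
     (\<forall>x. \<exists>W r s. open W \<and> x \<in> W \<and> (\<forall>i<r. smooth_section_on A E W (s i)) \<and>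
        (\<forall>y\<in>W. V y = {lin_comb r k (\<lambda>i. s i y) | k. True} \<and>
           (\<forall>k. lin_comb r k (\<lambda>i. s i y) = (\<lambda>c a. 0) \<longrightarrow> (\<forall>i<r. k i = 0))))"

definition preserves_subbundle_on ::
  "('a, 'n::finite) chart set \<Rightarrow> natural_bundle \<Rightarrow> ('a \<Rightarrow> ('a, 'n) fibre_elem set) \<Rightarrow> 'a set \<Rightarrow> ('a \<Rightarrow> 'a) \<Rightarrow> bool" where
  "preserves_subbundle_on A E V W f \<longleftrightarrow> (\<forall>x\<in>W. pushforward A E f x ` V x = V (f x))"

section \<open>Vector fields and flows\<close>

abbreviation vector_field :: "('a, 'n::finite) chart set \<Rightarrow> ('a \<Rightarrow> ('a, 'n) fibre_elem) \<Rightarrow> bool" where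
  "vector_field A X \<equiv> smooth_section_on A Tangent UNIV X"

definition vec_comp :: "('a, 'n) chart \<Rightarrow> ('a, 'n::finite) fibre_elem \<Rightarrow> real ^ 'n" where
  "vec_comp c v = (\<chi> i. v c (Coord i))"

definition vec_rep :: "('a, 'n) chart \<Rightarrow> ('a \<Rightarrow> ('a, 'n::finite) fibre_elem) \<Rightarrow> real ^ 'n \<Rightarrow> real ^ 'n" where
  "vec_rep c X = (\<lambda>u. vec_comp c (X (chart_inv c u)))"

definition fun_deriv :: "('a, 'n::finite) chart \<Rightarrow> ('a \<Rightarrow> real) \<Rightarrow> 'a \<Rightarrow> real ^ 'n \<Rightarrow> real" where
  "fun_deriv c f x = frechet_derivative (\<lambda>u. f (chart_inv c u)) (at (snd c x))"

definition differential :: "('a, 'n::finite) chart \<Rightarrow> ('a \<Rightarrow> real) \<Rightarrow> 'a \<Rightarrow> real ^ 'n" where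
  "differential c f x = (\<chi> i. fun_deriv c f x (axis i 1))"

text \<open>\<open>X(f)\<close> and \<open>[X, Y]\<close>, computed in the chart \<open>c\<close>.\<close>

definition lie_derivative_fun ::
  "('a, 'n::finite) chart \<Rightarrow> ('a \<Rightarrow> ('a, 'n) fibre_elem) \<Rightarrow> ('a \<Rightarrow> real) \<Rightarrow> 'a \<Rightarrow> real" where
  "lie_derivative_fun c X f x = fun_deriv c f x (vec_comp c (X x))"

definition lie_bracket ::
  "('a, 'n::finite) chart \<Rightarrow> ('a \<Rightarrow> ('a, 'n) fibre_elem) \<Rightarrow> ('a \<Rightarrow> ('a, 'n) fibre_elem) \<Rightarrow> 'a \<Rightarrow> real ^ 'n" where
  "lie_bracket c X Y x =
     frechet_derivative (vec_rep c Y) (at (snd c x)) (vec_comp c (X x)) -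
     frechet_derivative (vec_rep c X) (at (snd c x)) (vec_comp c (Y x))"

text \<open>Components of \<open>v 1 \<and> \<dots> \<and> v k\<close> (for \<open>k = 0\<close> the constant \<open>1\<close>); used for vectors and covectors.\<close>

definition wedge :: "nat \<Rightarrow> (nat \<Rightarrow> real ^ 'n) \<Rightarrow> (nat \<Rightarrow> 'n) \<Rightarrow> real" where
  "wedge k v = (\<lambda>\<iota>. \<Sum>\<sigma> | \<sigma> permutes {1..k}. of_int (sign \<sigma>) * (\<Prod>i=1..k. v i $ \<iota> (\<sigma> i)))"

text \<open>Continuity keeps the curve inside the domain of a chart for a short time.\<close>

definition integral_curve ::
  "('a::topological_space, 'n::finite) chart set \<Rightarrow> ('a \<Rightarrow> ('a, 'n) fibre_elem) \<Rightarrow> real set \<Rightarrow> (real \<Rightarrow> 'a) \<Rightarrow> bool" where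
  "integral_curve A X J \<gamma> \<longleftrightarrow> continuous_on J \<gamma> \<and>
     (\<forall>t\<in>J. \<forall>c\<in>charts_at A (\<gamma> t).
        ((\<lambda>t. snd c (\<gamma> t)) has_vector_derivative vec_comp c (X (\<gamma> t))) (at t))"

definition orbit :: "('a::topological_space, 'n::finite) chart set \<Rightarrow> ('a \<Rightarrow> ('a, 'n) fibre_elem) \<Rightarrow> 'a \<Rightarrow> 'a set" where
  "orbit A X x = {\<gamma> t | \<gamma> J t. open J \<and> is_interval J \<and> 0 \<in> J \<and> t \<in> J \<and>
     integral_curve A X J \<gamma> \<and> \<gamma> 0 = x}"

text \<open>The flow of \<open>X\<close> restricted to a box \<open>J \<times> W\<close> in its domain. Such a \<open>\<phi>\<close> is determined by \<open>X\<close> and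
  automatically smooth in both arguments (uniqueness and smooth dependence on initial values).\<close>

definition local_flow ::
  "('a::topological_space, 'n::finite) chart set \<Rightarrow> ('a \<Rightarrow> ('a, 'n) fibre_elem) \<Rightarrow>
   real set \<Rightarrow> 'a set \<Rightarrow> (real \<Rightarrow> 'a \<Rightarrow> 'a) \<Rightarrow> bool" where
  "local_flow A X J W \<phi> \<longleftrightarrow> open J \<and> is_interval J \<and> 0 \<in> J \<and> open W \<and>
     (\<forall>x\<in>W. \<phi> 0 x = x \<and> integral_curve A X J (\<lambda>t. \<phi> t x))"

definition conserved_by ::
  "('a::topological_space, 'n::finite) chart set \<Rightarrow> natural_bundle \<Rightarrow> ('a \<Rightarrow> ('a, 'n) fibre_elem set) \<Rightarrow>
   ('a \<Rightarrow> ('a, 'n) fibre_elem) \<Rightarrow> bool" where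
  "conserved_by A E V X \<longleftrightarrow>
     (\<forall>J W \<phi>. local_flow A X J W \<phi> \<longrightarrow> (\<forall>t\<in>J. preserves_subbundle_on A E V W (\<phi> t)))"

section \<open>Integrable systems\<close>

definition vectors_nondegenerate_at ::
  "('a, 'n::finite) chart set \<Rightarrow> nat \<Rightarrow> (nat \<Rightarrow> 'a \<Rightarrow> ('a, 'n) fibre_elem) \<Rightarrow> 'a \<Rightarrow> bool" where
  "vectors_nondegenerate_at A p X x \<longleftrightarrow>
     (\<forall>c\<in>charts_at A x. wedge p (\<lambda>i. vec_comp c (X i x)) \<noteq> (\<lambda>\<iota>. 0))"

definition differentials_nondegenerate_at ::
  "('a, 'n::finite) chart set \<Rightarrow> nat \<Rightarrow> (nat \<Rightarrow> 'a \<Rightarrow> real) \<Rightarrow> 'a \<Rightarrow> bool" where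
  "differentials_nondegenerate_at A q F x \<longleftrightarrow>
     (\<forall>c\<in>charts_at A x. wedge q (\<lambda>j. differential c (F j) x) \<noteq> (\<lambda>\<iota>. 0))"

definition almost_everywhere :: "('a, 'n::finite) chart set \<Rightarrow> ('a \<Rightarrow> bool) \<Rightarrow> bool" where
  "almost_everywhere A P \<longleftrightarrow> (\<forall>c\<in>A. negligible (snd c ` {x \<in> fst c. \<not> P x}))"

text \<open>The system is \<open>X 1, \<dots>, X p, F 1, \<dots>, F q\<close>.\<close>

definition integrable_system ::
  "('a::topological_space, 'n::finite) chart set \<Rightarrow> nat \<Rightarrow> (nat \<Rightarrow> 'a \<Rightarrow> ('a, 'n) fibre_elem) \<Rightarrow>
   nat \<Rightarrow> (nat \<Rightarrow> 'a \<Rightarrow> real) \<Rightarrow> bool" where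
  "integrable_system A p X q F \<longleftrightarrow>
     p \<ge> 1 \<and> p + q = CARD('n) \<and>
     (\<forall>i\<in>{1..p}. vector_field A (X i)) \<and>
     (\<forall>j\<in>{1..q}. smooth_function A (F j)) \<and>
     (\<forall>i\<in>{1..p}. \<forall>j\<in>{1..p}. \<forall>x. \<forall>c\<in>charts_at A x. lie_bracket c (X i) (X j) x = 0) \<and>
     (\<forall>i\<in>{1..p}. \<forall>j\<in>{1..q}. \<forall>x. \<forall>c\<in>charts_at A x. lie_derivative_fun c (X i) (F j) x = 0) \<and>
     almost_everywhere A (vectors_nondegenerate_at A p X) \<and>
     almost_everywhere A (differentials_nondegenerate_at A q F)"

definition level_set :: "nat \<Rightarrow> (nat \<Rightarrow> 'a::topological_space \<Rightarrow> real) \<Rightarrow> 'a set \<Rightarrow> bool" where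
  "level_set q F N \<longleftrightarrow> (\<exists>k. N \<in> components {x. \<forall>j\<in>{1..q}. F j x = k j})"

definition regular_at ::
  "('a, 'n::finite) chart set \<Rightarrow> nat \<Rightarrow> (nat \<Rightarrow> 'a \<Rightarrow> ('a, 'n) fibre_elem) \<Rightarrow>
   nat \<Rightarrow> (nat \<Rightarrow> 'a \<Rightarrow> real) \<Rightarrow> 'a set \<Rightarrow> bool" where
  "regular_at A p X q F N \<longleftrightarrow>
     (\<forall>x\<in>N. vectors_nondegenerate_at A p X x \<and> differentials_nondegenerate_at A q F x)"

definition liouville_torus ::
  "('a::topological_space, 'n::finite) chart set \<Rightarrow> nat \<Rightarrow> (nat \<Rightarrow> 'a \<Rightarrow> ('a, 'n) fibre_elem) \<Rightarrow>
   nat \<Rightarrow> (nat \<Rightarrow> 'a \<Rightarrow> real) \<Rightarrow> 'a set \<Rightarrow> bool" where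
  "liouville_torus A p X q F N \<longleftrightarrow> compact N \<and> level_set q F N \<and> regular_at A p X q F N"

section \<open>The Liouville torus action\<close>

text \<open>\<open>T^p = R^p / Z^p\<close> with \<open>p = CARD('p)\<close>. A point \<open>(\<theta>, z)\<close> of \<open>R^p \<times> B^q\<close>, with \<open>B^q\<close> the open unit ball,
  is written \<open>angle_vec e \<theta> + z\<close> in \<open>R^(p+q)\<close>, where the injection \<open>e\<close> names the slots of the
  angles and \<open>z\<close> lives in the remaining \<open>q\<close> slots. This also covers \<open>q = 0\<close>.\<close>

definition angle_vec :: "('p::finite \<Rightarrow> 'n::finite) \<Rightarrow> real ^ 'p \<Rightarrow> real ^ 'n" where
  "angle_vec e \<theta> = (\<Sum>j\<in>UNIV. (\<theta> $ j) *\<^sub>R axis (e j) 1)"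

definition unit_ball_q :: "('p::finite \<Rightarrow> 'n::finite) \<Rightarrow> (real ^ 'n) set" where
  "unit_ball_q e = {z. (\<forall>j. z $ e j = 0) \<and> norm z < 1}"

definition angle_domain :: "('p::finite \<Rightarrow> 'n::finite) \<Rightarrow> (real ^ 'n) set" where
  "angle_domain e = {angle_vec e \<theta> + z | \<theta> z. z \<in> unit_ball_q e}"

text \<open>\<open>\<Phi>\<close> descends to a diffeomorphism from \<open>T^p \<times> B^q\<close> onto the open set \<open>U\<close> (a bijective local
  diffeomorphism) which maps \<open>T^p \<times> {0}\<close> onto \<open>N\<close>.\<close>

definition tubular_coordinates ::
  "('a::topological_space, 'n::finite) chart set \<Rightarrow> 'a set \<Rightarrow> 'a set \<Rightarrow> ('p::finite \<Rightarrow> 'n) \<Rightarrow> (real ^ 'n \<Rightarrow> 'a) \<Rightarrow> bool" where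
  "tubular_coordinates A N U e \<Phi> \<longleftrightarrow>
     inj e \<and> open U \<and> \<Phi> ` angle_domain e = U \<and> \<Phi> ` range (angle_vec e) = N \<and>
     (\<forall>\<theta> \<theta>'. \<forall>z\<in>unit_ball_q e. \<forall>z'\<in>unit_ball_q e.
        \<Phi> (angle_vec e \<theta> + z) = \<Phi> (angle_vec e \<theta>' + z') \<longleftrightarrow> z = z' \<and> (\<forall>j. \<theta> $ j - \<theta>' $ j \<in> \<int>)) \<and>
     continuous_on (angle_domain e) \<Phi> \<and>
     (\<forall>c\<in>A. smooth_on {u \<in> angle_domain e. \<Phi> u \<in> fst c} (\<lambda>u. snd c (\<Phi> u)) \<and>
        (\<forall>u\<in>angle_domain e. \<Phi> u \<in> fst c \<longrightarrow> invertible (jacobian (\<lambda>u. snd c (\<Phi> u)) (at u))))"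

text \<open>A smooth free action of \<open>T^p\<close> on \<open>U\<close>, written as an action of \<open>R^p\<close> for which the stabiliser of
  every point is exactly \<open>Z^p\<close>.\<close>

definition free_torus_action ::
  "('a::topological_space, 'n::finite) chart set \<Rightarrow> 'a set \<Rightarrow> (real ^ 'p::finite \<Rightarrow> 'a \<Rightarrow> 'a) \<Rightarrow> bool" where
  "free_torus_action A U \<rho> \<longleftrightarrow>
     (\<forall>x\<in>U. \<rho> 0 x = x) \<and>
     (\<forall>s. \<forall>x\<in>U. \<rho> s x \<in> U) \<and>
     (\<forall>s t. \<forall>x\<in>U. \<rho> (s + t) x = \<rho> s (\<rho> t x)) \<and>
     (\<forall>s. \<forall>x\<in>U. \<rho> s x = x \<longleftrightarrow> (\<forall>j. s $ j \<in> \<int>)) \<and>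
     continuous_on (UNIV \<times> U) (\<lambda>(s, x). \<rho> s x) \<and>
     (\<forall>c\<in>A. \<forall>d\<in>A. smooth_on {(s, u). u \<in> snd c ` (U \<inter> fst c) \<and> \<rho> s (chart_inv c u) \<in> fst d}
        (\<lambda>(s, u). snd d (\<rho> s (chart_inv c u))))"

definition liouville_torus_action ::
  "('a::topological_space, 'n::finite) chart set \<Rightarrow> nat \<Rightarrow> (nat \<Rightarrow> 'a \<Rightarrow> ('a, 'n) fibre_elem) \<Rightarrow>
   nat \<Rightarrow> (nat \<Rightarrow> 'a \<Rightarrow> real) \<Rightarrow> 'a set \<Rightarrow> 'a set \<Rightarrow> (real ^ 'p::finite \<Rightarrow> 'a \<Rightarrow> 'a) \<Rightarrow> bool" where
  "liouville_torus_action A p X q F N U \<rho> \<longleftrightarrow>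
     (\<exists>(e :: 'p \<Rightarrow> 'n) \<Phi>. tubular_coordinates A N U e \<Phi>) \<and>
     free_torus_action A U \<rho> \<and>
     (\<forall>i\<in>{1..p}. \<forall>s. \<forall>x\<in>U. pushforward A Tangent (\<rho> s) x (X i x) = X i (\<rho> s x)) \<and>
     (\<forall>j\<in>{1..q}. \<forall>s. \<forall>x\<in>U. F j (\<rho> s x) = F j x) \<and>
     (\<forall>x\<in>U. level_set q F (range (\<lambda>s. \<rho> s x)) \<and> regular_at A p X q F (range (\<lambda>s. \<rho> s x)))"

text \<open>Coordinates as in Liouville's theorem: the action \<open>\<rho>\<close> is generated by the \<open>\<partial>/\<partial>\<theta>\<^sub>j\<close>, the \<open>F j\<close>
  depend only on \<open>z\<close>, and \<open>X i = (\<Sum>j. a i j z * \<partial>/\<partial>\<theta>\<^sub>j)\<close>.\<close>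

definition liouville_coordinates ::
  "('a::topological_space, 'n::finite) chart set \<Rightarrow> nat \<Rightarrow> (nat \<Rightarrow> 'a \<Rightarrow> ('a, 'n) fibre_elem) \<Rightarrow>
   nat \<Rightarrow> (nat \<Rightarrow> 'a \<Rightarrow> real) \<Rightarrow> 'a set \<Rightarrow> 'a set \<Rightarrow> (real ^ 'p::finite \<Rightarrow> 'a \<Rightarrow> 'a) \<Rightarrow>
   ('p \<Rightarrow> 'n) \<Rightarrow> (real ^ 'n \<Rightarrow> 'a) \<Rightarrow> bool" where
  "liouville_coordinates A p X q F N U \<rho> e \<Phi> \<longleftrightarrow>
     tubular_coordinates A N U e \<Phi> \<and>
     (\<forall>s \<theta>. \<forall>z\<in>unit_ball_q e. \<rho> s (\<Phi> (angle_vec e \<theta> + z)) = \<Phi> (angle_vec e (\<theta> + s) + z)) \<and>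
     (\<forall>j\<in>{1..q}. \<forall>\<theta>. \<forall>z\<in>unit_ball_q e. F j (\<Phi> (angle_vec e \<theta> + z)) = F j (\<Phi> z)) \<and>
     (\<exists>a :: nat \<Rightarrow> 'p \<Rightarrow> real ^ 'n \<Rightarrow> real.
        \<forall>i\<in>{1..p}. \<forall>\<theta>. \<forall>z\<in>unit_ball_q e. \<forall>c\<in>charts_at A (\<Phi> (angle_vec e \<theta> + z)).
          vec_comp c (X i (\<Phi> (angle_vec e \<theta> + z))) =
          (\<Sum>j\<in>UNIV. a i j z *\<^sub>R
             frechet_derivative (\<lambda>u. snd c (\<Phi> u)) (at (angle_vec e \<theta> + z)) (axis (e j) 1)))"

definition completely_irrational_near ::
  "'p::finite itself \<Rightarrow> ('a::topological_space, 'n::finite) chart set \<Rightarrow> nat \<Rightarrow>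
   (nat \<Rightarrow> 'a \<Rightarrow> ('a, 'n) fibre_elem) \<Rightarrow> nat \<Rightarrow> (nat \<Rightarrow> 'a \<Rightarrow> real) \<Rightarrow> 'a set \<Rightarrow> bool" where
  "completely_irrational_near (_ :: 'p itself) A p X q F N \<longleftrightarrow>
     (\<exists>U (\<rho> :: real ^ 'p \<Rightarrow> 'a \<Rightarrow> 'a) e \<Phi>.
        liouville_torus_action A p X q F N U \<rho> \<and>
        liouville_coordinates A p X q F N U \<rho> e \<Phi> \<and>
        unit_ball_q e \<subseteq> closure {z \<in> unit_ball_q e.
          \<forall>x \<in> range (\<lambda>\<theta>. \<Phi> (angle_vec e \<theta> + z)).
            range (\<lambda>\<theta>. \<Phi> (angle_vec e \<theta> + z)) \<subseteq> closure (orbit A (X 1) x)})"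

end

theory Submission
  imports Defs
begin

text \<open>Let \<open>x\<close> lie in \<open>U\<close>. The orbits of the torus action \<open>\<rho>\<close> are level sets of the \<open>F j\<close>, so at \<open>x\<close> their
  tangent space is the common kernel of the \<open>dF j\<close>, and a field \<open>X = X i\<close> of the system is tangent to
  them: \<open>X\<close> at \<open>x\<close> is the velocity of \<open>t \<mapsto> \<rho> (t \<alpha>(x)) x\<close> for a unique frequency vector \<open>\<alpha>(x) \<in> R^p\<close>.
  Since \<open>X\<close> is \<open>\<rho>\<close>-invariant, so is \<open>\<alpha>\<close>, and the flow of \<open>X\<close> on \<open>U\<close> is \<open>y \<mapsto> \<rho> (t \<alpha>(y)) y\<close>. It is not the
  torus translation by \<open>t \<alpha>(x)\<close>, because \<open>\<alpha>\<close> varies from torus to torus; its derivative at \<open>x\<close> is the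
  derivative of that translation composed with the shear \<open>1 + t N\<close>, where \<open>N w\<close> is the infinitesimal
  action of \<open>d\<alpha>(w)\<close>. As \<open>\<alpha>\<close> is constant along the orbits, \<open>N\<^sup>2 = 0\<close>
  (\<open>flow_jac\<close>, \<open>shear_nilpotent\<close>).

  Suppose that the flow of \<open>X\<close> preserves \<open>V\<close>. Pull all fibres of \<open>V\<close> over the orbit of \<open>x\<close> back to the
  fibre over \<open>x\<close> by the translations \<open>\<rho> s\<close>; this gives subspaces \<open>S(s)\<close> that depend on \<open>s \<in> R^p\<close> in a
  closed way and are \<open>Z^p\<close>-periodic. For \<open>v\<close> in \<open>S(0)\<close> the vector that \<open>1 + t N\<close> makes of \<open>v\<close> lies in
  \<open>S(t \<alpha>)\<close>, and it is a polynomial in \<open>t\<close>, since a natural bundle transforms by polynomials in the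
  entries of a matrix and of its inverse, and \<open>1 + t N\<close> has the inverse \<open>1 - t N\<close>. There are \<open>t\<close> tending
  to infinity for which \<open>t \<alpha>\<close> returns to \<open>Z^p\<close> up to a small error. Along them the polynomial divided by
  the highest power of \<open>t\<close> converges to the leading coefficient, which therefore lies in \<open>S(0)\<close>, and
  likewise in every \<open>S(t \<alpha>)\<close>. Subtracting the leading term and repeating the argument shows that all
  coefficients lie in all \<open>S(t \<alpha>)\<close> (\<open>recurrent_polynomial_coeffs\<close>). The constant coefficient is \<open>v\<close>
  itself: although the flow involves the shear, \<open>V\<close> is preserved by the pure translation by \<open>t \<alpha>(x)\<close>
  (\<open>carries_into_frequency\<close>).

  If all \<open>X i\<close> conserve \<open>V\<close>, their frequency vectors at \<open>x\<close> form a basis of \<open>R^p\<close>, and composing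
  translations gives every \<open>\<rho> s\<close>. If only \<open>X 1\<close> does, but its orbits are dense in the tori of a dense set,
  then \<open>S(0) \<subseteq> S(s)\<close> for all \<open>s\<close> on such a torus because \<open>S\<close> is closed, and for the remaining tori one
  passes to the limit inside the subbundle. Complete irrationality refers to a torus action of its own,
  but the orbits of both actions near \<open>N\<close> are level sets of the \<open>F j\<close>, hence the same sets.\<close>

section \<open>Independent vectors and limits of linear combinations\<close>

lemma sum_minus_multiple:
  fixes d :: real and k :: "nat \<Rightarrow> real"
  shows "(\<Sum>i<r. k i * (x i - y i / d * e)) = (\<Sum>i<r. k i * x i) - (\<Sum>i<r. k i * y i) / d * e"
proof -
  have "(\<Sum>i<r. k i * (x i - y i / d * e)) = (\<Sum>i<r. k i * x i - k i * y i * (e / d))"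
    by (simp add: algebra_simps)
  also have "\<dots> = (\<Sum>i<r. k i * x i) - (\<Sum>i<r. k i * y i) * (e / d)"
    by (simp only: sum_subtractf sum_distrib_right)
  finally show ?thesis by simp
qed

text \<open>The limit of linear combinations of vectors that converge to independent vectors is a linear
  combination of their limits. The proof is Gaussian elimination, one vector at a time, which keeps
  track of the coefficients although nothing is known about their size beforehand.\<close>

lemma lin_comb_limit:
  fixes f :: "nat \<Rightarrow> 'b \<Rightarrow> 'i \<Rightarrow> real"
  assumes "\<F> \<noteq> bot"
    and "\<And>i a. i < r \<Longrightarrow> ((\<lambda>b. f i b a) \<longlongrightarrow> g i a) \<F>"
    and "\<And>k. (\<And>a. (\<Sum>i<r. k i * g i a) = 0) \<Longrightarrow> \<forall>i<r. k i = 0"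
    and "\<forall>\<^sub>F b in \<F>. \<forall>a. w b a = (\<Sum>i<r. k b i * f i b a)"
    and "\<And>a. ((\<lambda>b. w b a) \<longlongrightarrow> v a) \<F>"
  shows "\<exists>k. \<forall>a. v a = (\<Sum>i<r. k i * g i a)"
  using assms(2-5)
proof (induction r arbitrary: f g w v)
  case 0
  have "v a = 0" for a
  proof (rule tendsto_unique[OF assms(1) 0(4)])
    have "\<forall>\<^sub>F b in \<F>. w b a = 0" using 0(3) by (auto elim: eventually_mono)
    then show "((\<lambda>b. w b a) \<longlongrightarrow> 0) \<F>" by (simp add: tendsto_eventually)
  qed
  then show ?case by simp
next
  case (Suc r)
  obtain a0 where a0: "g r a0 \<noteq> 0"
  proof (rule ccontr)
    assume "\<not> thesis"
    with that have "g r a = 0" for a by blast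
    then have "(\<Sum>i<Suc r. (if i = r then 1 else 0) * g i a) = 0" for a by simp
    from Suc.prems(2)[OF this] show False by auto
  qed
  have ev: "\<forall>\<^sub>F b in \<F>. f r b a0 \<noteq> 0"
    using Suc.prems(1)[of r a0] a0 by (simp add: tendsto_imp_eventually_ne)
  define f' where "f' = (\<lambda>i b a. f i b a - f i b a0 / f r b a0 * f r b a)"
  define g' where "g' = (\<lambda>i a. g i a - g i a0 / g r a0 * g r a)"
  define w' where "w' = (\<lambda>b a. w b a - w b a0 / f r b a0 * f r b a)"
  define v' where "v' = (\<lambda>a. v a - v a0 / g r a0 * g r a)"
  have "\<exists>k. \<forall>a. v' a = (\<Sum>i<r. k i * g' i a)"
  proof (rule Suc.IH)
    show "((\<lambda>b. f' i b a) \<longlongrightarrow> g' i a) \<F>" if "i < r" for i a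
      unfolding f'_def g'_def using that a0 by (auto intro!: tendsto_intros Suc.prems(1))
    show "((\<lambda>b. w' b a) \<longlongrightarrow> v' a) \<F>" for a
      unfolding w'_def v'_def using a0 by (auto intro!: tendsto_intros Suc.prems)
    show "\<forall>\<^sub>F b in \<F>. \<forall>a. w' b a = (\<Sum>i<r. k b i * f' i b a)"
      using ev Suc.prems(3)
    proof eventually_elim
      case (elim b)
      then show ?case unfolding w'_def f'_def sum_minus_multiple
        by (auto simp: field_simps)
    qed
    show "\<forall>i<r. k i = 0" if k: "\<And>a. (\<Sum>i<r. k i * g' i a) = 0" for k
    proof -
      define k' where "k' = k(r := - (\<Sum>i<r. k i * g i a0) / g r a0)"
      have "(\<Sum>i<Suc r. k' i * g i a) = 0" for a
      proof -
        have "(\<Sum>i<Suc r. k' i * g i a) = (\<Sum>i<r. k i * g' i a)"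
          using a0 unfolding g'_def sum_minus_multiple by (simp add: k'_def field_simps)
        then show ?thesis using k by simp
      qed
      from Suc.prems(2)[OF this] have "k' i = 0" if "i < r" for i using that by simp
      then show ?thesis by (auto simp: k'_def split: if_splits)
    qed
  qed
  then obtain k where k: "\<And>a. v' a = (\<Sum>i<r. k i * g' i a)" by blast
  define k' where "k' = k(r := v a0 / g r a0 - (\<Sum>i<r. k i * g i a0) / g r a0)"
  have "v a = (\<Sum>i<Suc r. k' i * g i a)" for a
  proof -
    have "v a = v' a + v a0 / g r a0 * g r a" by (simp add: v'_def)
    also have "\<dots> = (\<Sum>i<Suc r. k' i * g i a)"
      using a0 unfolding k g'_def sum_minus_multiple by (simp add: k'_def field_simps)
    finally show ?thesis .
  qed
  then show ?case by blast
qed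

text \<open>If \<open>v i0\<close> is a combination of the other vectors, then the wedge product, which is linear in its
  \<open>i0\<close>-th argument, is a combination of products with a repeated factor. Those vanish because a
  transposition changes the sign of each of their terms.\<close>

lemma wedge_nonzero_imp_independent:
  assumes nz: "wedge k v \<noteq> (\<lambda>\<iota>. 0)" and sum0: "(\<Sum>i\<in>{1..k}. c i *\<^sub>R v i) = 0"
  shows "\<forall>i\<in>{1..k}. c i = 0"
proof (rule ccontr)
  assume "\<not> ?thesis"
  then obtain i0 where i0: "i0 \<in> {1..k}" "c i0 \<noteq> 0" by blast
  have "wedge k v \<iota> = 0" for \<iota>
  proof -
    define R where "R = (\<lambda>\<sigma>. of_int (sign \<sigma>) * (\<Prod>i\<in>{1..k} - {i0}. v i $ \<iota> (\<sigma> i)) :: real)"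
    \<comment> \<open>\<open>\<Delta> w\<close> is the component \<open>\<iota>\<close> of the product in which \<open>w\<close> replaces \<open>v i0\<close>.\<close>
    define \<Delta> where "\<Delta> = (\<lambda>w. \<Sum>\<sigma> | \<sigma> permutes {1..k}. R \<sigma> * w $ \<iota> (\<sigma> i0))"
    have wedge_upd: "wedge k (v(i0 := w)) \<iota> = \<Delta> w" for w
    proof -
      have "(\<Prod>i=1..k. (v(i0 := w)) i $ \<iota> (\<sigma> i)) = w $ \<iota> (\<sigma> i0) * (\<Prod>i\<in>{1..k} - {i0}. v i $ \<iota> (\<sigma> i))" for \<sigma>
        unfolding prod.remove[OF finite_atLeastAtMost i0(1)] by (auto intro!: prod.cong)
      then show ?thesis by (simp add: wedge_def \<Delta>_def R_def mult_ac)
    qed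
    have repeated: "\<Delta> (v j) = 0" if j: "j \<in> {1..k}" "j \<noteq> i0" for j
    proof -
      let ?u = "v(i0 := v j)" and ?T = "Transposition.transpose i0 j"
      have perm: "?T permutes {1..k}" using i0(1) j(1) by (rule permutes_swap_id)
      have prod_swap: "(\<Prod>i=1..k. ?u i $ \<iota> (\<sigma> (?T i))) = (\<Prod>i=1..k. ?u i $ \<iota> (\<sigma> i))" for \<sigma>
      proof -
        have u: "?u (?T i) = ?u i" for i using j by (auto simp: Transposition.transpose_def)
        have "(\<Prod>i=1..k. ?u i $ \<iota> (\<sigma> i)) = (\<Prod>i=1..k. ?u (?T i) $ \<iota> (\<sigma> (?T i)))"
          using prod.permute[OF perm, of "\<lambda>i. ?u i $ \<iota> (\<sigma> i)"] by (simp add: o_def)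
        then show ?thesis unfolding u by simp
      qed
      have sgn: "sign (\<sigma> \<circ> ?T) = - sign \<sigma>" if "\<sigma> permutes {1..k}" for \<sigma>
        using that perm j(2)
        by (subst sign_compose) (auto simp: sign_swap_id intro: permutation_permutes[THEN iffD2])
      have "wedge k ?u \<iota> = (\<Sum>\<sigma> | \<sigma> permutes {1..k}. of_int (sign (\<sigma> \<circ> ?T)) * (\<Prod>i=1..k. ?u i $ \<iota> ((\<sigma> \<circ> ?T) i)))"
        unfolding wedge_def by (rule sum_permutations_compose_right[OF perm])
      also have "\<dots> = - wedge k ?u \<iota>"
        unfolding wedge_def sum_negf[symmetric] by (intro sum.cong refl)
          (simp only: mem_Collect_eq sgn of_int_minus mult_minus_left comp_apply prod_swap)
      finally show ?thesis unfolding wedge_upd by simp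
    qed
    have \<Delta>_sum: "\<Delta> (\<Sum>i\<in>I. c i *\<^sub>R v i) = (\<Sum>i\<in>I. c i * \<Delta> (v i))" for I
      unfolding \<Delta>_def sum_distrib_left by (subst sum.swap) (simp add: sum_distrib_left mult_ac)
    have "0 = \<Delta> (\<Sum>i\<in>{1..k}. c i *\<^sub>R v i)" unfolding sum0 by (simp add: \<Delta>_def)
    also have "\<dots> = c i0 * \<Delta> (v i0) + (\<Sum>i\<in>{1..k} - {i0}. c i * \<Delta> (v i))"
      unfolding \<Delta>_sum using i0(1) by (simp add: sum.remove)
    also have "(\<Sum>i\<in>{1..k} - {i0}. c i * \<Delta> (v i)) = 0"
      by (intro sum.neutral) (auto simp: repeated)
    finally have "\<Delta> (v i0) = 0" using i0(2) by simp
    then show ?thesis using wedge_upd[of "v i0"] by simp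
  qed
  then show False using nz by auto
qed

lemma independent_family_span:
  fixes f :: "'i \<Rightarrow> 'v::euclidean_space"
  assumes fin: "finite I" and ind: "\<And>c. (\<Sum>i\<in>I. c i *\<^sub>R f i) = 0 \<Longrightarrow> \<forall>i\<in>I. c i = 0"
  shows "inj_on f I" and "dim (span (f ` I)) = card I"
proof -
  show inj: "inj_on f I"
  proof (rule inj_onI, rule ccontr)
    fix i j assume ij: "i \<in> I" "j \<in> I" "f i = f j" "i \<noteq> j"
    define c where "c = (\<lambda>k. if k = i then 1 else if k = j then -1 else 0 :: real)"
    have "(\<Sum>k\<in>I. c k *\<^sub>R f k) = (\<Sum>k\<in>{i, j}. c k *\<^sub>R f k)"
      by (rule sum.mono_neutral_right) (use ij fin in \<open>auto simp: c_def\<close>)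
    also have "\<dots> = 0" using ij by (simp add: c_def)
    finally have "c i = 0" using ind ij(1) by blast
    then show False by (simp add: c_def)
  qed
  have "independent (f ` I)"
    unfolding independent_explicit
  proof (intro conjI allI impI ballI)
    fix u v assume "(\<Sum>v\<in>f ` I. u v *\<^sub>R v) = 0" "v \<in> f ` I"
    then show "u v = 0" using ind[of "\<lambda>i. u (f i)"] by (auto simp: sum.reindex[OF inj])
  qed (simp add: fin)
  then show "dim (span (f ` I)) = card I"
    by (simp add: dim_eq_card_independent card_image[OF inj])
qed

lemma in_span_family:
  fixes f :: "'i \<Rightarrow> 'v::real_vector"
  assumes "finite I" "inj_on f I" "x \<in> span (f ` I)"
  obtains c where "x = (\<Sum>i\<in>I. c i *\<^sub>R f i)"
proof -
  obtain u where "x = (\<Sum>v\<in>f ` I. u v *\<^sub>R v)"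
    using assms(3) span_finite[OF finite_imageI[OF assms(1)], of f] by auto
  then show ?thesis using that[of "\<lambda>i. u (f i)"] by (simp add: sum.reindex[OF assms(2)])
qed

section \<open>Matrices\<close>

lemma matrix_inv_both:
  fixes L :: "real ^ 'n ^ 'n"
  assumes "invertible L"
  shows "L ** matrix_inv L = mat 1" "matrix_inv L ** L = mat 1"
  using someI_ex[OF assms[unfolded invertible_def]] unfolding matrix_inv_def by auto

lemma matrix_inv_eqI:
  fixes L :: "real ^ 'n ^ 'n"
  assumes "L ** M = mat 1"
  shows "matrix_inv L = M" "invertible L"
proof -
  have lt: "M ** L = mat 1" using assms matrix_left_right_inverse by blast
  show inv0: "invertible L" using assms lt by (auto simp: invertible_def)
  have "matrix_inv L = matrix_inv L ** (L ** M)" using assms by simp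
  also have "\<dots> = M" using inv0 by (simp add: matrix_mul_assoc matrix_inv_both)
  finally show "matrix_inv L = M" .
qed

lemma matrix_inv_mult:
  fixes L M :: "real ^ 'n ^ 'n"
  assumes "invertible L" "invertible M"
  shows "matrix_inv (L ** M) = matrix_inv M ** matrix_inv L"
proof (rule matrix_inv_eqI)
  have "L ** M ** (matrix_inv M ** matrix_inv L) = L ** (M ** matrix_inv M) ** matrix_inv L"
    by (simp add: matrix_mul_assoc)
  then show "L ** M ** (matrix_inv M ** matrix_inv L) = mat 1"
    using assms by (simp add: matrix_inv_both)
qed

lemma nilpotent_inverse:
  fixes N :: "real ^ 'n ^ 'n"
  assumes "N ** N = 0"
  shows "(mat 1 + t *\<^sub>R N) ** (mat 1 + (- t) *\<^sub>R N) = mat 1"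
proof -
  have "N *v (N *v x) = 0" for x
    using assms by (simp add: matrix_vector_mul_assoc)
  then have "(mat 1 + t *\<^sub>R N) *v ((mat 1 + (- t) *\<^sub>R N) *v x) = x" for x
    by (simp add: matrix_vector_mult_add_rdistrib matrix_vector_right_distrib matrix_vector_mult_scaleR
      matrix_vector_mult_diff_rdistrib matrix_vector_mult_diff_distrib flip: scaleR_matrix_vector_assoc)
  then show ?thesis by (simp add: matrix_eq flip: matrix_vector_mul_assoc)
qed

lemma tendsto_det:
  fixes L :: "'b \<Rightarrow> real ^ 'n ^ 'n"
  assumes "\<And>i j. ((\<lambda>b. L b $ i $ j) \<longlongrightarrow> M $ i $ j) \<F>"
  shows "((\<lambda>b. det (L b)) \<longlongrightarrow> det M) \<F>"
  unfolding det_def by (intro tendsto_intros assms)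

lemma tendsto_matrix_inv:
  fixes L :: "'b \<Rightarrow> real ^ 'n ^ 'n"
  assumes L: "\<And>i j. ((\<lambda>b. L b $ i $ j) \<longlongrightarrow> M $ i $ j) \<F>" and "invertible M"
  shows "((\<lambda>b. matrix_inv (L b) $ i $ j) \<longlongrightarrow> matrix_inv M $ i $ j) \<F>"
proof -
  have dM: "det M \<noteq> 0" using assms(2) by (simp add: invertible_det_nz)
  have inv: "matrix_inv K $ i $ j = det (\<chi> i' j'. if j' = i then axis j 1 $ i' else K $ i' $ j') / det K"
    if "det K \<noteq> 0" for K :: "real ^ 'n ^ 'n"
  proof -
    have "K ** matrix_inv K = mat 1"
      using that by (simp add: matrix_inv_both invertible_det_nz)
    then have "K *v (matrix_inv K *v axis j 1) = axis j 1"
      by (simp add: matrix_vector_mul_assoc)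
    then have "matrix_inv K *v axis j 1 = (\<chi> k. det (\<chi> i' j'. if j' = k then axis j 1 $ i' else K $ i' $ j') / det K)"
      using cramer[OF that] by blast
    then show ?thesis by (simp add: matrix_vector_mult_basis column_def vec_eq_iff)
  qed
  have "((\<lambda>b. det (\<chi> i' j'. if j' = i then axis j 1 $ i' else L b $ i' $ j') / det (L b)) \<longlongrightarrow> matrix_inv M $ i $ j) \<F>"
    unfolding inv[OF dM] using dM by (intro tendsto_divide tendsto_det L) (auto simp: L)
  moreover have "\<forall>\<^sub>F b in \<F>. det (L b) \<noteq> 0"
    using tendsto_det[of L, OF L] dM by (simp add: tendsto_imp_eventually_ne)
  ultimately show ?thesis
    by (rule Lim_transform_eventually[OF _ eventually_mono]) (simp add: inv)
qed

lemma differentiable_det: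
  fixes L :: "'x::real_normed_vector \<Rightarrow> real ^ 'n ^ 'n"
  assumes "\<And>i j. (\<lambda>x. L x $ i $ j) differentiable (at x)"
  shows "(\<lambda>x. det (L x)) differentiable (at x)"
proof -
  obtain L' where "\<And>i j. ((\<lambda>x. L x $ i $ j) has_derivative L' i j) (at x)"
    using assms unfolding differentiable_def by metis
  then have "((\<lambda>x. \<Prod>i\<in>UNIV. L x $ i $ p i) has_derivative
      (\<lambda>y. \<Sum>i\<in>UNIV. L' i (p i) y * (\<Prod>j\<in>UNIV - {i}. L x $ j $ p j))) (at x)" for p
    by (intro has_derivative_prod) auto
  then have "(\<lambda>x. \<Prod>i\<in>UNIV. L x $ i $ p i) differentiable (at x)" for p
    by (rule differentiableI)
  then show ?thesis unfolding det_def
    by (intro differentiable_sum differentiable_mult differentiable_const) auto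
qed

lemma differentiable_vecI:
  fixes f :: "'x::real_normed_vector \<Rightarrow> real ^ 'n"
  assumes "\<And>i. (\<lambda>x. f x $ i) differentiable (at x)"
  shows "f differentiable (at x)"
proof -
  have "f = (\<lambda>x. \<Sum>i\<in>UNIV. f x $ i *\<^sub>R axis i 1)"
    by (rule ext) (simp add: basis_expansion flip: scalar_mult_eq_scaleR)
  moreover have "(\<lambda>x. \<Sum>i\<in>UNIV. f x $ i *\<^sub>R axis i (1::real)) differentiable (at x)"
  proof (intro differentiable_sum ballI)
    show "(\<lambda>x. f x $ i *\<^sub>R axis i (1::real)) differentiable (at x)" for i
      using assms[of i] unfolding differentiable_def by (metis has_derivative_scaleR_left)
  qed auto
  ultimately show ?thesis by simp
qed

text \<open>By Cramer's rule the solution of a linear system is a rational function of its coefficients.\<close>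

lemma differentiable_linear_solution:
  fixes L :: "'x::real_normed_vector \<Rightarrow> real ^ 'n ^ 'n"
  assumes "\<And>i j. (\<lambda>x. L x $ i $ j) differentiable (at x)" "\<And>i. (\<lambda>x. b x $ i) differentiable (at x)"
    and "invertible (L x)" "\<forall>\<^sub>F y in nhds x. L y *v a y = b y"
  shows "a differentiable (at x)"
proof -
  have dx: "det (L x) \<noteq> 0" using assms(3) by (simp add: invertible_det_nz)
  define a' where "a' = (\<lambda>y. \<chi> k. det (\<chi> i j. if j = k then b y $ i else L y $ i $ j) / det (L y))"
  have "a' differentiable (at x)"
  proof (rule differentiable_vecI)
    fix k
    have "(\<lambda>y. det (\<chi> i j. if j = k then b y $ i else L y $ i $ j)) differentiable (at x)"
    proof (rule differentiable_det)
      show "(\<lambda>y. (\<chi> i j. if j = k then b y $ i else L y $ i $ j) $ i $ j) differentiable (at x)" for i j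
        using assms(1,2) by (cases "j = k") simp_all
    qed
    then show "(\<lambda>y. a' y $ k) differentiable (at x)"
      using dx unfolding a'_def by (auto intro!: differentiable_divide differentiable_det assms)
  qed
  then obtain D where "(a' has_derivative D) (at x)" unfolding differentiable_def by blast
  moreover have "continuous (at x) (\<lambda>y. det (L y))"
    by (intro differentiable_imp_continuous_within differentiable_det assms)
  then have "\<forall>\<^sub>F y in at x. det (L y) \<noteq> 0"
    using dx by (auto simp: continuous_within intro: tendsto_imp_eventually_ne)
  then have "\<forall>\<^sub>F y in nhds x. det (L y) \<noteq> 0"
    using dx eventually_nhds_conv_at by blast
  with assms(4) have ev: "\<forall>\<^sub>F y in nhds x. a' y = a y"
    by eventually_elim (simp add: a'_def cramer)
  ultimately have "(a has_derivative D) (at x)"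
    using has_derivative_transform_eventually[of a' D x UNIV a] eventually_nhds_x_imp_x[OF ev]
    by (auto simp: eventually_nhds_conv_at)
  then show ?thesis by (rule differentiableI)
qed

section \<open>The model representation\<close>

lemma finite_indices: "finite (indices E :: 'n::finite comp_index set)"
proof (induction E)
  case (Tensor_Product E E')
  have "indices (Tensor_Product E E') = (\<lambda>(a, b). In_Pair a b) ` (indices E \<times> (indices E' :: 'n comp_index set))"
    by auto
  then show ?case using Tensor_Product by simp
qed auto

lemma sum_indices:
  fixes f :: "'n::finite comp_index \<Rightarrow> real"
  shows "sum f (indices Tangent) = (\<Sum>i\<in>UNIV. f (Coord i))"
    and "sum f (indices Cotangent) = (\<Sum>i\<in>UNIV. f (Coord i))"
    and "sum f (indices Trivial_Line) = f Scalar"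
    and "sum f (indices (Direct_Sum E E')) = (\<Sum>a\<in>indices E. f (In_Left a)) + (\<Sum>a\<in>indices E'. f (In_Right a))"
    and "sum f (indices (Tensor_Product E E')) = (\<Sum>a\<in>indices E. \<Sum>b\<in>indices E'. f (In_Pair a b))"
proof -
  show "sum f (indices Tangent) = (\<Sum>i\<in>UNIV. f (Coord i))"
    "sum f (indices Cotangent) = (\<Sum>i\<in>UNIV. f (Coord i))"
    by (simp_all add: sum.reindex inj_on_def)
  show "sum f (indices Trivial_Line) = f Scalar" by simp
  show "sum f (indices (Direct_Sum E E')) = (\<Sum>a\<in>indices E. f (In_Left a)) + (\<Sum>a\<in>indices E'. f (In_Right a))"
    by (simp, subst sum.union_disjoint) (auto simp: finite_indices sum.reindex inj_on_def)
  have *: "indices (Tensor_Product E E') = (\<lambda>(a, b). In_Pair a b) ` (indices E \<times> (indices E' :: 'n comp_index set))"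
    by auto
  show "sum f (indices (Tensor_Product E E')) = (\<Sum>a\<in>indices E. \<Sum>b\<in>indices E'. f (In_Pair a b))"
    unfolding * by (subst sum.reindex) (auto simp: inj_on_def sum.cartesian_product case_prod_beta)
qed

lemma rep_entry_outside: "a \<notin> indices E \<Longrightarrow> rep_entry E L a b = 0"
  by (induction E L a b rule: rep_entry.induct) auto

lemma rep_entry_mult:
  fixes L M :: "real ^ 'n ^ 'n"
  assumes "invertible L" "invertible M" "a \<in> indices E" "b \<in> indices E"
  shows "rep_entry E (L ** M) a b = (\<Sum>k\<in>indices E. rep_entry E L a k * rep_entry E M k b)"
  using assms(3,4)
proof (induction E arbitrary: a b)
  case Tangent
  then show ?case by (auto simp: sum_indices matrix_matrix_mult_def simp del: indices.simps(1)) (auto simp: sum.reindex inj_on_def)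
next
  case Cotangent
  then show ?case
    using matrix_inv_mult[OF assms(1,2)]
    by (auto simp: sum.reindex inj_on_def mult.commute) (simp add: matrix_matrix_mult_def mult.commute)
next
  case (Direct_Sum E E')
  have "(\<Sum>k\<in>indices (Direct_Sum E E'). rep_entry (Direct_Sum E E') L a k * rep_entry (Direct_Sum E E') M k b)
    = rep_entry (Direct_Sum E E') (L ** M) a b"
    unfolding sum_indices using Direct_Sum by auto
  then show ?case by simp
next
  case (Tensor_Product E E')
  obtain a1 a2 b1 b2 where [simp]: "a = In_Pair a1 a2" "b = In_Pair b1 b2" and
    *: "a1 \<in> indices E" "a2 \<in> indices E'" "b1 \<in> indices E" "b2 \<in> indices E'"
    using Tensor_Product.prems by auto
  show ?case unfolding sum_indices using * Tensor_Product.IH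
    by (subst sum.swap) (simp add: sum_product mult_ac sum.swap[of _ "indices E'"])
qed auto

lemma rep_entry_one:
  assumes "a \<in> indices E" "b \<in> indices E"
  shows "rep_entry E (mat 1) a b = (if a = b then 1 else 0)"
proof -
  have [simp]: "matrix_inv (mat 1 :: real ^ 'n ^ 'n) = mat 1" by (rule matrix_inv_eqI) simp
  have [simp]: "(mat 1 :: real ^ 'n ^ 'n) $ i $ j = (if i = j then 1 else 0)" for i j
    by (simp add: mat_def)
  show ?thesis using assms by (induction E arbitrary: a b) (auto split: if_splits)
qed

lemma rep_outside: "a \<notin> indices E \<Longrightarrow> rep E L v a = 0"
  by (simp add: rep_def rep_entry_outside)

lemma rep_mult:
  assumes "invertible L" "invertible M"
  shows "rep E (L ** M) v = rep E L (rep E M v)"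
proof
  fix a
  show "rep E (L ** M) v a = rep E L (rep E M v) a"
  proof (cases "a \<in> indices E")
    case True
    have "rep E (L ** M) v a = (\<Sum>b\<in>indices E. \<Sum>k\<in>indices E. rep_entry E L a k * rep_entry E M k b * v b)"
      using True assms by (simp add: rep_def rep_entry_mult sum_distrib_right)
    also have "\<dots> = rep E L (rep E M v) a"
      by (subst sum.swap) (simp add: rep_def sum_distrib_left mult.assoc)
    finally show ?thesis .
  qed (simp add: rep_outside)
qed

lemma rep_one: "(\<And>a. a \<notin> indices E \<Longrightarrow> v a = 0) \<Longrightarrow> rep E (mat 1) v = v"
  unfolding rep_def
proof
  fix a assume v: "\<And>a. a \<notin> indices E \<Longrightarrow> v a = 0"
  show "(\<Sum>b\<in>indices E. rep_entry E (mat 1) a b * v b) = v a"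
  proof (cases "a \<in> indices E")
    case True
    then have "(\<Sum>b\<in>indices E. rep_entry E (mat 1) a b * v b) = (\<Sum>b\<in>indices E. if a = b then v b else 0)"
      by (intro sum.cong) (auto simp: rep_entry_one)
    then show ?thesis using True by (simp add: finite_indices)
  qed (simp add: rep_entry_outside v)
qed

lemma rep_lincomb:
  "rep E L (\<lambda>a. c * v a + c' * w a) a = c * rep E L v a + c' * rep E L w a"
  by (simp add: rep_def sum_distrib_left sum.distrib algebra_simps)

text \<open>Entries of the representation are polynomials in the entries of a matrix and of its inverse, and
  for \<open>1 + t N\<close> both are affine in \<open>t\<close>.\<close>

lemma rep_entry_nilpotent_poly:
  fixes N :: "real ^ 'n ^ 'n"
  assumes "N ** N = 0"
  shows "\<exists>P :: real poly. \<forall>t. rep_entry E (mat 1 + t *\<^sub>R N) a b = poly P t"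
proof -
  have inv: "matrix_inv (mat 1 + t *\<^sub>R N) = mat 1 + (- t) *\<^sub>R N" for t :: real
    by (rule matrix_inv_eqI(1)[OF nilpotent_inverse[OF assms]])
  have lin: "\<exists>P :: real poly. \<forall>t. x + t * y = poly P t" for x y
    by (rule exI[of _ "[:x, y:]"]) (simp add: mult.commute)
  have zero: "\<exists>P :: real poly. \<forall>t. 0 = poly P t" by (rule exI[of _ 0]) simp
  show ?thesis
  proof (induction E "mat 1 + 0 *\<^sub>R N" a b rule: rep_entry.induct)
    case (2 i j)
    show ?case using lin[of "mat 1 $ j $ i" "- N $ j $ i"] by (simp add: inv)
  next
    case (6 E E' a a' b b')
    then obtain P Q :: "real poly" where
      "\<forall>t. rep_entry E (mat 1 + t *\<^sub>R N) a b = poly P t"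
      "\<forall>t. rep_entry E' (mat 1 + t *\<^sub>R N) a' b' = poly Q t" by auto
    then show ?case by (intro exI[of _ "P * Q"]) simp
  qed (use lin zero in \<open>auto intro: exI[of _ 1]\<close>)
qed

lemma rep_nilpotent_poly:
  fixes N :: "real ^ 'n ^ 'n"
  assumes "N ** N = 0"
  obtains P D where "\<And>t a. rep E (mat 1 + t *\<^sub>R N) w a = poly (P a) t" "\<And>a. degree (P a) \<le> D"
proof -
  have "\<exists>P :: real poly. \<forall>t. rep_entry E (mat 1 + t *\<^sub>R N) a b = poly P t" for a b
    by (rule rep_entry_nilpotent_poly[OF assms])
  then obtain R where R: "\<And>t a b. rep_entry E (mat 1 + t *\<^sub>R N) a b = poly (R a b) t" by metis
  define P where "P = (\<lambda>a. if a \<in> indices E then \<Sum>b\<in>indices E. smult (w b) (R a b) else 0)"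
  have "rep E (mat 1 + t *\<^sub>R N) w a = poly (P a) t" for t a
    by (simp add: P_def rep_outside) (simp add: rep_def R poly_sum mult.commute)
  moreover have "degree (P a) \<le> (\<Sum>a\<in>indices E. degree (P a))" for a
  proof (cases "a \<in> indices E")
    case True
    then show ?thesis using member_le_sum[of a "indices E" "\<lambda>a. degree (P a)"] finite_indices by auto
  qed (simp add: P_def)
  ultimately show ?thesis by (rule that)
qed

lemma tendsto_rep_entry:
  fixes L :: "'b \<Rightarrow> real ^ 'n ^ 'n"
  assumes "\<And>i j. ((\<lambda>b. L b $ i $ j) \<longlongrightarrow> M $ i $ j) \<F>" "invertible M"
  shows "((\<lambda>b. rep_entry E (L b) a k) \<longlongrightarrow> rep_entry E M a k) \<F>"
  using assms
  by (induction E M a k rule: rep_entry.induct) (auto intro!: tendsto_mult tendsto_matrix_inv)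

lemma tendsto_rep:
  fixes L :: "'b \<Rightarrow> real ^ 'n ^ 'n"
  assumes "\<And>i j. ((\<lambda>b. L b $ i $ j) \<longlongrightarrow> M $ i $ j) \<F>" "invertible M" "\<And>a. ((\<lambda>b. w b a) \<longlongrightarrow> v a) \<F>"
  shows "((\<lambda>b. rep E (L b) (w b) a) \<longlongrightarrow> rep E M v a) \<F>"
  unfolding rep_def by (intro tendsto_intros tendsto_rep_entry assms)

section \<open>Recurrent polynomial curves\<close>

text \<open>The multiples \<open>n \<beta>\<close> reduced modulo \<open>Z^p\<close> have a convergent subsequence in the unit cube, so
  differences of indices far apart along it nearly return to the lattice.\<close>

lemma exists_recurrence_times:
  fixes \<beta> :: "real ^ 'p"
  obtains \<tau> :: "nat \<Rightarrow> real" and m :: "nat \<Rightarrow> real ^ 'p"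
  where "filterlim \<tau> at_top sequentially" "\<And>n j. m n $ j \<in> \<int>"
    "(\<lambda>n. \<tau> n *\<^sub>R \<beta> - m n) \<longlonglongrightarrow> 0"
proof -
  define fl :: "nat \<Rightarrow> real ^ 'p" where "fl = (\<lambda>n. \<chi> j. of_int \<lfloor>real n * \<beta> $ j\<rfloor>)"
  define u where "u = (\<lambda>n. real n *\<^sub>R \<beta> - fl n)"
  have "u n \<in> cbox 0 1" for n
    unfolding mem_box_cart u_def fl_def by (auto simp: less_imp_le) linarith+
  then obtain l r where r: "strict_mono r" "(u \<circ> r) \<longlonglongrightarrow> l"
    using compact_cbox[of 0 "1 :: real ^ 'p"] unfolding compact_def by metis
  \<comment> \<open>The index \<open>2 n\<close> makes the difference at least \<open>n\<close>, since \<open>r\<close> is strictly increasing.\<close>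
  define \<tau> where "\<tau> = (\<lambda>n. real (r (2 * n)) - real (r n))"
  show ?thesis
  proof
    have r2: "r n + k \<le> r (n + k)" for n k
      by (induction k) (use r(1) in \<open>auto simp: strict_mono_Suc_iff less_eq_Suc_le intro: order_trans\<close>)
    have "real n \<le> \<tau> n" for n
      using r2[of n n] by (simp add: \<tau>_def mult_2)
    then show "filterlim \<tau> at_top sequentially"
      by (intro filterlim_at_top_mono[OF filterlim_real_sequentially]) auto
    show "(fl (r (2 * n)) - fl (r n)) $ j \<in> \<int>" for n j
      by (simp add: fl_def)
    have "filterlim (\<lambda>n::nat. 2 * n) sequentially sequentially"
      by (rule filterlim_subseq) (simp add: strict_mono_def)
    from filterlim_compose[OF r(2) this]
    have "(\<lambda>n. u (r (2 * n)) - u (r n)) \<longlonglongrightarrow> l - l"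
      using r(2) by (intro tendsto_diff) (auto simp: o_def)
    moreover have "u (r (2 * n)) - u (r n) = \<tau> n *\<^sub>R \<beta> - (fl (r (2 * n)) - fl (r n))" for n
      by (simp add: u_def \<tau>_def algebra_simps)
    ultimately show "(\<lambda>n. \<tau> n *\<^sub>R \<beta> - (fl (r (2 * n)) - fl (r n))) \<longlonglongrightarrow> 0"
      by simp
  qed
qed

lemma poly_shift_over_power_tendsto:
  fixes P :: "real poly"
  assumes "degree P \<le> D"
  shows "((\<lambda>x. poly P (t + x) / x ^ D) \<longlongrightarrow> coeff P D) at_top"
proof -
  have P: "poly P y = (\<Sum>i\<le>D. coeff P i * y ^ i)" for y
    by (subst poly_as_sum_of_monoms'[OF assms, symmetric]) (simp add: poly_sum poly_monom)
  have inv: "((\<lambda>x::real. 1 / x) \<longlongrightarrow> 0) at_top"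
    using tendsto_inverse_0_at_top[OF filterlim_ident] by (simp add: inverse_eq_divide)
  have "((\<lambda>x. \<Sum>i\<le>D. coeff P i * ((1 + t * (1 / x)) ^ i * (1 / x) ^ (D - i))) \<longlongrightarrow>
      (\<Sum>i\<le>D. coeff P i * ((1 + t * 0) ^ i * 0 ^ (D - i)))) at_top"
    by (intro tendsto_intros inv)
  also have "(\<Sum>i\<le>D. coeff P i * ((1 + t * 0) ^ i * 0 ^ (D - i))) = (\<Sum>i\<le>D. if i = D then coeff P i else 0)"
    by (intro sum.cong) auto
  also have "\<dots> = coeff P D" by simp
  finally show ?thesis
  proof (rule Lim_transform_eventually)
    show "\<forall>\<^sub>F x in at_top. (\<Sum>i\<le>D. coeff P i * ((1 + t * (1 / x)) ^ i * (1 / x) ^ (D - i))) = poly P (t + x) / x ^ D"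
      using eventually_gt_at_top[of 0]
    proof eventually_elim
      case (elim x)
      have "(1 + t * (1 / x)) ^ i * (1 / x) ^ (D - i) = (t + x) ^ i / x ^ D" if "i \<le> D" for i
      proof -
        have "1 + t * (1 / x) = (t + x) / x" using elim by (simp add: field_simps)
        moreover have "x ^ D = x ^ i * x ^ (D - i)" using that by (simp flip: power_add)
        ultimately show ?thesis by (simp add: power_divide)
      qed
      then show ?case by (simp add: P sum_divide_distrib)
    qed
  qed
qed

text \<open>A polynomial curve that stays in a closed periodic family of subspaces along a line has all its
  coefficients in the family: at recurrence times \<open>\<tau> n\<close> after \<open>t\<close> the normalised curve
  \<open>P (t + \<tau> n) / \<tau> n ^ D\<close> lies in subspaces that approach the one at \<open>t\<close>, and it converges to the
  coefficient of degree \<open>D\<close>. After this term has been removed, the degree has dropped.\<close>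

lemma recurrent_polynomial_coeffs:
  fixes S :: "real ^ 'p \<Rightarrow> ('i \<Rightarrow> real) set" and P :: "'i \<Rightarrow> real poly"
  assumes closed: "\<And>\<sigma> w s v. \<lbrakk>\<sigma> \<longlonglongrightarrow> s; \<And>n. w n \<in> S (\<sigma> n); \<And>a. (\<lambda>n. w n a) \<longlonglongrightarrow> v a\<rbrakk> \<Longrightarrow> v \<in> S s"
    and lincomb: "\<And>s w w' c c'. \<lbrakk>w \<in> S s; w' \<in> S s\<rbrakk> \<Longrightarrow> (\<lambda>a. c * w a + c' * w' a) \<in> S s"
    and periodic: "\<And>s m. (\<And>j. m $ j \<in> \<int>) \<Longrightarrow> S (s - m) = S s"
    and "\<And>t. (\<lambda>a. poly (P a) t) \<in> S (t *\<^sub>R \<beta>)" and "\<And>a. degree (P a) \<le> D"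
  shows "(\<lambda>a. coeff (P a) j) \<in> S (t *\<^sub>R \<beta>)"
  using assms(4,5)
proof (induction D arbitrary: P j t)
  obtain \<tau> m where \<tau>: "filterlim \<tau> at_top sequentially" and m: "\<And>n j. m n $ j \<in> \<int>"
    and \<tau>m: "(\<lambda>n. \<tau> n *\<^sub>R \<beta> - m n) \<longlonglongrightarrow> 0"
    using exists_recurrence_times[of \<beta>] by metis
  have top: "(\<lambda>a. coeff (P a) D) \<in> S (t *\<^sub>R \<beta>)"
    if P: "\<And>t. (\<lambda>a. poly (P a) t) \<in> S (t *\<^sub>R \<beta>)" and deg: "\<And>a. degree (P a) \<le> D" for P D t
  proof (rule closed)
    show "(\<lambda>n. (t + \<tau> n) *\<^sub>R \<beta> - m n) \<longlonglongrightarrow> t *\<^sub>R \<beta>"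
      using tendsto_add[OF tendsto_const[of "t *\<^sub>R \<beta>"] \<tau>m] by (simp add: algebra_simps)
    show "(\<lambda>a. poly (P a) (t + \<tau> n) / \<tau> n ^ D) \<in> S ((t + \<tau> n) *\<^sub>R \<beta> - m n)" for n
      using lincomb[OF P P, of "1 / \<tau> n ^ D" "t + \<tau> n" 0] by (simp add: periodic m)
    show "(\<lambda>n. poly (P a) (t + \<tau> n) / \<tau> n ^ D) \<longlonglongrightarrow> coeff (P a) D" for a
      using filterlim_compose[OF poly_shift_over_power_tendsto[OF deg] \<tau>] .
  qed
  {
    case 0
    show ?case
    proof (cases j)
      case 0
      then show ?thesis using top[of P 0] "0.prems" by simp
    next
      case (Suc i)
      then have "coeff (P a) j = 0" for a using "0.prems"(2)[of a] by (simp add: coeff_eq_0)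
      then show ?thesis using lincomb[OF "0.prems"(1) "0.prems"(1), of 0 t 0] by simp
    qed
  next
    case (Suc D)
    define Q where "Q = (\<lambda>a. P a - monom (coeff (P a) (Suc D)) (Suc D))"
    have top': "(\<lambda>a. coeff (P a) (Suc D)) \<in> S (t *\<^sub>R \<beta>)" for t
      using top[of P "Suc D"] Suc.prems by simp
    have "(\<lambda>a. coeff (Q a) j) \<in> S (t *\<^sub>R \<beta>)"
    proof (rule Suc.IH)
      show "(\<lambda>a. poly (Q a) t) \<in> S (t *\<^sub>R \<beta>)" for t
        using lincomb[OF Suc.prems(1)[of t] top'[of t], of 1 "- (t ^ Suc D)"]
        by (simp add: Q_def poly_monom algebra_simps)
      show "degree (Q a) \<le> D" for a
      proof (rule degree_le, intro allI impI)
        fix i assume "D < i"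
        then show "coeff (Q a) i = 0"
          using Suc.prems(2)[of a] by (cases "i = Suc D") (auto simp: Q_def coeff_eq_0)
      qed
    qed
    then show ?case using top' by (cases "j = Suc D") (simp_all add: Q_def)
  }
qed

section \<open>Charts and the natural action of local diffeomorphisms\<close>

lemma nhds_tendstoI:
  fixes f :: "'a::t2_space \<Rightarrow> 'b::t2_space"
  shows "continuous_on S f \<Longrightarrow> open S \<Longrightarrow> x \<in> S \<Longrightarrow> (f \<longlongrightarrow> f x) (nhds x)"
  using continuous_on_eq_continuous_at[of S f] tendsto_at_iff_tendsto_nhds[of f x]
  by (auto simp: isCont_def)

lemma smooth_on_differentiable:
  assumes "smooth_on S f" "x \<in> S"
  shows "f differentiable (at x)"
    and "(\<lambda>y. frechet_derivative f (at y) v) differentiable (at x)"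
proof -
  from assms(1) have "Ck_on (Suc (Suc 0)) S f" unfolding smooth_on_def by blast
  then have *: "\<forall>x\<in>S. f differentiable (at x)" "\<forall>v. Ck_on (Suc 0) S (\<lambda>y. frechet_derivative f (at y) v)"
    unfolding Ck_on.simps by blast+
  from *(1) show "f differentiable (at x)" using assms(2) by blast
  from *(2) have "\<forall>x\<in>S. (\<lambda>y. frechet_derivative f (at y) v) differentiable (at x)"
    unfolding Ck_on.simps by blast
  then show "(\<lambda>y. frechet_derivative f (at y) v) differentiable (at x)" using assms(2) by blast
qed

lemma has_derivative_eventually_cong:
  assumes "(f has_derivative D) (at x)" "\<forall>\<^sub>F y in nhds x. f y = g y"
  shows "(g has_derivative D) (at x)"
  using assms eventually_nhds_x_imp_x[OF assms(2)]
  by (auto intro!: has_derivative_transform_eventually[of f D x UNIV g] simp: eventually_at_filter elim: eventually_mono)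

lemma differentiable_eventually_cong:
  "f differentiable (at x) \<Longrightarrow> \<forall>\<^sub>F y in nhds x. f y = g y \<Longrightarrow> g differentiable (at x)"
  unfolding differentiable_def using has_derivative_eventually_cong by blast

locale manifold =
  fixes A :: "('a::t2_space, 'n::finite) chart set"
  assumes atlas: "smooth_atlas A"
begin

lemma charts_atD: "c \<in> charts_at A x \<Longrightarrow> c \<in> A" "c \<in> charts_at A x \<Longrightarrow> x \<in> fst c"
  by (auto simp: charts_at_def)

lemma chart_exists: obtains c where "c \<in> charts_at A x"
  using atlas unfolding smooth_atlas_def charts_at_def by blast

lemma chart_homeo: "c \<in> A \<Longrightarrow> homeomorphism (fst c) (snd c ` fst c) (snd c) (chart_inv c)"
  and chart_open: "c \<in> A \<Longrightarrow> open (fst c)" "c \<in> A \<Longrightarrow> open (snd c ` fst c)"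
  using atlas unfolding smooth_atlas_def by blast+

lemma chart_inv_chart: "c \<in> A \<Longrightarrow> x \<in> fst c \<Longrightarrow> chart_inv c (snd c x) = x"
  using chart_homeo by (auto simp: homeomorphism_def)

lemma tendsto_chart:
  assumes "c \<in> charts_at A x"
  shows "(snd c \<longlongrightarrow> snd c x) (nhds x)" "(chart_inv c \<longlongrightarrow> x) (nhds (snd c x))"
proof -
  have c: "c \<in> A" "x \<in> fst c" using assms by (auto simp: charts_at_def)
  have cont: "continuous_on (fst c) (snd c)" "continuous_on (snd c ` fst c) (chart_inv c)"
    using chart_homeo[OF c(1)] by (auto simp: homeomorphism_def)
  show "(snd c \<longlongrightarrow> snd c x) (nhds x)"
    using nhds_tendstoI[OF cont(1) chart_open(1)] c by blast
  show "(chart_inv c \<longlongrightarrow> x) (nhds (snd c x))"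
    using nhds_tendstoI[OF cont(2) chart_open(2)[OF c(1)], of "snd c x"] c by (simp add: chart_inv_chart)
qed

lemma eventually_in_chart: "c \<in> charts_at A x \<Longrightarrow> \<forall>\<^sub>F y in nhds x. y \<in> fst c"
  using chart_open(1) by (auto simp: charts_at_def eventually_nhds_in_open)

text \<open>\<open>chart_jacobian\<close> is an unspecified matrix where \<open>f\<close> is not differentiable; this relation also
  records the differentiability and the continuity that the chain rule requires.\<close>

definition has_chart_jac where
  "has_chart_jac c d f x L \<longleftrightarrow> c \<in> charts_at A x \<and> d \<in> charts_at A (f x) \<and>
     (f \<longlongrightarrow> f x) (nhds x) \<and> (local_rep c d f has_derivative (*v) L) (at (snd c x))"

lemma has_chart_jacD:
  assumes "has_chart_jac c d f x L"
  shows "chart_jacobian c d f x = L"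
proof -
  have "(local_rep c d f has_derivative (*v) L) (at (snd c x))" using assms by (simp add: has_chart_jac_def)
  from frechet_derivative_at[OF this, symmetric] show ?thesis
    by (simp add: chart_jacobian_def jacobian_def)
qed

lemma has_chart_jacI:
  assumes "c \<in> charts_at A x" "d \<in> charts_at A (f x)" "(f \<longlongrightarrow> f x) (nhds x)"
    "local_rep c d f differentiable (at (snd c x))"
  shows "has_chart_jac c d f x (chart_jacobian c d f x)"
  using assms jacobian_works unfolding has_chart_jac_def chart_jacobian_def by blast

lemma has_chart_jac_compose:
  assumes f: "has_chart_jac c d f x L" and g: "has_chart_jac d e g (f x) M"
  shows "has_chart_jac c e (\<lambda>y. g (f y)) x (M ** L)"
  unfolding has_chart_jac_def
proof (intro conjI)
  have c: "c \<in> charts_at A x" and d: "d \<in> charts_at A (f x)" and e: "e \<in> charts_at A (g (f x))"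
    and fc: "(f \<longlongrightarrow> f x) (nhds x)" and gc: "(g \<longlongrightarrow> g (f x)) (nhds (f x))"
    and Df: "(local_rep c d f has_derivative (*v) L) (at (snd c x))"
    and Dg: "(local_rep d e g has_derivative (*v) M) (at (snd d (f x)))"
    using f g by (auto simp: has_chart_jac_def)
  show "c \<in> charts_at A x" "e \<in> charts_at A (g (f x))" by fact+
  show "((\<lambda>y. g (f y)) \<longlongrightarrow> g (f x)) (nhds x)"
    using filterlim_compose[OF gc fc] .
  have fx: "local_rep c d f (snd c x) = snd d (f x)"
    using c by (simp add: local_rep_def chart_inv_chart charts_at_def)
  have "((local_rep d e g \<circ> local_rep c d f) has_derivative ((*v) M \<circ> (*v) L)) (at (snd c x))"
    by (rule diff_chain_at[OF Df]) (use Dg fx in simp)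
  moreover have "((*v) M \<circ> (*v) L) = (*v) (M ** L)"
    by (auto simp: matrix_vector_mul_assoc)
  ultimately have D: "((local_rep d e g \<circ> local_rep c d f) has_derivative (*v) (M ** L)) (at (snd c x))"
    by simp
  have "\<forall>\<^sub>F u in nhds (snd c x). (local_rep d e g \<circ> local_rep c d f) u = local_rep c e (\<lambda>y. g (f y)) u"
    using eventually_compose_filterlim[OF eventually_in_chart[OF d] filterlim_compose[OF fc tendsto_chart(2)[OF c]]]
    by eventually_elim (use d in \<open>simp add: local_rep_def chart_inv_chart charts_at_def\<close>)
  with D show "(local_rep c e (\<lambda>y. g (f y)) has_derivative (*v) (M ** L)) (at (snd c x))"
    by (rule has_derivative_eventually_cong)
qed

lemma has_chart_jac_cong:
  assumes f: "has_chart_jac c d f x L" and fg: "\<forall>\<^sub>F y in nhds x. f y = g y"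
  shows "has_chart_jac c d g x L"
proof -
  have c: "c \<in> charts_at A x" using f by (simp add: has_chart_jac_def)
  have gx: "g x = f x" using eventually_nhds_x_imp_x[OF fg] by simp
  have ev: "\<forall>\<^sub>F u in nhds (snd c x). local_rep c d f u = local_rep c d g u"
    using eventually_compose_filterlim[OF fg tendsto_chart(2)[OF c]]
    by eventually_elim (simp add: local_rep_def)
  have "(f \<longlongrightarrow> f x) (nhds x) \<longleftrightarrow> (g \<longlongrightarrow> g x) (nhds x)"
    unfolding gx by (rule tendsto_cong[OF fg])
  then show ?thesis
    using f has_derivative_eventually_cong[OF _ ev] unfolding has_chart_jac_def gx by blast
qed

lemma has_chart_jac_id:
  assumes "c \<in> charts_at A x" "d \<in> charts_at A x"
  shows "has_chart_jac c d id x (chart_jacobian c d id x)"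
proof (rule has_chart_jacI)
  have "smooth_on (snd c ` (fst c \<inter> fst d)) (local_rep c d id)"
    using atlas assms unfolding smooth_atlas_def charts_at_def by blast
  then show "local_rep c d id differentiable (at (snd c x))"
    using assms by (auto simp: charts_at_def intro!: smooth_on_differentiable(1))
qed (use assms in \<open>auto simp: id_def filterlim_ident\<close>)

lemma has_chart_jac_id_same:
  assumes "c \<in> charts_at A x"
  shows "has_chart_jac c c id x (mat 1)"
proof -
  have c: "c \<in> A" "x \<in> fst c" using assms by (auto simp: charts_at_def)
  have "\<forall>\<^sub>F u in nhds (snd c x). u \<in> snd c ` fst c"
    using chart_open(2)[OF c(1)] c(2) by (auto simp: eventually_nhds_in_open)
  then have "\<forall>\<^sub>F u in nhds (snd c x). u = local_rep c c id u"
    by eventually_elim (use c in \<open>auto simp: local_rep_def chart_inv_chart\<close>)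
  from has_derivative_eventually_cong[OF has_derivative_ident this]
  have "(local_rep c c id has_derivative (\<lambda>x. x)) (at (snd c x))" .
  moreover have "(*v) (mat 1 :: real ^ 'n ^ 'n) = (\<lambda>x. x)" by auto
  ultimately show ?thesis
    using assms by (auto simp: has_chart_jac_def id_def filterlim_ident)
qed

lemma has_chart_jac_inverse:
  assumes "has_chart_jac c d f x L" "has_chart_jac d c g (f x) M" "\<forall>\<^sub>F y in nhds x. g (f y) = y"
  shows "M ** L = mat 1" "L ** M = mat 1" "invertible L" "invertible M"
proof -
  have c: "c \<in> charts_at A x" using assms(1) by (simp add: has_chart_jac_def)
  have ev: "\<forall>\<^sub>F y in nhds x. g (f y) = id y" using assms(3) by simp
  show *: "M ** L = mat 1"
    using has_chart_jac_cong[OF has_chart_jac_compose[OF assms(1,2)] ev] has_chart_jac_id_same[OF c]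
    by (metis has_chart_jacD)
  then show **: "L ** M = mat 1" using matrix_left_right_inverse by blast
  show "invertible L" "invertible M" using * ** by (auto simp: invertible_def)
qed

lemma transition_invertible:
  assumes "c \<in> charts_at A x" "d \<in> charts_at A x"
  shows "invertible (chart_jacobian c d id x)"
  using has_chart_jac_inverse(3)[OF has_chart_jac_id[OF assms], of id] has_chart_jac_id[OF assms(2,1)] by auto

lemma chart_jacobian_id_comp:
  assumes "has_chart_jac c d f x L" "c' \<in> charts_at A x"
  shows "has_chart_jac c' d f x (L ** chart_jacobian c' c id x)"
  using has_chart_jac_compose[OF has_chart_jac_id[OF assms(2), of c], of d f L] assms
  by (auto simp: has_chart_jac_def)

lemma comp_chart_jacobian_id:
  assumes "has_chart_jac c d f x L" "d' \<in> charts_at A (f x)"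
  shows "has_chart_jac c d' f x (chart_jacobian d d' id (f x) ** L)"
  using has_chart_jac_compose[OF assms(1) has_chart_jac_id[OF _ assms(2)]] assms(1)
  by (auto simp: has_chart_jac_def)

lemma fibre_transition:
  "v \<in> fibre A E x \<Longrightarrow> c \<in> charts_at A x \<Longrightarrow> d \<in> charts_at A x \<Longrightarrow> v d = rep E (chart_jacobian c d id x) (v c)"
  unfolding fibre_def by blast

lemma fibre_outside: "v \<in> fibre A E x \<Longrightarrow> a \<notin> indices E \<Longrightarrow> v c a = 0"
  unfolding fibre_def by blast

lemma fibre_outside_charts: "v \<in> fibre A E x \<Longrightarrow> c \<notin> charts_at A x \<Longrightarrow> v c a = 0"
  unfolding fibre_def by blast

lemma fibre_eqI:
  assumes "v \<in> fibre A E x" "w \<in> fibre A E x" "c \<in> charts_at A x" "v c = w c"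
  shows "v = w"
proof
  fix d show "v d = w d"
  proof (cases "d \<in> charts_at A x")
    case True
    then show ?thesis
      using assms(4) fibre_transition[OF assms(1,3)] fibre_transition[OF assms(2,3)] by simp
  next
    case False
    then show ?thesis using assms(1,2) by (auto simp: fibre_outside_charts)
  qed
qed

lemma rep_sum:
  "rep E L (\<lambda>a. \<Sum>i\<in>I. k i * w i a) a = (\<Sum>i\<in>I. k i * rep E L (w i) a)"
  unfolding rep_def sum_distrib_left by (subst sum.swap) (simp add: mult_ac)

lemma fibre_lin_comb:
  assumes "\<And>i. i < r \<Longrightarrow> v i \<in> fibre A E x"
  shows "lin_comb r k v \<in> fibre A E x"
proof -
  have "lin_comb r k v d = rep E (chart_jacobian c d id x) (lin_comb r k v c)"
    if cd: "c \<in> charts_at A x" "d \<in> charts_at A x" for c d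
  proof
    fix a
    have "lin_comb r k v d a = (\<Sum>i<r. k i * rep E (chart_jacobian c d id x) (v i c) a)"
      unfolding lin_comb_def using fibre_transition[OF assms cd] by (intro sum.cong) auto
    then show "lin_comb r k v d a = rep E (chart_jacobian c d id x) (lin_comb r k v c) a"
      by (simp add: lin_comb_def rep_sum)
  qed
  moreover have "lin_comb r k v c a = 0" if "c \<notin> charts_at A x \<or> a \<notin> indices E" for c a
    using that assms fibre_outside fibre_outside_charts
    unfolding lin_comb_def by (intro sum.neutral ballI) (metis lessThan_iff mult_zero_right)
  ultimately show ?thesis unfolding fibre_def by blast
qed

text \<open>The definition of \<open>pushforward\<close> chooses a chart around \<open>x\<close>; the chain rule and the transition law
  of the fibre remove the choice.\<close>

lemma pushforward_in_chart:
  assumes f: "has_chart_jac c d f x L" and L: "invertible L" and v: "v \<in> fibre A E x"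
  shows "pushforward A E f x v d = rep E L (v c)"
proof -
  have c: "c \<in> charts_at A x" and d: "d \<in> charts_at A (f x)" using f by (auto simp: has_chart_jac_def)
  define c0 where "c0 = (SOME c. c \<in> charts_at A x)"
  have c0: "c0 \<in> charts_at A x" unfolding c0_def using c by (rule someI)
  have "pushforward A E f x v d = rep E (L ** chart_jacobian c0 c id x) (v c0)"
    using d has_chart_jacD[OF chart_jacobian_id_comp[OF f c0]]
    by (simp add: pushforward_def c0_def[symmetric] Let_def)
  also have "\<dots> = rep E L (v c)"
    by (simp add: rep_mult[OF L transition_invertible[OF c0 c]] fibre_transition[OF v c0 c])
  finally show ?thesis .
qed

lemma pushforward_in_fibre:
  assumes f: "has_chart_jac c d f x L" and L: "invertible L" and v: "v \<in> fibre A E x"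
  shows "pushforward A E f x v \<in> fibre A E (f x)"
proof -
  have "pushforward A E f x v e' = rep E (chart_jacobian e e' id (f x)) (pushforward A E f x v e)"
    if e: "e \<in> charts_at A (f x)" "e' \<in> charts_at A (f x)" for e e'
  proof -
    have d: "d \<in> charts_at A (f x)" using f by (auto simp: has_chart_jac_def)
    have je: "has_chart_jac c e f x (chart_jacobian d e id (f x) ** L)"
      by (rule comp_chart_jacobian_id[OF f e(1)])
    have inv: "invertible (chart_jacobian d e id (f x) ** L)"
      by (intro invertible_mult transition_invertible d e L)
    have je': "has_chart_jac c e' f x (chart_jacobian e e' id (f x) ** (chart_jacobian d e id (f x) ** L))"
      by (rule comp_chart_jacobian_id[OF je e(2)])
    show ?thesis
      unfolding pushforward_in_chart[OF je inv v]
        pushforward_in_chart[OF je' invertible_mult[OF transition_invertible[OF e] inv] v]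
      by (rule rep_mult[OF transition_invertible[OF e] inv])
  qed
  moreover have "pushforward A E f x v e a = 0" if "e \<notin> charts_at A (f x) \<or> a \<notin> indices E" for e a
    using that by (auto simp: pushforward_def Let_def rep_outside)
  ultimately show ?thesis unfolding fibre_def by blast
qed

text \<open>Constancy is a local matter on a connected interval, and near each time the curve stays in one
  chart.\<close>

lemma curve_constant:
  fixes J :: "real set"
  assumes J: "open J" "is_interval J" and cont: "continuous_on J \<gamma>"
    and der: "\<And>t c. t \<in> J \<Longrightarrow> c \<in> charts_at A (\<gamma> t) \<Longrightarrow> ((\<lambda>t. snd c (\<gamma> t)) has_derivative (\<lambda>h. 0)) (at t)"
    and ab: "a \<in> J" "b \<in> J"
  shows "\<gamma> a = \<gamma> b"
proof (rule connected_local_const[OF _ ab])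
  show "connected J" using J(2) by (rule is_interval_connected)
  show "\<forall>a\<in>J. \<forall>\<^sub>F b in at a within J. \<gamma> a = \<gamma> b"
  proof
    fix a :: real assume a: "a \<in> J"
    obtain c where c: "c \<in> charts_at A (\<gamma> a)" by (rule chart_exists)
    have "(\<gamma> \<longlongrightarrow> \<gamma> a) (nhds a)" by (rule nhds_tendstoI[OF cont J(1) a])
    from eventually_compose_filterlim[OF eventually_in_chart[OF c] this]
    have "\<forall>\<^sub>F t in nhds a. \<gamma> t \<in> fst c \<and> t \<in> J"
      using eventually_nhds_in_open[OF J(1) a] by eventually_elim simp
    then obtain \<epsilon> where \<epsilon>: "\<epsilon> > 0" "\<And>t. dist t a < \<epsilon> \<Longrightarrow> \<gamma> t \<in> fst c \<and> t \<in> J"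
      unfolding eventually_nhds_metric by blast
    have "\<exists>k. \<forall>t\<in>ball a \<epsilon>. snd c (\<gamma> t) = k"
    proof (rule has_derivative_zero_constant)
      show "((\<lambda>t. snd c (\<gamma> t)) has_derivative (\<lambda>h. 0)) (at t within ball a \<epsilon>)" if "t \<in> ball a \<epsilon>" for t
        using that \<epsilon>(2)[of t] der[of t c] c
        by (auto simp: dist_commute charts_at_def intro: has_derivative_at_withinI)
    qed simp
    then have "\<gamma> t = \<gamma> a" if "dist t a < \<epsilon>" for t
      using that \<epsilon> chart_inv_chart charts_atD(1)[OF c] by (metis dist_commute mem_ball dist_self)
    then show "\<forall>\<^sub>F b in at a within J. \<gamma> a = \<gamma> b"
      unfolding eventually_at using \<epsilon>(1) by metis
  qed
qed

end

section \<open>Subbundles\<close>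

locale manifold_subbundle = manifold A
  for A :: "('a::t2_space, 'n::finite) chart set" +
  fixes E :: natural_bundle and V :: "'a \<Rightarrow> ('a, 'n) fibre_elem set"
  assumes V: "subbundle A E V"
begin

text \<open>The local frames of a subbundle, with the smoothness of their sections reduced to the continuity
  of the components in the charts around \<open>x\<close>.\<close>

lemma local_frame:
  obtains W r s where "open W" "x \<in> W"
    "\<And>y i. y \<in> W \<Longrightarrow> i < r \<Longrightarrow> s i y \<in> fibre A E y"
    "\<And>y. y \<in> W \<Longrightarrow> V y = {lin_comb r k (\<lambda>i. s i y) | k. True}"
    "\<And>y k. y \<in> W \<Longrightarrow> lin_comb r k (\<lambda>i. s i y) = (\<lambda>c a. 0) \<Longrightarrow> \<forall>i<r. k i = 0"
    "\<And>c i a. c \<in> charts_at A x \<Longrightarrow> i < r \<Longrightarrow> ((\<lambda>y. s i y c a) \<longlongrightarrow> s i x c a) (nhds x)"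
proof -
  from V[unfolded subbundle_def, rule_format, of x] obtain W r s
    where *: "open W \<and> x \<in> W \<and> (\<forall>i<r. smooth_section_on A E W (s i)) \<and>
        (\<forall>y\<in>W. V y = {lin_comb r k (\<lambda>i. s i y) | k. True} \<and>
           (\<forall>k. lin_comb r k (\<lambda>i. s i y) = (\<lambda>c a. 0) \<longrightarrow> (\<forall>i<r. k i = 0)))"
    by (elim exE)
  then have W: "open W" "x \<in> W" and s: "\<And>i. i < r \<Longrightarrow> smooth_section_on A E W (s i)"
    by blast+
  have fr: "\<And>y. y \<in> W \<Longrightarrow> V y = {lin_comb r k (\<lambda>i. s i y) | k. True}"
    using * by (elim conjE) (drule (1) bspec, elim conjE, assumption)
  have ind: "\<And>y k. y \<in> W \<Longrightarrow> lin_comb r k (\<lambda>i. s i y) = (\<lambda>c a. 0) \<Longrightarrow> \<forall>i<r. k i = 0"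
    using * by blast
  have fib: "s i y \<in> fibre A E y" if "y \<in> W" "i < r" for y i
    using s that unfolding smooth_section_on_def by blast
  have "((\<lambda>y. s i y c a) \<longlongrightarrow> s i x c a) (nhds x)" if c: "c \<in> charts_at A x" and i: "i < r" for c i a
  proof (cases "a \<in> indices E")
    case True
    have cA: "c \<in> A" "x \<in> fst c" using c by (auto simp: charts_at_def)
    have "smooth_on (snd c ` (W \<inter> fst c)) (\<lambda>u. s i (chart_inv c u) c a)"
      using s[OF i] cA(1) True unfolding smooth_section_on_def by blast
    then have "(\<lambda>u. s i (chart_inv c u) c a) differentiable (at (snd c x))"
      by (rule smooth_on_differentiable(1)) (use W cA in auto)
    then have "((\<lambda>u. s i (chart_inv c u) c a) \<longlongrightarrow> s i x c a) (at (snd c x))"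
      using differentiable_imp_continuous_within[of "\<lambda>u. s i (chart_inv c u) c a" "snd c x" UNIV] cA
      by (simp add: continuous_within chart_inv_chart)
    then have "((\<lambda>u. s i (chart_inv c u) c a) \<longlongrightarrow> s i x c a) (nhds (snd c x))"
      using tendsto_at_iff_tendsto_nhds[of "\<lambda>u. s i (chart_inv c u) c a" "snd c x"] cA
      by (simp add: chart_inv_chart)
    from filterlim_compose[OF this tendsto_chart(1)[OF c]]
    show ?thesis
    proof (rule Lim_transform_eventually)
      show "\<forall>\<^sub>F y in nhds x. s i (chart_inv c (snd c y)) c a = s i y c a"
        using eventually_in_chart[OF c] by eventually_elim (simp add: chart_inv_chart cA)
    qed
  next
    case False
    have "\<forall>\<^sub>F y in nhds x. 0 = s i y c a"
      using eventually_nhds_in_open[OF W] by eventually_elim (simp add: fibre_outside[OF fib[OF _ i] False])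
    from Lim_transform_eventually[OF tendsto_const this] show ?thesis
      using fibre_outside[OF fib[OF W(2) i] False] by simp
  qed
  from that[OF W fib fr ind this] show ?thesis .
qed

lemma V_fibre: "v \<in> V x \<Longrightarrow> v \<in> fibre A E x"
proof (rule local_frame[of x])
  fix W r s assume v: "v \<in> V x" and "x \<in> W" and "\<And>y i. y \<in> W \<Longrightarrow> i < r \<Longrightarrow> s i y \<in> fibre A E y"
    and fr: "\<And>y. y \<in> W \<Longrightarrow> V y = {lin_comb r k (\<lambda>i. s i y) | k. True}"
  then have "lin_comb r k (\<lambda>i. s i x) \<in> fibre A E x" for k by (intro fibre_lin_comb) auto
  then show "v \<in> fibre A E x" using v unfolding fr[OF \<open>x \<in> W\<close>] by blast
qed

lemma V_lincomb:
  assumes "v \<in> V x" "w \<in> V x"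
  shows "(\<lambda>c a. k * v c a + l * w c a) \<in> V x"
proof (rule local_frame[of x])
  fix W r s assume "x \<in> W" and fr: "\<And>y. y \<in> W \<Longrightarrow> V y = {lin_comb r k (\<lambda>i. s i y) | k. True}"
  then obtain kv kw where "v = lin_comb r kv (\<lambda>i. s i x)" "w = lin_comb r kw (\<lambda>i. s i x)"
    using assms by blast
  then have "(\<lambda>c a. k * v c a + l * w c a) = lin_comb r (\<lambda>i. k * kv i + l * kw i) (\<lambda>i. s i x)"
    by (simp add: lin_comb_def sum_distrib_left sum.distrib algebra_simps)
  then show ?thesis using fr \<open>x \<in> W\<close> by blast
qed

text \<open>The fibre of \<open>V\<close> in the coordinates of the chart \<open>d\<close>, in which limits over varying base points
  make sense.\<close>

definition V_in where "V_in d y = (\<lambda>v. v d) ` V y"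

lemma V_in_lincomb:
  assumes "w \<in> V_in d y" "w' \<in> V_in d y"
  shows "(\<lambda>a. k * w a + l * w' a) \<in> V_in d y"
proof -
  obtain v v' where "v \<in> V y" "w = v d" "v' \<in> V y" "w' = v' d" using assms by (auto simp: V_in_def)
  then show ?thesis unfolding V_in_def using V_lincomb[of v y v' k l] by (intro image_eqI[of _ _ "\<lambda>c a. k * v c a + l * v' c a"]) auto
qed

lemma V_in_transition:
  assumes "w \<in> V_in d y" "d \<in> charts_at A y" "d' \<in> charts_at A y"
  shows "rep E (chart_jacobian d d' id y) w \<in> V_in d' y"
proof -
  obtain v where v: "v \<in> V y" "w = v d" using assms(1) by (auto simp: V_in_def)
  have "v d' = rep E (chart_jacobian d d' id y) w"
    unfolding v(2) by (rule fibre_transition[OF V_fibre[OF v(1)] assms(2,3)])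
  then show ?thesis using v(1) unfolding V_in_def by (metis imageI)
qed

text \<open>The total space of a subbundle is closed: local frames remain independent in the limit.\<close>

lemma V_in_closed:
  assumes "\<F> \<noteq> bot" "(y \<longlongrightarrow> x) \<F>" "d \<in> charts_at A x"
    and "\<forall>\<^sub>F b in \<F>. w b \<in> V_in d (y b)" "\<And>a. ((\<lambda>b. w b a) \<longlongrightarrow> w0 a) \<F>"
  shows "w0 \<in> V_in d x"
proof (rule local_frame[of x])
  fix W r s assume W: "open W" "x \<in> W"
    and fib: "\<And>y i. y \<in> W \<Longrightarrow> i < r \<Longrightarrow> s i y \<in> fibre A E y"
    and fr: "\<And>y. y \<in> W \<Longrightarrow> V y = {lin_comb r k (\<lambda>i. s i y) | k. True}"
    and ind: "\<And>y k. y \<in> W \<Longrightarrow> lin_comb r k (\<lambda>i. s i y) = (\<lambda>c a. 0) \<Longrightarrow> \<forall>i<r. k i = 0"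
    and cont: "\<And>c i a. c \<in> charts_at A x \<Longrightarrow> i < r \<Longrightarrow> ((\<lambda>y. s i y c a) \<longlongrightarrow> s i x c a) (nhds x)"
  have zero: "(\<lambda>c a. 0) \<in> fibre A E x" by (simp add: fibre_def rep_def)
  have "\<forall>\<^sub>F b in \<F>. y b \<in> W" using topological_tendstoD[OF assms(2) W] .
  with assms(4) have "\<forall>\<^sub>F b in \<F>. \<exists>k. \<forall>a. w b a = (\<Sum>i<r. k i * s i (y b) d a)"
  proof eventually_elim
    case (elim b)
    then show ?case by (auto simp: V_in_def fr lin_comb_def)
  qed
  then obtain K where "\<forall>\<^sub>F b in \<F>. \<forall>a. w b a = (\<Sum>i<r. K b i * s i (y b) d a)"
    unfolding eventually_ex by blast
  moreover have "((\<lambda>b. s i (y b) d a) \<longlongrightarrow> s i x d a) \<F>" if "i < r" for i a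
    using filterlim_compose[OF cont[OF assms(3) that] assms(2)] .
  moreover have "\<forall>i<r. k i = 0" if k: "\<And>a. (\<Sum>i<r. k i * s i x d a) = 0" for k
  proof (rule ind[OF W(2)], rule fibre_eqI[OF _ zero assms(3)])
    show "lin_comb r k (\<lambda>i. s i x) \<in> fibre A E x" by (intro fibre_lin_comb fib W)
    show "lin_comb r k (\<lambda>i. s i x) d = (\<lambda>a. 0)" using k by (simp add: lin_comb_def)
  qed
  ultimately obtain k where "\<And>a. w0 a = (\<Sum>i<r. k i * s i x d a)"
    using lin_comb_limit[OF assms(1), of r "\<lambda>i b. s i (y b) d" "\<lambda>i. s i x d" w K w0] assms(5)
    by blast
  then have "w0 = lin_comb r k (\<lambda>i. s i x) d" by (auto simp: lin_comb_def)
  then show ?thesis using fr[OF W(2)] by (auto simp: V_in_def)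
qed

text \<open>Every vector of a subbundle is a limit of its vectors over any nearby points: extend it with
  constant coefficients in a local frame.\<close>

lemma V_in_extend:
  assumes "d \<in> charts_at A x" "w0 \<in> V_in d x"
  obtains w where "\<forall>\<^sub>F y in nhds x. w y \<in> V_in d y" "\<And>a. ((\<lambda>y. w y a) \<longlongrightarrow> w0 a) (nhds x)"
proof (rule local_frame[of x])
  fix W r s assume W: "open W" "x \<in> W"
    and fr: "\<And>y. y \<in> W \<Longrightarrow> V y = {lin_comb r k (\<lambda>i. s i y) | k. True}"
    and cont: "\<And>c i a. c \<in> charts_at A x \<Longrightarrow> i < r \<Longrightarrow> ((\<lambda>y. s i y c a) \<longlongrightarrow> s i x c a) (nhds x)"
  obtain k where k: "w0 = lin_comb r k (\<lambda>i. s i x) d"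
    using assms(2) fr[OF W(2)] by (auto simp: V_in_def)
  show ?thesis
  proof (rule that[of "\<lambda>y. lin_comb r k (\<lambda>i. s i y) d"])
    show "\<forall>\<^sub>F y in nhds x. lin_comb r k (\<lambda>i. s i y) d \<in> V_in d y"
      using eventually_nhds_in_open[OF W] by eventually_elim (auto simp: V_in_def fr)
    show "((\<lambda>y. lin_comb r k (\<lambda>i. s i y) d a) \<longlongrightarrow> w0 a) (nhds x)" for a
      unfolding k lin_comb_def by (intro tendsto_intros cont assms) auto
  qed
qed

lemma pushforward_in_V_iff:
  assumes f: "has_chart_jac c d f x L" and L: "invertible L" and v: "v \<in> V x"
  shows "pushforward A E f x v \<in> V (f x) \<longleftrightarrow> rep E L (v c) \<in> V_in d (f x)"
proof
  have d: "d \<in> charts_at A (f x)" using f by (simp add: has_chart_jac_def)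
  note pf = pushforward_in_chart[OF f L V_fibre[OF v]]
  show "rep E L (v c) \<in> V_in d (f x)" if "pushforward A E f x v \<in> V (f x)"
    unfolding V_in_def pf[symmetric] using that by blast
  assume "rep E L (v c) \<in> V_in d (f x)"
  then obtain w where "w \<in> V (f x)" "w d = pushforward A E f x v d" unfolding pf V_in_def by auto
  then show "pushforward A E f x v \<in> V (f x)"
    using fibre_eqI[OF V_fibre[of w] pushforward_in_fibre[OF f L V_fibre[OF v]] d] by simp
qed

text \<open>Inclusions for \<open>f\<close> and for its local inverse give equality, since the two actions on the fibres are
  inverse to each other.\<close>

lemma pushforward_eq_of_inverse:
  assumes f: "has_chart_jac c d f x L" and g: "has_chart_jac d c g (f x) M"
    and gf: "\<forall>\<^sub>F y in nhds x. g (f y) = y"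
    and Vf: "pushforward A E f x ` V x \<subseteq> V (f x)" and Vg: "pushforward A E g (f x) ` V (f x) \<subseteq> V x"
  shows "pushforward A E f x ` V x = V (f x)"
proof
  note inv = has_chart_jac_inverse[OF f g gf]
  have d: "d \<in> charts_at A (f x)" using f by (simp add: has_chart_jac_def)
  show "V (f x) \<subseteq> pushforward A E f x ` V x"
  proof
    fix w assume w: "w \<in> V (f x)"
    define v where "v = pushforward A E g (f x) w"
    have v: "v \<in> V x" using Vg w by (auto simp: v_def)
    have "pushforward A E f x v = w"
    proof (rule fibre_eqI[OF _ V_fibre[OF w] d])
      show "pushforward A E f x v \<in> fibre A E (f x)"
        by (rule pushforward_in_fibre[OF f inv(3) V_fibre[OF v]])
      have "pushforward A E f x v d = rep E L (rep E M (w d))"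
        unfolding pushforward_in_chart[OF f inv(3) V_fibre[OF v]]
        by (simp add: v_def pushforward_in_chart[OF g inv(4) V_fibre[OF w]])
      also have "\<dots> = w d"
        unfolding rep_mult[OF inv(3,4), symmetric] inv(2)
        by (rule rep_one) (rule fibre_outside[OF V_fibre[OF w]])
      finally show "pushforward A E f x v d = w d" .
    qed
    then show "w \<in> pushforward A E f x ` V x" using v by blast
  qed
qed (rule Vf)

end

section \<open>Torus actions\<close>

locale torus_action = manifold A
  for A :: "('a::t2_space, 'n::finite) chart set" +
  fixes U :: "'a set" and \<rho> :: "real ^ 'p::finite \<Rightarrow> 'a \<Rightarrow> 'a"
  assumes open_U: "open U" and action: "free_torus_action A U \<rho>"
begin

lemmas action_conjuncts = action[unfolded free_torus_action_def]

lemma act_zero: "x \<in> U \<Longrightarrow> \<rho> 0 x = x"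
  using action_conjuncts[THEN conjunct1] by blast

lemma act_U: "x \<in> U \<Longrightarrow> \<rho> s x \<in> U"
  using action_conjuncts[THEN conjunct2, THEN conjunct1] by blast

lemma act_add: "x \<in> U \<Longrightarrow> \<rho> (s + t) x = \<rho> s (\<rho> t x)"
  using action_conjuncts[THEN conjunct2, THEN conjunct2, THEN conjunct1] by blast

lemma act_fix_iff: "x \<in> U \<Longrightarrow> \<rho> s x = x \<longleftrightarrow> (\<forall>j. s $ j \<in> \<int>)"
  using action_conjuncts[THEN conjunct2, THEN conjunct2, THEN conjunct2, THEN conjunct1] by blast

lemma act_cont: "continuous_on (UNIV \<times> U) (\<lambda>(s, x). \<rho> s x)"
  using action_conjuncts[THEN conjunct2, THEN conjunct2, THEN conjunct2, THEN conjunct2, THEN conjunct1] .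

lemma act_smooth: "c \<in> A \<Longrightarrow> d \<in> A \<Longrightarrow>
    smooth_on {(s, u). u \<in> snd c ` (U \<inter> fst c) \<and> \<rho> s (chart_inv c u) \<in> fst d} (\<lambda>(s, u). snd d (\<rho> s (chart_inv c u)))"
  using action_conjuncts[THEN conjunct2, THEN conjunct2, THEN conjunct2, THEN conjunct2, THEN conjunct2] by blast

lemma act_neg: "x \<in> U \<Longrightarrow> \<rho> (- s) (\<rho> s x) = x" "x \<in> U \<Longrightarrow> \<rho> s (\<rho> (- s) x) = x"
  using act_add[of x "- s" s] act_add[of x s "- s"] act_zero by auto

lemma act_tendsto:
  assumes "(\<sigma> \<longlongrightarrow> s) \<F>" "(y \<longlongrightarrow> x) \<F>" "x \<in> U"
  shows "((\<lambda>b. \<rho> (\<sigma> b) (y b)) \<longlongrightarrow> \<rho> s x) \<F>"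
proof -
  have "((\<lambda>(s, x). \<rho> s x) \<longlongrightarrow> (\<lambda>(s, x). \<rho> s x) (s, x)) (nhds (s, x))"
    by (rule nhds_tendstoI[OF act_cont]) (use assms(3) in \<open>auto intro: open_Times open_U\<close>)
  from filterlim_compose[OF this tendsto_Pair[OF assms(1,2)]] show ?thesis by simp
qed

lemma act_curve_continuous:
  assumes "x \<in> U" "continuous_on S f"
  shows "continuous_on S (\<lambda>t. \<rho> (f t) x)"
proof -
  have "continuous_on S (\<lambda>t. (f t, x))" by (intro continuous_intros assms)
  from continuous_on_compose2[OF act_cont this] show ?thesis using assms(1) by auto
qed

definition act_rep where "act_rep c d = (\<lambda>(s, u). snd d (\<rho> s (chart_inv c u)))"

lemma act_rep_differentiable:
  assumes "x \<in> U" "c \<in> charts_at A x" "d \<in> charts_at A (\<rho> s x)"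
  shows "act_rep c d differentiable (at (s, snd c x))"
    and "(\<lambda>z. frechet_derivative (act_rep c d) (at z) v) differentiable (at (s, snd c x))"
proof -
  have "smooth_on {(s, u). u \<in> snd c ` (U \<inter> fst c) \<and> \<rho> s (chart_inv c u) \<in> fst d} (act_rep c d)"
    using act_smooth assms unfolding charts_at_def act_rep_def by blast
  note sm = smooth_on_differentiable[OF this]
  have "(s, snd c x) \<in> {(s, u). u \<in> snd c ` (U \<inter> fst c) \<and> \<rho> s (chart_inv c u) \<in> fst d}"
    using assms by (auto simp: charts_at_def chart_inv_chart)
  from sm[OF this] show "act_rep c d differentiable (at (s, snd c x))"
    "(\<lambda>z. frechet_derivative (act_rep c d) (at z) v) differentiable (at (s, snd c x))" .
qed

lemma act_rep_has_derivative:
  assumes "x \<in> U" "c \<in> charts_at A x" "d \<in> charts_at A (\<rho> s x)"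
  shows "(act_rep c d has_derivative frechet_derivative (act_rep c d) (at (s, snd c x))) (at (s, snd c x))"
  using act_rep_differentiable(1)[OF assms] frechet_derivative_works by blast

lemma
  assumes "x \<in> U" "c \<in> charts_at A x" "d \<in> charts_at A (\<rho> s x)"
  shows act_jac: "has_chart_jac c d (\<rho> s) x (chart_jacobian c d (\<rho> s) x)"
    and act_jac_mult: "chart_jacobian c d (\<rho> s) x *v h = frechet_derivative (act_rep c d) (at (s, snd c x)) (0, h)"
proof -
  have "((\<lambda>u. (s, u)) has_derivative (\<lambda>h. (0, h))) (at (snd c x))"
    by (auto intro!: derivative_eq_intros)
  from diff_chain_at[OF this act_rep_has_derivative[OF assms]]
  have D: "(local_rep c d (\<rho> s) has_derivative (\<lambda>h. frechet_derivative (act_rep c d) (at (s, snd c x)) (0, h))) (at (snd c x))"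
    by (simp add: o_def act_rep_def local_rep_def)
  show *: "has_chart_jac c d (\<rho> s) x (chart_jacobian c d (\<rho> s) x)"
  proof (rule has_chart_jacI[OF assms(2), of d "\<rho> s", OF assms(3)])
    show "(\<rho> s \<longlongrightarrow> \<rho> s x) (nhds x)"
      by (rule act_tendsto) (auto simp: assms(1) filterlim_ident)
    show "local_rep c d (\<rho> s) differentiable (at (snd c x))" using D by (rule differentiableI)
  qed
  have "(*v) (chart_jacobian c d (\<rho> s) x) = (\<lambda>h. frechet_derivative (act_rep c d) (at (s, snd c x)) (0, h))"
    using * D unfolding has_chart_jac_def by (blast intro: has_derivative_unique)
  then show "chart_jacobian c d (\<rho> s) x *v h = frechet_derivative (act_rep c d) (at (s, snd c x)) (0, h)"
    by metis
qed

lemma eventually_U: "x \<in> U \<Longrightarrow> \<forall>\<^sub>F y in nhds x. y \<in> U"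
  using open_U by (rule eventually_nhds_in_open)

lemma act_jac_inverse:
  assumes "x \<in> U" "c \<in> charts_at A x" "d \<in> charts_at A (\<rho> s x)"
  shows "has_chart_jac d c (\<rho> (- s)) (\<rho> s x) (chart_jacobian d c (\<rho> (- s)) (\<rho> s x))"
    and "invertible (chart_jacobian c d (\<rho> s) x)"
proof -
  show *: "has_chart_jac d c (\<rho> (- s)) (\<rho> s x) (chart_jacobian d c (\<rho> (- s)) (\<rho> s x))"
    by (rule act_jac) (use assms act_U act_neg in auto)
  have "\<forall>\<^sub>F y in nhds x. \<rho> (- s) (\<rho> s y) = y"
    using eventually_U[OF assms(1)] by eventually_elim (rule act_neg(1))
  from has_chart_jac_inverse(3)[OF act_jac[OF assms] * this]
  show "invertible (chart_jacobian c d (\<rho> s) x)" .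
qed

lemma act_jac_tendsto:
  assumes "(\<sigma> \<longlongrightarrow> s) \<F>" "(y \<longlongrightarrow> x) \<F>" "x \<in> U" "c \<in> charts_at A x" "d \<in> charts_at A (\<rho> s x)"
  shows "((\<lambda>b. chart_jacobian c d (\<rho> (\<sigma> b)) (y b) $ i $ j) \<longlongrightarrow> chart_jacobian c d (\<rho> s) x $ i $ j) \<F>"
proof -
  have entry: "chart_jacobian c d (\<rho> s) x $ i $ j = frechet_derivative (act_rep c d) (at (s, snd c x)) (0, axis j 1) $ i"
    if "x \<in> U" "c \<in> charts_at A x" "d \<in> charts_at A (\<rho> s x)" for s x
    using act_jac_mult[OF that, of "axis j 1"] by (simp add: matrix_vector_mult_basis column_def vec_eq_iff)
  have "((\<lambda>z. frechet_derivative (act_rep c d) (at z) (0, axis j 1)) \<longlongrightarrow>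
      frechet_derivative (act_rep c d) (at (s, snd c x)) (0, axis j 1)) (at (s, snd c x))"
    using differentiable_imp_continuous_within[OF act_rep_differentiable(2)[OF assms(3-5), of "(0, axis j 1)"]]
    by (simp add: continuous_within)
  then have "((\<lambda>z. frechet_derivative (act_rep c d) (at z) (0, axis j 1)) \<longlongrightarrow>
      frechet_derivative (act_rep c d) (at (s, snd c x)) (0, axis j 1)) (nhds (s, snd c x))"
    using tendsto_at_iff_tendsto_nhds[of "\<lambda>z. frechet_derivative (act_rep c d) (at z) (0, axis j 1)"] by simp
  from filterlim_compose[OF this tendsto_Pair[OF assms(1) filterlim_compose[OF tendsto_chart(1)[OF assms(4)] assms(2)]]]
  have "((\<lambda>b. frechet_derivative (act_rep c d) (at (\<sigma> b, snd c (y b))) (0, axis j 1) $ i) \<longlongrightarrow>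
      frechet_derivative (act_rep c d) (at (s, snd c x)) (0, axis j 1) $ i) \<F>"
    by (rule tendsto_vec_nth)
  moreover have "\<forall>\<^sub>F b in \<F>. frechet_derivative (act_rep c d) (at (\<sigma> b, snd c (y b))) (0, axis j 1) $ i
      = chart_jacobian c d (\<rho> (\<sigma> b)) (y b) $ i $ j"
    using eventually_compose_filterlim[OF eventually_U[OF assms(3)] assms(2)]
      eventually_compose_filterlim[OF eventually_in_chart[OF assms(4)] assms(2)]
      eventually_compose_filterlim[OF eventually_in_chart[OF assms(5)] act_tendsto[OF assms(1-3)]]
    by eventually_elim (use assms(4,5) entry in \<open>auto simp: charts_at_def\<close>)
  ultimately show ?thesis
    unfolding entry[OF assms(3-5)] by (rule Lim_transform_eventually)
qed

text \<open>infinitesimal action\<close>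
text \<open>The infinitesimal action: \<open>generator c x b\<close> is the velocity at time \<open>0\<close> of \<open>t \<mapsto> \<rho> (t b) x\<close> in the
  chart \<open>c\<close>.\<close>

definition generator where "generator c x = frechet_derivative (\<lambda>s. snd c (\<rho> s x)) (at 0)"

lemma
  assumes "x \<in> U" "c \<in> charts_at A x"
  shows generator_has_derivative: "((\<lambda>s. snd c (\<rho> s x)) has_derivative generator c x) (at 0)"
    and generator_eq: "generator c x = (\<lambda>b. frechet_derivative (act_rep c c) (at (0, snd c x)) (b, 0))"
proof -
  have c0: "c \<in> charts_at A (\<rho> 0 x)" using assms act_zero by simp
  have "((\<lambda>s. (s, snd c x)) has_derivative (\<lambda>h. (h, 0))) (at 0)"
    by (auto intro!: derivative_eq_intros)
  from diff_chain_at[OF this act_rep_has_derivative[OF assms c0]]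
  have *: "((\<lambda>s. snd c (\<rho> s x)) has_derivative (\<lambda>b. frechet_derivative (act_rep c c) (at (0, snd c x)) (b, 0))) (at 0)"
    using assms(2) by (simp add: o_def act_rep_def chart_inv_chart charts_at_def)
  from frechet_derivative_at[OF this]
  show "generator c x = (\<lambda>b. frechet_derivative (act_rep c c) (at (0, snd c x)) (b, 0))" by (simp add: generator_def)
  with * show "((\<lambda>s. snd c (\<rho> s x)) has_derivative generator c x) (at 0)" by simp
qed

lemma generator_linear: "x \<in> U \<Longrightarrow> c \<in> charts_at A x \<Longrightarrow> linear (generator c x)"
  using generator_has_derivative has_derivative_linear by blast

lemma act_has_derivative:
  assumes "x \<in> U" "d \<in> charts_at A (\<rho> s x)"
  shows "((\<lambda>s. snd d (\<rho> s x)) has_derivative generator d (\<rho> s x)) (at s)"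
proof -
  have "((\<lambda>t. t - s) has_derivative (\<lambda>h. h)) (at s)" by (auto intro!: derivative_eq_intros)
  from diff_chain_at[OF this, of "\<lambda>t. snd d (\<rho> t (\<rho> s x))"] generator_has_derivative[OF act_U[OF assms(1)] assms(2)]
  have "((\<lambda>t. snd d (\<rho> (t - s) (\<rho> s x))) has_derivative generator d (\<rho> s x)) (at s)" by (simp add: o_def)
  moreover have "\<rho> (t - s) (\<rho> s x) = \<rho> t x" for t
    using act_add[OF assms(1), of "t - s" s] by simp
  ultimately show ?thesis by simp
qed

lemma eventually_act_in_chart:
  assumes "x \<in> U" "c \<in> charts_at A x"
  shows "\<forall>\<^sub>F h in nhds 0. \<rho> h x \<in> fst c"
proof -
  have "((\<lambda>h. \<rho> h x) \<longlongrightarrow> \<rho> 0 x) (nhds 0)"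
    by (rule act_tendsto) (auto simp: filterlim_ident assms)
  then have "((\<lambda>h. \<rho> h x) \<longlongrightarrow> x) (nhds 0)" using act_zero[OF assms(1)] by simp
  from eventually_compose_filterlim[OF eventually_in_chart[OF assms(2)] this] show ?thesis .
qed

text \<open>Differentiate \<open>\<rho> s (\<rho> h x) = \<rho> h (\<rho> s x)\<close> in \<open>h\<close>; this is where the commutativity of the torus
  enters.\<close>

lemma generator_equivariant:
  assumes "x \<in> U" "c \<in> charts_at A x" "d \<in> charts_at A (\<rho> s x)"
  shows "chart_jacobian c d (\<rho> s) x *v generator c x b = generator d (\<rho> s x) b"
proof -
  have c0: "snd c (\<rho> 0 x) = snd c x" using act_zero[OF assms(1)] by simp
  have loc: "(local_rep c d (\<rho> s) has_derivative (*v) (chart_jacobian c d (\<rho> s) x)) (at (snd c (\<rho> 0 x)))"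
    unfolding c0 using act_jac[OF assms] by (simp add: has_chart_jac_def)
  have "((\<lambda>h. local_rep c d (\<rho> s) (snd c (\<rho> h x))) has_derivative
      (\<lambda>b. chart_jacobian c d (\<rho> s) x *v generator c x b)) (at 0)"
    using diff_chain_at[OF generator_has_derivative[OF assms(1,2)] loc] by (simp add: o_def)
  moreover have "\<forall>\<^sub>F h in nhds 0. local_rep c d (\<rho> s) (snd c (\<rho> h x)) = snd d (\<rho> h (\<rho> s x))"
    using eventually_act_in_chart[OF assms(1,2)]
  proof eventually_elim
    case (elim h)
    have "\<rho> s (\<rho> h x) = \<rho> h (\<rho> s x)"
      using act_add[OF assms(1), of s h] act_add[OF assms(1), of h s] by (simp add: add.commute)
    then show ?case using elim assms(2) by (simp add: local_rep_def chart_inv_chart charts_at_def)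
  qed
  ultimately have "((\<lambda>h. snd d (\<rho> h (\<rho> s x))) has_derivative
      (\<lambda>b. chart_jacobian c d (\<rho> s) x *v generator c x b)) (at 0)"
    by (rule has_derivative_eventually_cong)
  from has_derivative_unique[OF this generator_has_derivative[OF act_U[OF assms(1)] assms(3)]]
  show ?thesis by metis
qed

text \<open>The two partial derivatives of the action in charts are the infinitesimal action at the image point
  and the Jacobian of the translation.\<close>

lemma act_rep_derivative:
  assumes "x \<in> U" "c \<in> charts_at A x" "d \<in> charts_at A (\<rho> s x)"
  shows "(act_rep c d has_derivative (\<lambda>(b, h). generator d (\<rho> s x) b + chart_jacobian c d (\<rho> s) x *v h)) (at (s, snd c x))"
proof -
  let ?G = "frechet_derivative (act_rep c d) (at (s, snd c x))"
  note G = act_rep_has_derivative[OF assms]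
  have Gs: "?G (b, 0) = generator d (\<rho> s x) b" for b
  proof -
    have "((\<lambda>s. (s, snd c x)) has_derivative (\<lambda>h. (h, 0))) (at s)"
      by (auto intro!: derivative_eq_intros)
    from diff_chain_at[OF this G]
    have "((\<lambda>s. snd d (\<rho> s x)) has_derivative (\<lambda>b. ?G (b, 0))) (at s)"
      using assms(2) by (simp add: o_def act_rep_def chart_inv_chart charts_at_def)
    from has_derivative_unique[OF this act_has_derivative[OF assms(1,3)]] show ?thesis by metis
  qed
  have "?G = (\<lambda>(b, h). generator d (\<rho> s x) b + chart_jacobian c d (\<rho> s) x *v h)"
  proof (rule ext, clarify)
    fix b h
    show "?G (b, h) = generator d (\<rho> s x) b + chart_jacobian c d (\<rho> s) x *v h"
      using linear_add[OF has_derivative_linear[OF G], of "(b, 0)" "(0, h)"]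
      by (simp add: Gs act_jac_mult[OF assms])
  qed
  with G show ?thesis by simp
qed

text \<open>If \<open>b\<close> generated no motion at \<open>x\<close>, then by equivariance it would generate none along
  \<open>t \<mapsto> \<rho> (t b) x\<close>, so all multiples of \<open>b\<close> would fix \<open>x\<close> and hence be integral.\<close>

lemma generator_inj:
  assumes "x \<in> U" "c \<in> charts_at A x"
  shows "inj (generator c x)"
proof -
  have "b = 0" if b: "generator c x b = 0" for b
  proof -
    have "\<rho> (t *\<^sub>R b) x = \<rho> (0 *\<^sub>R b) x" for t :: real
    proof (rule curve_constant[of UNIV "\<lambda>t. \<rho> (t *\<^sub>R b) x"])
      show "continuous_on UNIV (\<lambda>t. \<rho> (t *\<^sub>R b) x)"
        by (intro act_curve_continuous continuous_intros assms(1))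
      fix t :: real and d assume d: "d \<in> charts_at A (\<rho> (t *\<^sub>R b) x)"
      have "((\<lambda>t. t *\<^sub>R b) has_derivative (\<lambda>h. h *\<^sub>R b)) (at t)" by (auto intro!: derivative_eq_intros)
      from diff_chain_at[OF this act_has_derivative[OF assms(1) d]]
      have "((\<lambda>t. snd d (\<rho> (t *\<^sub>R b) x)) has_derivative (\<lambda>h. generator d (\<rho> (t *\<^sub>R b) x) (h *\<^sub>R b))) (at t)"
        by (simp add: o_def)
      moreover have "generator d (\<rho> (t *\<^sub>R b) x) b = 0"
        using generator_equivariant[OF assms d, of b] b by simp
      ultimately show "((\<lambda>t. snd d (\<rho> (t *\<^sub>R b) x)) has_derivative (\<lambda>h. 0)) (at t)"
        by (simp add: linear_cmul[OF generator_linear[OF act_U[OF assms(1)] d]])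
    qed auto
    then have per: "(t *\<^sub>R b) $ j \<in> \<int>" for t j
      using act_fix_iff[OF assms(1)] act_zero[OF assms(1)] by (metis scaleR_zero_left)
    show "b = 0"
    proof (rule ccontr)
      assume "b \<noteq> 0"
      then obtain j where "b $ j \<noteq> 0" by (auto simp: vec_eq_iff)
      then have "(1 / 2 :: real) \<in> \<int>" using per[of "1 / (2 * b $ j)" j] by simp
      then obtain k :: int where "1 / 2 = real_of_int k" by (auto elim: Ints_cases)
      then have "1 = 2 * k" by linarith
      then show False by presburger
    qed
  qed
  then show ?thesis using linear_injective_0[OF generator_linear[OF assms]] by blast
qed

end

section \<open>Invariant vector fields tangent to the orbits\<close>

locale invariant_tangent_field = torus_action A U \<rho>
  for A :: "('a::t2_space, 'n::finite) chart set" and U and \<rho> :: "real ^ 'p::finite \<Rightarrow> 'a \<Rightarrow> 'a" +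
  fixes Y :: "'a \<Rightarrow> ('a, 'n) fibre_elem"
  assumes field: "vector_field A Y"
    and invariant: "\<And>s x. x \<in> U \<Longrightarrow> pushforward A Tangent (\<rho> s) x (Y x) = Y (\<rho> s x)"
    and tangent: "\<And>x c. x \<in> U \<Longrightarrow> c \<in> charts_at A x \<Longrightarrow> vec_comp c (Y x) \<in> range (generator c x)"
begin

lemma field_equivariant:
  assumes "x \<in> U" "c \<in> charts_at A x" "d \<in> charts_at A (\<rho> s x)"
  shows "chart_jacobian c d (\<rho> s) x *v vec_comp c (Y x) = vec_comp d (Y (\<rho> s x))"
proof -
  have "Y x \<in> fibre A Tangent x" using field by (auto simp: smooth_section_on_def)
  from pushforward_in_chart[OF act_jac[OF assms] act_jac_inverse(2)[OF assms] this]
  have "Y (\<rho> s x) d = rep Tangent (chart_jacobian c d (\<rho> s) x) (Y x c)"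
    using invariant[OF assms(1)] by simp
  then show ?thesis
    by (simp add: vec_eq_iff vec_comp_def matrix_vector_mult_def rep_def sum.reindex inj_on_def)
qed

text \<open>The vector \<open>b\<close> for which \<open>Y\<close> at \<open>x\<close> is the velocity of \<open>t \<mapsto> \<rho> (t b) x\<close>. It is unique because the
  infinitesimal action is injective.\<close>

definition frequency where "frequency x = (SOME b. \<forall>c\<in>charts_at A x. generator c x b = vec_comp c (Y x))"

lemma generator_frequency:
  assumes "x \<in> U" "c \<in> charts_at A x"
  shows "generator c x (frequency x) = vec_comp c (Y x)"
proof -
  obtain b where b: "generator c x b = vec_comp c (Y x)" using tangent[OF assms] by (auto simp: image_iff)
  have "\<forall>d\<in>charts_at A x. generator d x b = vec_comp d (Y x)"
  proof
    fix d assume "d \<in> charts_at A x"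
    then have d: "d \<in> charts_at A (\<rho> 0 x)" using act_zero[OF assms(1)] by simp
    show "generator d x b = vec_comp d (Y x)"
      using generator_equivariant[OF assms d, of b] field_equivariant[OF assms d] b act_zero[OF assms(1)] by simp
  qed
  from someI[of "\<lambda>b. \<forall>c\<in>charts_at A x. generator c x b = vec_comp c (Y x)", OF this]
  show ?thesis using assms(2) unfolding frequency_def by blast
qed

lemma frequency_invariant:
  assumes "x \<in> U" shows "frequency (\<rho> s x) = frequency x"
proof -
  obtain c d where c: "c \<in> charts_at A x" and d: "d \<in> charts_at A (\<rho> s x)" by (meson chart_exists)
  have "generator d (\<rho> s x) (frequency x) = vec_comp d (Y (\<rho> s x))"
    using generator_equivariant[OF assms c d, of "frequency x"] field_equivariant[OF assms c d] generator_frequency[OF assms c] by simp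
  also have "\<dots> = generator d (\<rho> s x) (frequency (\<rho> s x))" using generator_frequency[OF act_U[OF assms] d] by simp
  finally show ?thesis using generator_inj[OF act_U[OF assms] d] by (simp add: inj_def)
qed

text \<open>In a chart, \<open>frequency\<close> solves the overdetermined linear system
  \<open>generator c y b = vec_comp c (Y y)\<close>. A left inverse \<open>B\<close> of \<open>generator c x\<close>, kept fixed while \<open>y\<close>
  varies, turns it into a square system which is invertible near \<open>x\<close>.\<close>

lemma frequency_differentiable:
  assumes x: "x \<in> U" and c: "c \<in> charts_at A x"
  shows "(\<lambda>u. frequency (chart_inv c u)) differentiable (at (snd c x))"
proof -
  have cA: "c \<in> A" "x \<in> fst c" using c by (auto simp: charts_at_def)
  obtain B where B: "linear B" "B \<circ> generator c x = id"
    using linear_injective_left_inverse[OF generator_linear[OF x c] generator_inj[OF x c]] by blast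
  define L where "L = (\<lambda>u. matrix (\<lambda>b. B (generator c (chart_inv c u) b)))"
  have near: "\<forall>\<^sub>F u in nhds (snd c x). chart_inv c u \<in> U \<and> u \<in> snd c ` fst c"
    using eventually_compose_filterlim[OF eventually_U[OF x] tendsto_chart(2)[OF c]]
      eventually_nhds_in_open[OF chart_open(2)[OF cA(1)] imageI[OF cA(2)]]
    by eventually_elim simp
  have chart_near: "c \<in> charts_at A (chart_inv c u)" "snd c (chart_inv c u) = u" if "u \<in> snd c ` fst c" for u
    using that cA(1) by (auto simp: charts_at_def chart_inv_chart)
  have Bdiff: "(\<lambda>u. B (f u) $ i) differentiable (at (snd c x))" if f: "f differentiable (at (snd c x))"
    for f :: "real ^ 'n \<Rightarrow> real ^ 'n" and i
  proof -
    obtain f' where "(f has_derivative f') (at (snd c x))" using f by (auto simp: differentiable_def)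
    then have "((\<lambda>u. B (f u) $ i) has_derivative (\<lambda>h. B (f' h) $ i)) (at (snd c x))"
      by (intro bounded_linear.has_derivative[OF bounded_linear_vec_nth]
          bounded_linear.has_derivative[OF linear_conv_bounded_linear[THEN iffD1, OF B(1)]])
    then show ?thesis by (rule differentiableI)
  qed
  show ?thesis
  proof (rule differentiable_linear_solution[of L _ "\<lambda>u. B (vec_comp c (Y (chart_inv c u)))"])
    fix i j
    have c0: "c \<in> charts_at A (\<rho> 0 x)" using c act_zero[OF x] by simp
    have "((\<lambda>u::real ^ 'n. (0::real ^ 'p, u)) has_derivative (\<lambda>h. (0, h))) (at (snd c x))"
      by (auto intro!: derivative_eq_intros)
    then have "(\<lambda>u::real ^ 'n. (0::real ^ 'p, u)) differentiable (at (snd c x))" by (rule differentiableI)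
    from differentiable_chain_at[OF this act_rep_differentiable(2)[OF x c c0, of "(axis j 1, 0)"]]
    have "(\<lambda>u. frechet_derivative (act_rep c c) (at (0, u)) (axis j 1, 0)) differentiable (at (snd c x))"
      by (simp add: o_def)
    then have "(\<lambda>u. generator c (chart_inv c u) (axis j 1)) differentiable (at (snd c x))"
      by (rule differentiable_eventually_cong)
        (use near in eventually_elim, use chart_near generator_eq in auto)
    from Bdiff[OF this]
    show "(\<lambda>u. L u $ i $ j) differentiable (at (snd c x))" by (simp add: L_def matrix_def)
  next
    fix i
    have "(\<lambda>u. vec_comp c (Y (chart_inv c u))) differentiable (at (snd c x))"
    proof (rule differentiable_vecI)
      fix k
      have "smooth_on (snd c ` (UNIV \<inter> fst c)) (\<lambda>u. Y (chart_inv c u) c (Coord k))"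
        using field cA(1) by (auto simp: smooth_section_on_def)
      from smooth_on_differentiable(1)[OF this, of "snd c x"]
      show "(\<lambda>u. vec_comp c (Y (chart_inv c u)) $ k) differentiable (at (snd c x))"
        using cA by (simp add: vec_comp_def)
    qed
    from Bdiff[OF this]
    show "(\<lambda>u. B (vec_comp c (Y (chart_inv c u))) $ i) differentiable (at (snd c x))" .
  next
    have "L (snd c x) = matrix id"
      using B(2) cA by (simp add: L_def chart_inv_chart o_def id_def fun_eq_iff)
    then show "invertible (L (snd c x))"
      using matrix_inv_eqI(2)[of "mat 1" "mat 1"] by (simp add: matrix_id_mat_1)
  next
    show "\<forall>\<^sub>F u in nhds (snd c x). L u *v frequency (chart_inv c u) = B (vec_comp c (Y (chart_inv c u)))"
      using near
    proof eventually_elim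
      case (elim u)
      have "linear (\<lambda>b. B (generator c (chart_inv c u) b))"
        using linear_compose[OF generator_linear B(1)] elim chart_near(1)[of u] by (simp add: o_def)
      from matrix_works[OF this[unfolded linear_matrix_vector_mul_eq[symmetric]]]
      show ?case using generator_frequency elim chart_near(1)[of u] by (simp add: L_def)
    qed
  qed
qed

definition flow where "flow t x = \<rho> (t *\<^sub>R frequency x) x"

text \<open>On each orbit the frequency vector is constant, so \<open>flow\<close> moves along the orbits with the velocity
  of \<open>Y\<close>.\<close>

lemma flow_local_flow: "local_flow A Y UNIV U flow"
  unfolding local_flow_def integral_curve_def
proof (intro conjI ballI)
  fix x assume x: "x \<in> U"
  show "flow 0 x = x" using act_zero[OF x] by (simp add: flow_def)
  show "continuous_on UNIV (\<lambda>t. flow t x)"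
    unfolding flow_def by (intro act_curve_continuous continuous_intros x)
  fix t c assume c: "c \<in> charts_at A (flow t x)"
  have "((\<lambda>t. t *\<^sub>R frequency x) has_derivative (\<lambda>h. h *\<^sub>R frequency x)) (at t)" by (auto intro!: derivative_eq_intros)
  from diff_chain_at[OF this act_has_derivative[OF x c[unfolded flow_def]]]
  have "((\<lambda>t. snd c (flow t x)) has_derivative (\<lambda>h. generator c (flow t x) (h *\<^sub>R frequency x))) (at t)"
    by (simp add: o_def flow_def)
  moreover have "generator c (flow t x) (h *\<^sub>R frequency x) = h *\<^sub>R vec_comp c (Y (flow t x))" for h
    using linear_cmul[OF generator_linear[OF act_U[OF x] c[unfolded flow_def]]]
      generator_frequency[OF act_U[OF x] c[unfolded flow_def]] frequency_invariant[OF x] by (simp add: flow_def)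
  ultimately show "((\<lambda>t. snd c (flow t x)) has_vector_derivative vec_comp c (Y (flow t x))) (at t)"
    by (simp add: has_vector_derivative_def)
qed (auto simp: open_U)

text \<open>How the flow deviates from a translation to first order: a displacement \<open>w\<close> changes the frequency
  vector by its derivative at \<open>w\<close>, which moves the image point along the orbit.\<close>

definition shear where
  "shear c x = matrix (\<lambda>w. generator c x (frechet_derivative (\<lambda>u. frequency (chart_inv c u)) (at (snd c x)) w))"

lemma frequency_has_derivative:
  assumes "x \<in> U" "c \<in> charts_at A x"
  shows "((\<lambda>u. frequency (chart_inv c u)) has_derivative frechet_derivative (\<lambda>u. frequency (chart_inv c u)) (at (snd c x))) (at (snd c x))"
  using frequency_differentiable[OF assms] frechet_derivative_works by blast

lemma shear_mult:
  assumes "x \<in> U" "c \<in> charts_at A x"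
  shows "shear c x *v w = generator c x (frechet_derivative (\<lambda>u. frequency (chart_inv c u)) (at (snd c x)) w)"
proof -
  have "linear (\<lambda>w. generator c x (frechet_derivative (\<lambda>u. frequency (chart_inv c u)) (at (snd c x)) w))"
    using linear_compose[OF has_derivative_linear[OF frequency_has_derivative[OF assms]] generator_linear[OF assms]]
    by (simp add: o_def)
  from matrix_works[OF this[unfolded linear_matrix_vector_mul_eq[symmetric]]] show ?thesis by (simp add: shear_def)
qed

text \<open>The image of \<open>shear\<close> is tangent to the orbit of \<open>x\<close>, and along it \<open>frequency\<close> has derivative \<open>0\<close>.\<close>

lemma shear_nilpotent:
  assumes "x \<in> U" "c \<in> charts_at A x"
  shows "shear c x ** shear c x = 0"
proof -
  let ?D = "frechet_derivative (\<lambda>u. frequency (chart_inv c u)) (at (snd c x))"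
  have c0: "snd c (\<rho> 0 x) = snd c x" using act_zero[OF assms(1)] by simp
  have loc: "((\<lambda>u. frequency (chart_inv c u)) has_derivative ?D) (at (snd c (\<rho> 0 x)))"
    unfolding c0 by (rule frequency_has_derivative[OF assms])
  have "((\<lambda>h. frequency (chart_inv c (snd c (\<rho> h x)))) has_derivative (\<lambda>b. ?D (generator c x b))) (at 0)"
    using diff_chain_at[OF generator_has_derivative[OF assms] loc] by (simp add: o_def)
  moreover have "\<forall>\<^sub>F h in nhds 0. frequency (chart_inv c (snd c (\<rho> h x))) = frequency x"
    using eventually_act_in_chart[OF assms]
    by eventually_elim (simp add: chart_inv_chart charts_atD[OF assms(2)] frequency_invariant assms(1))
  ultimately have "((\<lambda>h. frequency x) has_derivative (\<lambda>b. ?D (generator c x b))) (at 0)"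
    by (rule has_derivative_eventually_cong)
  from has_derivative_unique[OF this has_derivative_const] have "?D (generator c x b) = 0" for b by metis
  then show ?thesis
    by (simp add: matrix_eq shear_mult[OF assms] linear_0[OF generator_linear[OF assms]] flip: matrix_vector_mul_assoc)
qed

text \<open>The base point of \<open>\<rho> (t * frequency y) y\<close> contributes the Jacobian of the translation; the frequency
  contributes an infinitesimal action at the image point, which equivariance moves back to \<open>x\<close>, where
  it becomes \<open>shear\<close>.\<close>

lemma flow_jac:
  assumes x: "x \<in> U" and c: "c \<in> charts_at A x" and d: "d \<in> charts_at A (flow t x)"
  shows "has_chart_jac c d (flow t) x (chart_jacobian c d (\<rho> (t *\<^sub>R frequency x)) x ** (mat 1 + t *\<^sub>R shear c x))"
proof -
  let ?s = "t *\<^sub>R frequency x" and ?D = "frechet_derivative (\<lambda>u. frequency (chart_inv c u)) (at (snd c x))"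
  let ?J = "chart_jacobian c d (\<rho> (t *\<^sub>R frequency x)) x"
  have cA: "c \<in> A" "x \<in> fst c" using c by (auto simp: charts_at_def)
  have d': "d \<in> charts_at A (\<rho> ?s x)" using d by (simp add: flow_def)
  have fx: "frequency (chart_inv c (snd c x)) = frequency x" using cA by (simp add: chart_inv_chart)
  have "((\<lambda>u. (t *\<^sub>R frequency (chart_inv c u), u)) has_derivative (\<lambda>h. (t *\<^sub>R ?D h, h))) (at (snd c x))"
    using frequency_has_derivative[OF x c] by (auto intro!: derivative_eq_intros)
  from diff_chain_at[OF this, of "act_rep c d" "\<lambda>(b, h). generator d (\<rho> ?s x) b + ?J *v h"] act_rep_derivative[OF x c d']
  have D: "(local_rep c d (flow t) has_derivative (\<lambda>h. generator d (\<rho> ?s x) (t *\<^sub>R ?D h) + ?J *v h)) (at (snd c x))"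
    by (simp add: o_def fx act_rep_def local_rep_def flow_def)
  have "generator d (\<rho> ?s x) (t *\<^sub>R ?D h) + ?J *v h = (?J ** (mat 1 + t *\<^sub>R shear c x)) *v h" for h
  proof -
    have "generator d (\<rho> ?s x) (t *\<^sub>R ?D h) + ?J *v h = ?J *v (h + t *\<^sub>R (shear c x *v h))"
      by (simp add: linear_cmul[OF generator_linear[OF x c]] shear_mult[OF x c] matrix_vector_right_distrib
        matrix_vector_mult_scaleR flip: generator_equivariant[OF x c d'])
    also have "\<dots> = (?J ** (mat 1 + t *\<^sub>R shear c x)) *v h"
      by (simp add: matrix_vector_mult_add_rdistrib scaleR_matrix_vector_assoc flip: matrix_vector_mul_assoc)
    finally show ?thesis .
  qed
  then have D': "(local_rep c d (flow t) has_derivative (*v) (?J ** (mat 1 + t *\<^sub>R shear c x))) (at (snd c x))"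
    using D by simp
  have "((\<lambda>u. frequency (chart_inv c u)) \<longlongrightarrow> frequency (chart_inv c (snd c x))) (at (snd c x))"
    using differentiable_imp_continuous_within[OF frequency_differentiable[OF x c]] by (simp add: continuous_within)
  then have "((\<lambda>u. frequency (chart_inv c u)) \<longlongrightarrow> frequency x) (nhds (snd c x))"
    using tendsto_at_iff_tendsto_nhds[of "\<lambda>u. frequency (chart_inv c u)" "snd c x"] fx by simp
  from filterlim_compose[OF this tendsto_chart(1)[OF c]]
  have "(frequency \<longlongrightarrow> frequency x) (nhds x)"
    by (rule Lim_transform_eventually)
      (use eventually_in_chart[OF c] in eventually_elim, use cA chart_inv_chart in auto)
  then have "(flow t \<longlongrightarrow> flow t x) (nhds x)"
    unfolding flow_def by (intro act_tendsto tendsto_intros filterlim_ident x)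
  then show ?thesis using D' c d by (simp add: has_chart_jac_def)
qed

text \<open>Moving \<open>\<gamma> t\<close> back by \<open>t\<close> times the frequency vector gives a curve with velocity \<open>0\<close>, since
  the velocities of \<open>\<gamma>\<close> and of the translation cancel by equivariance.\<close>

lemma integral_curve_in_orbit:
  assumes J: "open J" "is_interval J" "0 \<in> J" and \<gamma>: "integral_curve A Y J \<gamma>"
    and x: "\<gamma> 0 = x" "x \<in> U" and confined: "\<gamma> ` J \<subseteq> range (\<lambda>s. \<rho> s x)" and t: "t \<in> J"
  shows "\<gamma> t = \<rho> (t *\<^sub>R frequency x) x"
proof -
  have U: "\<gamma> t \<in> U" and frequency: "frequency (\<gamma> t) = frequency x" if "t \<in> J" for t
    using confined that act_U[OF x(2)] frequency_invariant[OF x(2)] by auto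
  have cont: "continuous_on J \<gamma>" using \<gamma> by (simp add: integral_curve_def)
  let ?\<eta> = "\<lambda>t. \<rho> (- (t *\<^sub>R frequency x)) (\<gamma> t)"
  have "?\<eta> t = ?\<eta> 0"
  proof (rule curve_constant[OF J(1,2) _ _ t J(3)])
    have "continuous_on J (\<lambda>t. (- (t *\<^sub>R frequency x), \<gamma> t))" by (intro continuous_intros cont)
    from continuous_on_compose2[OF act_cont this] show "continuous_on J ?\<eta>" using U by auto
    fix t d assume t: "t \<in> J" and d: "d \<in> charts_at A (?\<eta> t)"
    obtain c where c: "c \<in> charts_at A (\<gamma> t)" by (rule chart_exists)
    let ?s = "- (t *\<^sub>R frequency x)"
    have "((\<lambda>t. snd c (\<gamma> t)) has_derivative (\<lambda>h. h *\<^sub>R vec_comp c (Y (\<gamma> t)))) (at t)"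
      using \<gamma> t c by (auto simp: integral_curve_def has_vector_derivative_def)
    then have "((\<lambda>t. (- (t *\<^sub>R frequency x), snd c (\<gamma> t))) has_derivative
        (\<lambda>h. (- (h *\<^sub>R frequency x), h *\<^sub>R vec_comp c (Y (\<gamma> t))))) (at t)"
      by (auto intro!: derivative_eq_intros)
    from diff_chain_at[OF this act_rep_derivative[OF U[OF t] c d]]
    have D: "((\<lambda>t. act_rep c d (- (t *\<^sub>R frequency x), snd c (\<gamma> t))) has_derivative
        (\<lambda>h. generator d (?\<eta> t) (- (h *\<^sub>R frequency x)) + chart_jacobian c d (\<rho> ?s) (\<gamma> t) *v (h *\<^sub>R vec_comp c (Y (\<gamma> t))))) (at t)"
      by (simp add: o_def)
    have "generator d (?\<eta> t) (frequency x) = chart_jacobian c d (\<rho> ?s) (\<gamma> t) *v vec_comp c (Y (\<gamma> t))"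
      using field_equivariant[OF U[OF t] c d] generator_frequency[OF act_U[OF U[OF t]] d] frequency_invariant[OF U[OF t]] frequency[OF t]
      by simp
    then have zero: "generator d (?\<eta> t) (- (h *\<^sub>R frequency x)) + chart_jacobian c d (\<rho> ?s) (\<gamma> t) *v (h *\<^sub>R vec_comp c (Y (\<gamma> t))) = 0" for h
      using linear_cmul[OF generator_linear[OF act_U[OF U[OF t]] d], of "- h" "frequency x"]
      by (simp add: matrix_vector_mult_scaleR)
    have "(\<gamma> \<longlongrightarrow> \<gamma> t) (nhds t)" by (rule nhds_tendstoI[OF cont J(1) t])
    from eventually_compose_filterlim[OF eventually_in_chart[OF c] this]
    have "\<forall>\<^sub>F t' in nhds t. act_rep c d (- (t' *\<^sub>R frequency x), snd c (\<gamma> t')) = snd d (?\<eta> t')"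
      by eventually_elim (simp add: act_rep_def chart_inv_chart charts_atD(1)[OF c])
    from has_derivative_eventually_cong[OF D this]
    show "((\<lambda>t. snd d (?\<eta> t)) has_derivative (\<lambda>h. 0)) (at t)" by (simp add: zero)
  qed
  then have "?\<eta> t = x" using x act_zero[OF x(2)] by simp
  then show ?thesis using act_neg(2)[OF U[OF t], of "t *\<^sub>R frequency x"] by simp
qed

end

section \<open>Transport of a subbundle by the torus action\<close>

locale torus_subbundle = torus_action A U \<rho> + manifold_subbundle A E V
  for A :: "('a::t2_space, 'n::finite) chart set" and U and \<rho> :: "real ^ 'p::finite \<Rightarrow> 'a \<Rightarrow> 'a" and E V
begin

text \<open>The vectors over \<open>x\<close>, in the coordinates of \<open>c\<close>, which \<open>\<rho> s\<close> maps into \<open>V\<close>: the fibre of \<open>V\<close> over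
  \<open>\<rho> s x\<close>, translated back to \<open>x\<close>. By \<open>pullbackD\<close> one chart around \<open>\<rho> s x\<close> decides for all of them.\<close>

definition pullback where
  "pullback c x s = {w. \<exists>d\<in>charts_at A (\<rho> s x). rep E (chart_jacobian c d (\<rho> s) x) w \<in> V_in d (\<rho> s x)}"

lemma pullbackD:
  assumes "x \<in> U" "c \<in> charts_at A x" "w \<in> pullback c x s" "d \<in> charts_at A (\<rho> s x)"
  shows "rep E (chart_jacobian c d (\<rho> s) x) w \<in> V_in d (\<rho> s x)"
proof -
  obtain d' where d': "d' \<in> charts_at A (\<rho> s x)" and w: "rep E (chart_jacobian c d' (\<rho> s) x) w \<in> V_in d' (\<rho> s x)"
    using assms(3) by (auto simp: pullback_def)
  have "chart_jacobian c d (\<rho> s) x = chart_jacobian d' d id (\<rho> s x) ** chart_jacobian c d' (\<rho> s) x"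
    by (rule has_chart_jacD[OF comp_chart_jacobian_id[OF act_jac[OF assms(1,2) d'] assms(4)]])
  then show ?thesis
    using V_in_transition[OF w d' assms(4)]
    by (simp add: rep_mult[OF transition_invertible[OF d' assms(4)] act_jac_inverse(2)[OF assms(1,2) d']])
qed

lemma pushforward_iff_pullback:
  assumes "x \<in> U" "c \<in> charts_at A x" "v \<in> V x"
  shows "pushforward A E (\<rho> s) x v \<in> V (\<rho> s x) \<longleftrightarrow> v c \<in> pullback c x s"
proof -
  obtain d where d: "d \<in> charts_at A (\<rho> s x)" by (rule chart_exists)
  show ?thesis
    unfolding pushforward_in_V_iff[OF act_jac[OF assms(1,2) d] act_jac_inverse(2)[OF assms(1,2) d] assms(3)]
    using pullbackD[OF assms(1,2) _ d] d by (auto simp: pullback_def)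
qed

lemma pullback_lincomb:
  assumes "x \<in> U" "c \<in> charts_at A x" "w \<in> pullback c x s" "w' \<in> pullback c x s"
  shows "(\<lambda>a. k * w a + l * w' a) \<in> pullback c x s"
proof -
  obtain d where d: "d \<in> charts_at A (\<rho> s x)" by (rule chart_exists)
  have "rep E (chart_jacobian c d (\<rho> s) x) (\<lambda>a. k * w a + l * w' a) \<in> V_in d (\<rho> s x)"
    using V_in_lincomb[OF pullbackD[OF assms(1-3) d] pullbackD[OF assms(1,2,4) d], of k l]
    by (subst ext[OF rep_lincomb])
  then show ?thesis using d by (auto simp: pullback_def)
qed

lemma act_periodic:
  assumes "\<And>j. m $ j \<in> \<int>" "y \<in> U"
  shows "\<rho> (s - m) y = \<rho> s y"
proof -
  have "\<rho> (- m) y = y" using act_fix_iff[OF assms(2)] assms(1) by simp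
  then show ?thesis using act_add[OF assms(2), of s "- m"] by simp
qed

text \<open>\<open>\<rho> (s - m)\<close> and \<open>\<rho> s\<close> agree on the open set \<open>U\<close>, so they also have the same derivatives.\<close>

lemma pullback_periodic:
  assumes "x \<in> U" "c \<in> charts_at A x" "\<And>j. m $ j \<in> \<int>"
  shows "pullback c x (s - m) = pullback c x s"
proof -
  note per = act_periodic[OF assms(3)]
  have "chart_jacobian c d (\<rho> (s - m)) x = chart_jacobian c d (\<rho> s) x" if d: "d \<in> charts_at A (\<rho> s x)" for d
  proof -
    have ev: "\<forall>\<^sub>F y in nhds x. \<rho> s y = \<rho> (s - m) y"
      using eventually_U[OF assms(1)] by eventually_elim (simp add: per)
    show ?thesis by (rule has_chart_jacD[OF has_chart_jac_cong[OF act_jac[OF assms(1,2) d] ev]])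
  qed
  then show ?thesis by (auto simp: pullback_def per[OF assms(1)])
qed

lemma pullback_closed:
  assumes "x \<in> U" "c \<in> charts_at A x" "\<F> \<noteq> bot" "(\<sigma> \<longlongrightarrow> s) \<F>"
    and "\<And>b. w b \<in> pullback c x (\<sigma> b)" "\<And>a. ((\<lambda>b. w b a) \<longlongrightarrow> v a) \<F>"
  shows "v \<in> pullback c x s"
proof -
  obtain d where d: "d \<in> charts_at A (\<rho> s x)" by (rule chart_exists)
  have "((\<lambda>b. \<rho> (\<sigma> b) x) \<longlongrightarrow> \<rho> s x) \<F>" by (intro act_tendsto assms tendsto_const)
  moreover from eventually_compose_filterlim[OF eventually_in_chart[OF d] this]
  have "\<forall>\<^sub>F b in \<F>. rep E (chart_jacobian c d (\<rho> (\<sigma> b)) x) (w b) \<in> V_in d (\<rho> (\<sigma> b) x)"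
    by eventually_elim (use d pullbackD[OF assms(1,2,5)] in \<open>auto simp: charts_at_def\<close>)
  ultimately have "rep E (chart_jacobian c d (\<rho> s) x) v \<in> V_in d (\<rho> s x)"
    by (rule V_in_closed[OF assms(3) _ d])
      (intro tendsto_rep act_jac_tendsto act_jac_inverse(2) assms tendsto_const d)
  then show ?thesis using d by (auto simp: pullback_def)
qed

definition carries_into where
  "carries_into s x \<longleftrightarrow> pushforward A E (\<rho> s) x ` V x \<subseteq> V (\<rho> s x)"

lemma carries_into_add:
  assumes "x \<in> U" "carries_into t x" "carries_into s (\<rho> t x)"
  shows "carries_into (s + t) x"
  unfolding carries_into_def
proof
  fix w assume "w \<in> pushforward A E (\<rho> (s + t)) x ` V x"
  then obtain v where v: "v \<in> V x" and w: "w = pushforward A E (\<rho> (s + t)) x v" by blast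
  obtain c d e where c: "c \<in> charts_at A x" and d: "d \<in> charts_at A (\<rho> t x)" and e: "e \<in> charts_at A (\<rho> s (\<rho> t x))"
    by (meson chart_exists)
  note y = act_U[OF assms(1), of t]
  have vt: "pushforward A E (\<rho> t) x v \<in> V (\<rho> t x)" using v assms(2) by (auto simp: carries_into_def)
  have "pushforward A E (\<rho> s) (\<rho> t x) (pushforward A E (\<rho> t) x v) \<in> V (\<rho> s (\<rho> t x))"
    using vt assms(3) by (auto simp: carries_into_def)
  then have *: "rep E (chart_jacobian d e (\<rho> s) (\<rho> t x)) (rep E (chart_jacobian c d (\<rho> t) x) (v c)) \<in> V_in e (\<rho> s (\<rho> t x))"
    unfolding pushforward_in_V_iff[OF act_jac[OF y d e] act_jac_inverse(2)[OF y d e] vt]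
      pushforward_in_chart[OF act_jac[OF assms(1) c d] act_jac_inverse(2)[OF assms(1) c d] V_fibre[OF v]] .
  have ev: "\<forall>\<^sub>F y in nhds x. \<rho> s (\<rho> t y) = \<rho> (s + t) y"
    using eventually_U[OF assms(1)] by eventually_elim (simp add: act_add)
  have "chart_jacobian c e (\<rho> (s + t)) x = chart_jacobian d e (\<rho> s) (\<rho> t x) ** chart_jacobian c d (\<rho> t) x"
    by (rule has_chart_jacD[OF has_chart_jac_cong[OF has_chart_jac_compose[OF act_jac[OF assms(1) c d] act_jac[OF y d e]] ev]])
  with * have "rep E (chart_jacobian c e (\<rho> (s + t)) x) (v c) \<in> V_in e (\<rho> (s + t) x)"
    by (simp add: rep_mult[OF act_jac_inverse(2)[OF y d e] act_jac_inverse(2)[OF assms(1) c d]] act_add[OF assms(1)])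
  then have "v c \<in> pullback c x (s + t)"
    using e by (auto simp: pullback_def act_add[OF assms(1)])
  then show "w \<in> V (\<rho> (s + t) x)" using pushforward_iff_pullback[OF assms(1) c v] w by simp
qed

lemma carries_onto:
  assumes "x \<in> U" "carries_into s x" "carries_into (- s) (\<rho> s x)"
  shows "pushforward A E (\<rho> s) x ` V x = V (\<rho> s x)"
proof -
  obtain c d where c: "c \<in> charts_at A x" and d: "d \<in> charts_at A (\<rho> s x)" by (meson chart_exists)
  have ev: "\<forall>\<^sub>F y in nhds x. \<rho> (- s) (\<rho> s y) = y"
    using eventually_U[OF assms(1)] by eventually_elim (rule act_neg)
  show ?thesis
    by (rule pushforward_eq_of_inverse[OF act_jac[OF assms(1) c d] act_jac_inverse(1)[OF assms(1) c d] ev])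
      (use assms act_neg(1)[OF assms(1)] in \<open>auto simp: carries_into_def\<close>)
qed

text \<open>A vector of \<open>V\<close> over \<open>x\<close> is a limit of vectors of \<open>V\<close> over points of \<open>D\<close>; their images lie in \<open>V\<close>,
  which is closed.\<close>

lemma carries_into_closure:
  assumes "\<And>y. y \<in> D \<Longrightarrow> y \<in> U \<and> carries_into s y" "x \<in> U" "x \<in> closure D"
  shows "carries_into s x"
proof (cases "x \<in> D")
  case False
  then have \<F>: "at x within D \<noteq> bot"
    using assms(3) by (auto simp: closure_def trivial_limit_within)
  have id: "((\<lambda>y. y) \<longlongrightarrow> x) (at x within D)" by (rule tendsto_ident_at)
  have inD: "\<forall>\<^sub>F y in at x within D. y \<in> D" by (auto simp: eventually_at_filter)
  show ?thesis unfolding carries_into_def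
  proof
    fix w assume "w \<in> pushforward A E (\<rho> s) x ` V x"
    then obtain v where v: "v \<in> V x" and w: "w = pushforward A E (\<rho> s) x v" by blast
    obtain c d where c: "c \<in> charts_at A x" and d: "d \<in> charts_at A (\<rho> s x)" by (meson chart_exists)
    obtain W where W: "\<forall>\<^sub>F y in nhds x. W y \<in> V_in c y" "\<And>a. ((\<lambda>y. W y a) \<longlongrightarrow> v c a) (nhds x)"
      using V_in_extend[OF c, of "v c"] v by (auto simp: V_in_def)
    have lim: "((\<lambda>y. \<rho> s y) \<longlongrightarrow> \<rho> s x) (at x within D)" by (intro act_tendsto tendsto_const id assms)
    have "rep E (chart_jacobian c d (\<rho> s) x) (v c) \<in> V_in d (\<rho> s x)"
    proof (rule V_in_closed[OF \<F> lim d])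
      show "\<forall>\<^sub>F y in at x within D. rep E (chart_jacobian c d (\<rho> s) y) (W y) \<in> V_in d (\<rho> s y)"
        using inD eventually_compose_filterlim[OF W(1) id] eventually_compose_filterlim[OF eventually_in_chart[OF c] id]
          eventually_compose_filterlim[OF eventually_in_chart[OF d] lim]
      proof eventually_elim
        case (elim y)
        obtain v' where v': "v' \<in> V y" "W y = v' c" using elim by (auto simp: V_in_def)
        have y: "y \<in> U" "carries_into s y" using assms(1) elim by auto
        have cy: "c \<in> charts_at A y" "d \<in> charts_at A (\<rho> s y)" using c d elim by (auto simp: charts_at_def)
        have "W y \<in> pullback c y s"
          using pushforward_iff_pullback[OF y(1) cy(1) v'(1)] v' y(2) by (auto simp: carries_into_def)
        then show ?case by (rule pullbackD[OF y(1) cy(1) _ cy(2)])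
      qed
      show "((\<lambda>y. rep E (chart_jacobian c d (\<rho> s) y) (W y) a) \<longlongrightarrow> rep E (chart_jacobian c d (\<rho> s) x) (v c) a) (at x within D)" for a
        by (intro tendsto_rep act_jac_tendsto act_jac_inverse(2) assms tendsto_const id c d filterlim_compose[OF W(2) id])
    qed
    then show "w \<in> V (\<rho> s x)"
      using pushforward_iff_pullback[OF assms(2) c v] w d by (auto simp: pullback_def)
  qed
qed (use assms(1) in auto)

text \<open>The vectors \<open>t \<beta> - m\<close> with \<open>m\<close> integral represent the points \<open>\<rho> (t \<beta>) x\<close> of the orbit, and the
  admissible \<open>s\<close> form a closed periodic set. Density has to be lifted from the orbit to \<open>R^p\<close>, which
  works because the unit cube is compact.\<close>

lemma carries_into_of_dense:
  assumes "x \<in> U" "\<And>t. carries_into (t *\<^sub>R \<beta>) x"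
    and dense: "\<And>s. \<rho> s x \<in> closure (range (\<lambda>t. \<rho> (t *\<^sub>R \<beta>) x))"
  shows "carries_into s x"
  unfolding carries_into_def
proof
  fix w assume "w \<in> pushforward A E (\<rho> s) x ` V x"
  then obtain v where v: "v \<in> V x" and w: "w = pushforward A E (\<rho> s) x v" by blast
  obtain c where c: "c \<in> charts_at A x" by (rule chart_exists)
  define G where "G = {t *\<^sub>R \<beta> - m | t m. \<forall>j. m $ j \<in> \<int>}"
  have "v c \<in> pullback c x k" if "k \<in> closure G" for k
  proof -
    obtain \<sigma> where \<sigma>: "\<And>n. \<sigma> n \<in> G" "\<sigma> \<longlonglongrightarrow> k" using \<open>k \<in> closure G\<close> unfolding closure_sequential by blast
    have "v c \<in> pullback c x g" if gG: "g \<in> G" for g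
    proof -
      obtain t m where g: "g = t *\<^sub>R \<beta> - m" "\<And>j. m $ j \<in> \<int>" using gG unfolding G_def by blast
      have "v c \<in> pullback c x (t *\<^sub>R \<beta>)"
        using assms(2)[of t] v pushforward_iff_pullback[OF assms(1) c v] by (auto simp: carries_into_def)
      then show ?thesis using pullback_periodic[OF assms(1) c g(2)] g(1) by simp
    qed
    then show ?thesis
      using pullback_closed[OF assms(1) c sequentially_bot \<sigma>(2), of "\<lambda>_. v c" "v c"] \<sigma>(1) by simp
  qed
  moreover have "\<exists>k\<in>closure G. \<rho> s x = \<rho> k x"
  proof -
    \<comment> \<open>By periodicity all limits of the vectors in \<open>G\<close> may be taken in the unit cube.\<close>
    define C where "C = (\<lambda>k. \<rho> k x) ` (closure G \<inter> cbox 0 1)"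
    have "compact C" unfolding C_def
      by (intro compact_continuous_image act_curve_continuous continuous_on_id assms closed_Int_compact) auto
    then have "closed C" by (rule compact_imp_closed)
    moreover have "\<rho> (t *\<^sub>R \<beta>) x \<in> C" for t
    proof -
      define m :: "real ^ 'p" where "m = (\<chi> j. of_int \<lfloor>t * \<beta> $ j\<rfloor>)"
      have m: "m $ j \<in> \<int>" for j by (simp add: m_def)
      have "t *\<^sub>R \<beta> - m \<in> cbox 0 1"
        unfolding mem_box_cart m_def by (auto simp: less_imp_le) linarith+
      moreover have "t *\<^sub>R \<beta> - m \<in> closure G"
        using m closure_subset[of G] unfolding G_def by blast
      ultimately show ?thesis unfolding C_def using act_periodic[OF m assms(1)] by (metis IntI image_eqI)
    qed
    ultimately have "closure (range (\<lambda>t. \<rho> (t *\<^sub>R \<beta>) x)) \<subseteq> C" by (intro closure_minimal) auto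
    then show ?thesis using dense[of s] by (auto simp: C_def)
  qed
  then obtain k where k: "k \<in> closure G" "\<rho> s x = \<rho> k x" by blast
  have "\<rho> (s - k) x = x"
    using act_add[OF assms(1), of "- k" s] act_neg(1)[OF assms(1), of k] k(2) by (simp add: add.commute)
  then have "(s - k) $ j \<in> \<int>" for j using act_fix_iff[OF assms(1)] by blast
  from pullback_periodic[OF assms(1) c this, of s] have "pullback c x k = pullback c x s" by simp
  ultimately have "v c \<in> pullback c x s" using k(1) by blast
  then show "w \<in> V (\<rho> s x)" using pushforward_iff_pullback[OF assms(1) c v] w by simp
qed

end

locale conserved_field = invariant_tangent_field A U \<rho> Y + torus_subbundle A U \<rho> E V
  for A :: "('a::t2_space, 'n::finite) chart set" and U and \<rho> :: "real ^ 'p::finite \<Rightarrow> 'a \<Rightarrow> 'a"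
    and Y E V +
  assumes conserved: "conserved_by A E V Y"
begin

text \<open>Conservation by the flow, with the translation undone and only the shear left.\<close>

lemma sheared_in_pullback:
  assumes x: "x \<in> U" and c: "c \<in> charts_at A x" and v: "v \<in> V x"
  shows "rep E (mat 1 + t *\<^sub>R shear c x) (v c) \<in> pullback c x (t *\<^sub>R frequency x)"
proof -
  obtain d where d: "d \<in> charts_at A (flow t x)" by (rule chart_exists)
  have d': "d \<in> charts_at A (\<rho> (t *\<^sub>R frequency x) x)" using d by (simp add: flow_def)
  have inv: "invertible (chart_jacobian c d (\<rho> (t *\<^sub>R frequency x)) x)" by (rule act_jac_inverse(2)[OF x c d'])
  have inv': "invertible (mat 1 + t *\<^sub>R shear c x)"
    by (rule matrix_inv_eqI(2)[OF nilpotent_inverse[OF shear_nilpotent[OF x c]]])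
  have "pushforward A E (flow t) x v \<in> V (flow t x)"
    using conserved flow_local_flow x v unfolding conserved_by_def preserves_subbundle_on_def by blast
  then have "rep E (chart_jacobian c d (\<rho> (t *\<^sub>R frequency x)) x ** (mat 1 + t *\<^sub>R shear c x)) (v c) \<in> V_in d (flow t x)"
    unfolding pushforward_in_V_iff[OF flow_jac[OF x c d] invertible_mult[OF inv inv'] v] .
  then show ?thesis using d' by (auto simp: pullback_def rep_mult[OF inv inv'] flow_def)
qed

text \<open>The vector \<open>v\<close> is the constant coefficient of the polynomial curve of sheared vectors, so it lies in
  every pulled back fibre along \<open>t \<mapsto> t * frequency x\<close>.\<close>

lemma carries_into_frequency:
  assumes x: "x \<in> U"
  shows "carries_into (t *\<^sub>R frequency x) x"
  unfolding carries_into_def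
proof
  fix w assume "w \<in> pushforward A E (\<rho> (t *\<^sub>R frequency x)) x ` V x"
  then obtain v where v: "v \<in> V x" and w: "w = pushforward A E (\<rho> (t *\<^sub>R frequency x)) x v" by blast
  obtain c where c: "c \<in> charts_at A x" by (rule chart_exists)
  obtain P D where P: "\<And>t a. rep E (mat 1 + t *\<^sub>R shear c x) (v c) a = poly (P a) t" and D: "\<And>a. degree (P a) \<le> D"
    using rep_nilpotent_poly[OF shear_nilpotent[OF x c]] by metis
  have "(\<lambda>a. coeff (P a) 0) \<in> pullback c x (t *\<^sub>R frequency x)"
  proof (rule recurrent_polynomial_coeffs[OF _ _ _ _ D])
    show "(\<lambda>a. poly (P a) t) \<in> pullback c x (t *\<^sub>R frequency x)" for t
      using sheared_in_pullback[OF x c v, of t] by (simp flip: P)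
    show "u \<in> pullback c x s"
      if "\<sigma> \<longlonglongrightarrow> s" "\<And>n. W n \<in> pullback c x (\<sigma> n)" "\<And>a. (\<lambda>n. W n a) \<longlonglongrightarrow> u a" for \<sigma> W s u
      by (rule pullback_closed[OF x c sequentially_bot that])
  qed (rule pullback_lincomb[OF x c] pullback_periodic[OF x c]; assumption)+
  moreover have "coeff (P a) 0 = v c a" for a
    using P[of 0 a] rep_one[of E "v c"] fibre_outside[OF V_fibre[OF v]] by (simp add: poly_0_coeff_0)
  ultimately show "w \<in> V (\<rho> (t *\<^sub>R frequency x) x)"
    using pushforward_iff_pullback[OF x c v] w by simp
qed

end

section \<open>Integrable systems\<close>

lemma level_sets_meeting_eq:
  assumes "level_set q F N" "level_set q F N'" "x \<in> N" "x \<in> N'"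
  shows "N = N'"
proof -
  obtain k k' where k: "N \<in> components {x. \<forall>j\<in>{1..q}. F j x = k j}" "N' \<in> components {x. \<forall>j\<in>{1..q}. F j x = k' j}"
    using assms(1,2) by (auto simp: level_set_def)
  have "\<forall>j\<in>{1..q}. F j x = k j" "\<forall>j\<in>{1..q}. F j x = k' j"
    using in_components_subset[OF k(1)] in_components_subset[OF k(2)] assms(3,4) by auto
  then have "{x. \<forall>j\<in>{1..q}. F j x = k j} = {x. \<forall>j\<in>{1..q}. F j x = k' j}" by auto
  then show ?thesis using k assms(3,4) components_eq[of N _ N'] by auto
qed

context manifold begin

lemma function_has_derivative:
  assumes "smooth_function A f" "c \<in> charts_at A x"
  shows "((\<lambda>u. f (chart_inv c u)) has_derivative fun_deriv c f x) (at (snd c x))"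
proof -
  have "smooth_on (snd c ` fst c) (\<lambda>u. f (chart_inv c u))"
    using assms by (auto simp: smooth_function_def charts_at_def)
  from smooth_on_differentiable(1)[OF this, of "snd c x"] assms(2) show ?thesis
    unfolding fun_deriv_def by (simp add: frechet_derivative_works charts_at_def)
qed

lemma fun_deriv_eq_inner:
  assumes "smooth_function A f" "c \<in> charts_at A x"
  shows "fun_deriv c f x w = differential c f x \<bullet> w"
proof -
  have lin: "linear (fun_deriv c f x)"
    by (rule has_derivative_linear[OF function_has_derivative[OF assms]])
  have "fun_deriv c f x w = fun_deriv c f x (\<Sum>i\<in>UNIV. w $ i *\<^sub>R axis i 1)"
    by (simp add: basis_expansion flip: scalar_mult_eq_scaleR)
  also have "\<dots> = (\<Sum>i\<in>UNIV. w $ i * fun_deriv c f x (axis i 1))"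
    by (simp add: linear_sum[OF lin] linear_cmul[OF lin])
  finally show ?thesis by (simp add: inner_vec_def differential_def mult.commute)
qed

lemma function_constant_along_curve:
  assumes f: "smooth_function A f" and J: "open J" "is_interval J" and \<gamma>: "integral_curve A Y J \<gamma>"
    and Yf: "\<And>x c. c \<in> charts_at A x \<Longrightarrow> fun_deriv c f x (vec_comp c (Y x)) = 0"
  obtains k where "\<And>t. t \<in> J \<Longrightarrow> f (\<gamma> t) = k"
proof -
  have "\<exists>k. \<forall>t\<in>J. f (\<gamma> t) = k"
  proof (rule has_derivative_zero_constant)
    show "convex J" using J(2) by (simp add: is_interval_convex)
    fix t assume t: "t \<in> J"
    obtain c where c: "c \<in> charts_at A (\<gamma> t)" by (rule chart_exists)
    have "((\<lambda>t. snd c (\<gamma> t)) has_derivative (\<lambda>h. h *\<^sub>R vec_comp c (Y (\<gamma> t)))) (at t)"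
      using \<gamma> t c by (auto simp: integral_curve_def has_vector_derivative_def)
    from diff_chain_at[OF this function_has_derivative[OF f c]]
    have "((\<lambda>t. f (chart_inv c (snd c (\<gamma> t)))) has_derivative (\<lambda>h. fun_deriv c f (\<gamma> t) (h *\<^sub>R vec_comp c (Y (\<gamma> t))))) (at t)"
      by (simp add: o_def)
    moreover have "fun_deriv c f (\<gamma> t) (h *\<^sub>R vec_comp c (Y (\<gamma> t))) = 0" for h
      using linear_cmul[OF has_derivative_linear[OF function_has_derivative[OF f c]]] Yf[OF c] by simp
    moreover have "(\<gamma> \<longlongrightarrow> \<gamma> t) (nhds t)"
      using \<gamma> by (intro nhds_tendstoI[OF _ J(1) t]) (simp add: integral_curve_def)
    from eventually_compose_filterlim[OF eventually_in_chart[OF c] this]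
    have "\<forall>\<^sub>F t' in nhds t. f (chart_inv c (snd c (\<gamma> t'))) = f (\<gamma> t')"
      by eventually_elim (simp add: chart_inv_chart charts_atD(1)[OF c])
    ultimately have "((\<lambda>t. f (\<gamma> t)) has_derivative (\<lambda>h. 0)) (at t)"
      using has_derivative_eventually_cong by fastforce
    then show "((\<lambda>t. f (\<gamma> t)) has_derivative (\<lambda>h. 0)) (at t within J)"
      by (rule has_derivative_at_withinI)
  qed
  then show ?thesis using that by blast
qed

end

context torus_action begin

text \<open>The common kernel of \<open>q\<close> independent differentials has dimension \<open>CARD('p)\<close>; it contains the
  tangent space of the orbit, which has the same dimension.\<close>

lemma orbit_tangent_space:
  assumes x: "x \<in> U" and c: "c \<in> charts_at A x"
    and F: "\<And>j. j \<in> {1..q} \<Longrightarrow> smooth_function A (F j)"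
    and inv: "\<And>j s. j \<in> {1..q} \<Longrightarrow> F j (\<rho> s x) = F j x"
    and nondeg: "differentials_nondegenerate_at A q F x"
    and dims: "CARD('p) + q = CARD('n)"
    and w: "\<And>j. j \<in> {1..q} \<Longrightarrow> fun_deriv c (F j) x w = 0"
  shows "w \<in> range (generator c x)"
proof -
  define D where "D = (\<lambda>j. differential c (F j) x)"
  let ?K = "{w \<in> UNIV. \<forall>y \<in> span (D ` {1..q}). orthogonal y w}"
  have "wedge q D \<noteq> (\<lambda>\<iota>. 0)" using nondeg c by (auto simp: differentials_nondegenerate_at_def D_def)
  then have "dim (span (D ` {1..q})) = q"
    using independent_family_span(2)[of "{1..q}" D] wedge_nonzero_imp_independent[of q D] by auto
  then have dimK: "dim ?K + q = CARD('n)"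
    using dim_subspace_orthogonal_to_vectors[of "span (D ` {1..q})" UNIV] by simp
  have in_K: "w' \<in> ?K" if w': "\<And>j. j \<in> {1..q} \<Longrightarrow> fun_deriv c (F j) x w' = 0" for w'
  proof -
    have "orthogonal w' y" if "y \<in> D ` {1..q}" for y
      using that w' fun_deriv_eq_inner[OF F c] by (auto simp: D_def orthogonal_def inner_commute)
    then show ?thesis using orthogonal_to_span[of _ "D ` {1..q}" w'] by (auto simp: orthogonal_commute)
  qed
  have "generator c x b \<in> ?K" for b
  proof (rule in_K)
    fix j assume j: "j \<in> {1..q}"
    have c0: "snd c (\<rho> 0 x) = snd c x" using act_zero[OF x] by simp
    have loc: "((\<lambda>u. F j (chart_inv c u)) has_derivative fun_deriv c (F j) x) (at (snd c (\<rho> 0 x)))"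
      unfolding c0 by (rule function_has_derivative[OF F[OF j] c])
    have "((\<lambda>h. F j (chart_inv c (snd c (\<rho> h x)))) has_derivative (\<lambda>b. fun_deriv c (F j) x (generator c x b))) (at 0)"
      using diff_chain_at[OF generator_has_derivative[OF x c] loc] by (simp add: o_def)
    moreover have "\<forall>\<^sub>F h in nhds 0. F j (chart_inv c (snd c (\<rho> h x))) = F j x"
      using eventually_act_in_chart[OF x c]
      by eventually_elim (simp add: chart_inv_chart charts_atD[OF c] inv[OF j])
    ultimately have "((\<lambda>h. F j x) has_derivative (\<lambda>b. fun_deriv c (F j) x (generator c x b))) (at 0)"
      by (rule has_derivative_eventually_cong)
    from has_derivative_unique[OF this has_derivative_const] show "fun_deriv c (F j) x (generator c x b) = 0" by metis
  qed
  then have sub: "range (generator c x) \<subseteq> ?K" by blast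
  have "dim (range (generator c x)) = CARD('p)"
    using dim_image_eq[OF generator_linear[OF x c], of UNIV] generator_inj[OF x c] by simp
  then have "dim ?K \<le> dim (range (generator c x))" using dimK dims by simp
  moreover have "subspace ?K" by (simp add: subspace_orthogonal_to_vectors)
  moreover have "subspace (range (generator c x))" using generator_linear[OF x c] by (simp add: linear_subspace_image)
  ultimately have "range (generator c x) = ?K" using sub subspace_dim_equal by blast
  then show ?thesis using in_K[OF w] by blast
qed

end

locale integrable_torus = torus_action A U \<rho>
  for A :: "('a::t2_space, 'n::finite) chart set" and U and \<rho> :: "real ^ 'p::finite \<Rightarrow> 'a \<Rightarrow> 'a" +
  fixes p q :: nat and X :: "nat \<Rightarrow> 'a \<Rightarrow> ('a, 'n) fibre_elem" and F :: "nat \<Rightarrow> 'a \<Rightarrow> real"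
  assumes system: "integrable_system A p X q F" and p_eq: "p = CARD('p)"
    and X_invariant: "\<And>i s x. i \<in> {1..p} \<Longrightarrow> x \<in> U \<Longrightarrow> pushforward A Tangent (\<rho> s) x (X i x) = X i (\<rho> s x)"
    and F_invariant: "\<And>j s x. j \<in> {1..q} \<Longrightarrow> x \<in> U \<Longrightarrow> F j (\<rho> s x) = F j x"
    and orbit_level: "\<And>x. x \<in> U \<Longrightarrow> level_set q F (range (\<lambda>s. \<rho> s x))"
    and orbit_regular: "\<And>x. x \<in> U \<Longrightarrow> regular_at A p X q F (range (\<lambda>s. \<rho> s x))"
begin

lemma X_field: "i \<in> {1..p} \<Longrightarrow> vector_field A (X i)"
  and F_smooth: "j \<in> {1..q} \<Longrightarrow> smooth_function A (F j)"
  and dims: "p + q = CARD('n)"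
  and X_kills_F: "i \<in> {1..p} \<Longrightarrow> j \<in> {1..q} \<Longrightarrow> c \<in> charts_at A x \<Longrightarrow> fun_deriv c (F j) x (vec_comp c (X i x)) = 0"
  using system unfolding integrable_system_def lie_derivative_fun_def by blast+

lemma one_in: "1 \<in> {1..p}"
  using system by (simp add: integrable_system_def)

lemma in_orbit: "x \<in> U \<Longrightarrow> x \<in> range (\<lambda>s. \<rho> s x)"
  using act_zero by (metis rangeI)

lemma X_invariant_tangent:
  assumes "i \<in> {1..p}"
  shows "invariant_tangent_field A U \<rho> (X i)"
proof unfold_locales
  fix x c assume x: "x \<in> U" and c: "c \<in> charts_at A x"
  show "vec_comp c (X i x) \<in> range (generator c x)"
  proof (rule orbit_tangent_space[OF x c F_smooth F_invariant[OF _ x]])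
    show "differentials_nondegenerate_at A q F x"
      using orbit_regular[OF x] in_orbit[OF x] unfolding regular_at_def by blast
    show "CARD('p) + q = CARD('n)" using dims p_eq by simp
    show "fun_deriv c (F j) x (vec_comp c (X i x)) = 0" if "j \<in> {1..q}" for j
      by (rule X_kills_F[OF assms that c])
  qed
qed (use X_field X_invariant assms in auto)

text \<open>The functions \<open>F j\<close> are constant along the connected curve, and the orbit is a whole component of
  their joint level set.\<close>

lemma integral_curve_confined:
  assumes i: "i \<in> {1..p}" and J: "open J" "is_interval J" "0 \<in> J" and \<gamma>: "integral_curve A (X i) J \<gamma>" and x: "\<gamma> 0 \<in> U"
  shows "\<gamma> ` J \<subseteq> range (\<lambda>s. \<rho> s (\<gamma> 0))"
proof -
  obtain k where k: "range (\<lambda>s. \<rho> s (\<gamma> 0)) \<in> components {x. \<forall>j\<in>{1..q}. F j x = k j}"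
    using orbit_level[OF x] by (auto simp: level_set_def)
  have k0: "F j (\<gamma> 0) = k j" if "j \<in> {1..q}" for j
    using in_components_subset[OF k] in_orbit[OF x] that by blast
  show ?thesis
  proof (rule components_maximal[OF k])
    show "connected (\<gamma> ` J)"
      using \<gamma> J(2) by (intro connected_continuous_image) (auto simp: integral_curve_def is_interval_connected)
    show "\<gamma> ` J \<subseteq> {x. \<forall>j\<in>{1..q}. F j x = k j}"
    proof clarify
      fix t j assume t: "t \<in> J" and j: "j \<in> {1..q}"
      obtain a where "\<And>t. t \<in> J \<Longrightarrow> F j (\<gamma> t) = a"
        using function_constant_along_curve[OF F_smooth[OF j] J(1,2) \<gamma> X_kills_F[OF i j]] by metis
      then show "F j (\<gamma> t) = k j" using k0[OF j] t J(3) by metis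
    qed
    show "range (\<lambda>s. \<rho> s (\<gamma> 0)) \<inter> \<gamma> ` J \<noteq> {}" using in_orbit[OF x] J(3) by blast
  qed
qed

end

section \<open>Torus actions preserve conserved subbundles\<close>

theorem theorem2p6:
  fixes A :: "('a::{t2_space, second_countable_topology}, 'n::finite) chart set"
    and E :: natural_bundle
    and V :: "'a \<Rightarrow> ('a, 'n) fibre_elem set"
    and p q :: nat
    and X :: "nat \<Rightarrow> 'a \<Rightarrow> ('a, 'n) fibre_elem"
    and F :: "nat \<Rightarrow> 'a \<Rightarrow> real"
    and N U :: "'a set"
    and \<rho> :: "real ^ 'p::finite \<Rightarrow> 'a \<Rightarrow> 'a"
  assumes "smooth_atlas A"
    and "integrable_system A p X q F" and "p = CARD('p)"
    and "subbundle A E V"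
    and "liouville_torus A p X q F N"
    and "liouville_torus_action A p X q F N U \<rho>"
  shows "((\<forall>i\<in>{1..p}. conserved_by A E V (X i)) \<longrightarrow>
            (\<forall>s. preserves_subbundle_on A E V U (\<rho> s))) \<and>
         (conserved_by A E V (X 1) \<and> completely_irrational_near TYPE('p) A p X q F N \<longrightarrow>
            (\<exists>W. open W \<and> N \<subseteq> W \<and> W \<subseteq> U \<and> (\<forall>s. \<rho> s ` W = W) \<and>
                 (\<forall>s. preserves_subbundle_on A E V W (\<rho> s))))"
proof -
  have tub: "\<exists>(e :: 'p \<Rightarrow> 'n) \<Phi>. tubular_coordinates A N U e \<Phi>"
    and LT: "free_torus_action A U \<rho>"
      "\<forall>i\<in>{1..p}. \<forall>s. \<forall>x\<in>U. pushforward A Tangent (\<rho> s) x (X i x) = X i (\<rho> s x)"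
      "\<forall>j\<in>{1..q}. \<forall>s. \<forall>x\<in>U. F j (\<rho> s x) = F j x"
      "\<forall>x\<in>U. level_set q F (range (\<lambda>s. \<rho> s x)) \<and> regular_at A p X q F (range (\<lambda>s. \<rho> s x))"
    using assms(6) unfolding liouville_torus_action_def by blast+
  have tubD: "open U'" "N \<subseteq> U'" if "tubular_coordinates A N U' e \<Phi>" for U' and e :: "'p \<Rightarrow> 'n" and \<Phi>
  proof -
    have "range (angle_vec e) \<subseteq> angle_domain e"
    proof clarify
      fix \<theta>
      have "angle_vec e \<theta> = angle_vec e \<theta> + 0 \<and> 0 \<in> unit_ball_q e" by (simp add: unit_ball_q_def)
      then show "angle_vec e \<theta> \<in> angle_domain e" unfolding angle_domain_def by blast
    qed
    then show "open U'" "N \<subseteq> U'" using that unfolding tubular_coordinates_def by blast+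
  qed
  have U: "open U" "N \<subseteq> U" using tub tubD by blast+
  interpret integrable_torus A U \<rho> p q X F
    by unfold_locales (use assms U LT in auto)
  interpret torus_subbundle A U \<rho> E V
    by unfold_locales (rule assms)
  have field: "conserved_field A U \<rho> (X i) E V" if "i \<in> {1..p}" "conserved_by A E V (X i)" for i
  proof -
    interpret invariant_tangent_field A U \<rho> "X i" by (rule X_invariant_tangent[OF that(1)])
    show ?thesis by unfold_locales (rule that)
  qed
  have preserves: "preserves_subbundle_on A E V W (\<rho> s)"
    if "\<And>s x. x \<in> W \<Longrightarrow> carries_into s x" "\<And>s x. x \<in> W \<Longrightarrow> \<rho> s x \<in> W" "W \<subseteq> U" for W s
    unfolding preserves_subbundle_on_def using that carries_onto by blast
  show ?thesis
  proof (intro conjI impI)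
    assume cons: "\<forall>i\<in>{1..p}. conserved_by A E V (X i)"
    have "\<exists>f. \<forall>x\<in>U. (\<forall>c\<in>charts_at A x. generator c x (f x) = vec_comp c (X i x)) \<and>
        (\<forall>s. f (\<rho> s x) = f x) \<and> (\<forall>t. carries_into (t *\<^sub>R f x) x)" if i: "i \<in> {1..p}" for i
    proof -
      interpret Xi: conserved_field A U \<rho> "X i" E V using field cons i by blast
      show ?thesis
        by (intro exI[of _ Xi.frequency] ballI conjI allI)
          (simp_all add: Xi.generator_frequency Xi.frequency_invariant Xi.carries_into_frequency)
    qed
    then have "\<forall>i\<in>{1..p}. \<exists>f. \<forall>x\<in>U. (\<forall>c\<in>charts_at A x. generator c x (f x) = vec_comp c (X i x)) \<and>
        (\<forall>s. f (\<rho> s x) = f x) \<and> (\<forall>t. carries_into (t *\<^sub>R f x) x)" by (rule ballI)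
    from bchoice[OF this] obtain \<alpha>
      where \<alpha>: "\<forall>i\<in>{1..p}. \<forall>x\<in>U. (\<forall>c\<in>charts_at A x. generator c x (\<alpha> i x) = vec_comp c (X i x)) \<and>
        (\<forall>s. \<alpha> i (\<rho> s x) = \<alpha> i x) \<and> (\<forall>t. carries_into (t *\<^sub>R \<alpha> i x) x)" by (elim exE)
    \<comment> \<open>The frequency vectors \<open>\<alpha> i x\<close> span \<open>R^p\<close>; add up the translations along them one field at a time.\<close>
    have "carries_into s x" if x: "x \<in> U" for s x
    proof -
      obtain c where c: "c \<in> charts_at A x" by (rule chart_exists)
      have "wedge p (\<lambda>i. vec_comp c (X i x)) \<noteq> (\<lambda>\<iota>. 0)"
        using orbit_regular[OF x] in_orbit[OF x] c unfolding regular_at_def vectors_nondegenerate_at_def by blast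
      note ind = wedge_nonzero_imp_independent[OF this]
      have ind': "\<forall>i\<in>{1..p}. k i = 0" if "(\<Sum>i\<in>{1..p}. k i *\<^sub>R \<alpha> i x) = 0" for k
      proof (rule ind)
        have "(\<Sum>i\<in>{1..p}. k i *\<^sub>R vec_comp c (X i x)) = (\<Sum>i\<in>{1..p}. k i *\<^sub>R generator c x (\<alpha> i x))"
          by (intro sum.cong) (use \<alpha> x c in auto)
        also have "\<dots> = generator c x (\<Sum>i\<in>{1..p}. k i *\<^sub>R \<alpha> i x)"
          by (simp add: linear_sum[OF generator_linear[OF x c]] linear_cmul[OF generator_linear[OF x c]])
        finally show "(\<Sum>i\<in>{1..p}. k i *\<^sub>R vec_comp c (X i x)) = 0"
          using that linear_0[OF generator_linear[OF x c]] by simp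
      qed
      note fam = independent_family_span[of "{1..p}" "\<lambda>i. \<alpha> i x", OF _ ind']
      have "span ((\<lambda>i. \<alpha> i x) ` {1..p}) = UNIV"
        using fam(2) p_eq by (intro dim_eq_full[THEN iffD1, unfolded span_span]) auto
      then obtain k where s: "s = (\<Sum>i\<in>{1..p}. k i *\<^sub>R \<alpha> i x)"
        using in_span_family[of "{1..p}" "\<lambda>i. \<alpha> i x" s] fam(1) by auto
      have "m \<le> p \<Longrightarrow> carries_into (\<Sum>i\<in>{1..m}. k i *\<^sub>R \<alpha> i x) x" for m
      proof (induction m)
        case 0
        have "carries_into (0 *\<^sub>R \<alpha> 1 x) x" using \<alpha> x one_in by blast
        then show ?case by simp
      next
        case (Suc m)
        let ?s = "\<Sum>i\<in>{1..m}. k i *\<^sub>R \<alpha> i x"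
        have m: "Suc m \<in> {1..p}" using Suc.prems by simp
        then have "carries_into (k (Suc m) *\<^sub>R \<alpha> (Suc m) (\<rho> ?s x)) (\<rho> ?s x)" using \<alpha> act_U[OF x] by blast
        moreover have "\<alpha> (Suc m) (\<rho> ?s x) = \<alpha> (Suc m) x" using \<alpha> m x by blast
        ultimately have "carries_into (k (Suc m) *\<^sub>R \<alpha> (Suc m) x + ?s) x"
          using carries_into_add[OF x, of ?s "k (Suc m) *\<^sub>R \<alpha> (Suc m) x"] Suc by simp
        then show ?case by (simp add: add.commute)
      qed
      then show ?thesis using s by blast
    qed
    from preserves[OF this act_U subset_refl]
    show "\<forall>s. preserves_subbundle_on A E V U (\<rho> s)" by (rule allI)
  next
    assume *: "conserved_by A E V (X 1) \<and> completely_irrational_near TYPE('p) A p X q F N"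
    interpret X1: conserved_field A U \<rho> "X 1" E V using field[OF one_in] * by blast
    obtain U' and \<rho>' :: "real ^ 'p \<Rightarrow> 'a \<Rightarrow> 'a" and e \<Phi> where
      act': "liouville_torus_action A p X q F N U' \<rho>'"
      and coords: "liouville_coordinates A p X q F N U' \<rho>' e \<Phi>"
      and irr: "unit_ball_q e \<subseteq> closure {z \<in> unit_ball_q e.
          \<forall>x \<in> range (\<lambda>\<theta>. \<Phi> (angle_vec e \<theta> + z)).
            range (\<lambda>\<theta>. \<Phi> (angle_vec e \<theta> + z)) \<subseteq> closure (orbit A (X 1) x)}"
      using * unfolding completely_irrational_near_def by blast
    have level': "\<And>x. x \<in> U' \<Longrightarrow> level_set q F (range (\<lambda>s. \<rho>' s x))"
      and free': "free_torus_action A U' \<rho>'"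
      using act' unfolding liouville_torus_action_def by blast+
    have tub': "tubular_coordinates A N U' e \<Phi>"
      and shift: "\<And>s \<theta> z. z \<in> unit_ball_q e \<Longrightarrow> \<rho>' s (\<Phi> (angle_vec e \<theta> + z)) = \<Phi> (angle_vec e (\<theta> + s) + z)"
      using coords unfolding liouville_coordinates_def by blast+
    have U': "open U'" "N \<subseteq> U'" using tubD[OF tub'] by blast+
    interpret act': torus_action A U' \<rho>' by unfold_locales (rule U' free')+
    have \<Phi>: "\<Phi> ` angle_domain e = U'" "continuous_on (angle_domain e) \<Phi>"
      using tub' unfolding tubular_coordinates_def by blast+
    define W where "W = U \<inter> U'"
    \<comment> \<open>The orbits of \<open>\<rho>\<close> and \<open>\<rho>'\<close> through a common point are components of the same joint level set.\<close>
    have same_orbit: "range (\<lambda>s. \<rho> s x) = range (\<lambda>s. \<rho>' s x)" if "x \<in> W" for x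
    proof (rule level_sets_meeting_eq)
      show "x \<in> range (\<lambda>s. \<rho>' s x)" using act'.act_zero that by (metis IntD2 W_def rangeI)
    qed (use that orbit_level level' in_orbit in \<open>auto simp: W_def\<close>)
    have orbit_W: "\<rho> s x \<in> W" if "x \<in> W" for s x
    proof -
      have "\<rho> s x \<in> range (\<lambda>s. \<rho>' s x)" using same_orbit[OF that] by blast
      then show ?thesis using that act_U act'.act_U by (auto simp: W_def)
    qed
    have W: "open W" "N \<subseteq> W" "W \<subseteq> U" using U U' by (auto simp: W_def)
    have X1_orbit: "orbit A (X 1) x \<subseteq> range (\<lambda>t. \<rho> (t *\<^sub>R X1.frequency x) x)" if x: "x \<in> U" for x
    proof
      fix y assume "y \<in> orbit A (X 1) x"
      then obtain \<gamma> J t where y: "y = \<gamma> t" and J: "open J" "is_interval J" "0 \<in> J" "t \<in> J"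
        and \<gamma>: "integral_curve A (X 1) J \<gamma>" "\<gamma> 0 = x" unfolding orbit_def by blast
      have "\<gamma> ` J \<subseteq> range (\<lambda>s. \<rho> s x)" using integral_curve_confined[OF one_in J(1-3) \<gamma>(1)] x \<gamma>(2) by simp
      from X1.integral_curve_in_orbit[OF J(1-3) \<gamma> x this J(4)] show "y \<in> range (\<lambda>t. \<rho> (t *\<^sub>R X1.frequency x) x)"
        using y by blast
    qed
    \<comment> \<open>The union of the tori in \<open>W\<close> on which \<open>X 1\<close> has dense orbits.\<close>
    define D where "D = {x \<in> W. range (\<lambda>s. \<rho> s x) \<subseteq> closure (orbit A (X 1) x)}"
    have carries_D: "carries_into s x" if "x \<in> D" for s x
    proof (rule carries_into_of_dense)
      show x: "x \<in> U" using that W by (auto simp: D_def)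
      show "carries_into (t *\<^sub>R X1.frequency x) x" for t by (rule X1.carries_into_frequency[OF x])
      show "\<rho> s x \<in> closure (range (\<lambda>t. \<rho> (t *\<^sub>R X1.frequency x) x))" for s
        using that closure_mono[OF X1_orbit[OF x]] by (auto simp: D_def)
    qed
    have "x \<in> closure D" if x: "x \<in> W" for x
    proof -
      have "x \<in> \<Phi> ` angle_domain e" using x \<Phi>(1) by (simp add: W_def)
      then obtain \<theta> z where z: "z \<in> unit_ball_q e" and x_eq: "x = \<Phi> (angle_vec e \<theta> + z)"
        by (auto simp: angle_domain_def)
      obtain \<zeta> where \<zeta>: "\<And>n. \<zeta> n \<in> {z \<in> unit_ball_q e.
          \<forall>x \<in> range (\<lambda>\<theta>. \<Phi> (angle_vec e \<theta> + z)).
            range (\<lambda>\<theta>. \<Phi> (angle_vec e \<theta> + z)) \<subseteq> closure (orbit A (X 1) x)}" "\<zeta> \<longlonglongrightarrow> z"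
        using subsetD[OF irr z] unfolding closure_sequential by (elim exE conjE) blast
      have dom: "angle_vec e \<theta> + y \<in> angle_domain e" if "y \<in> unit_ball_q e" for y
        using that by (auto simp: angle_domain_def)
      have lim: "(\<lambda>n. \<Phi> (angle_vec e \<theta> + \<zeta> n)) \<longlonglongrightarrow> x"
        unfolding x_eq
        by (rule continuous_on_tendsto_compose[OF \<Phi>(2) _ dom[OF z]])
          (use \<zeta> dom in \<open>auto intro!: tendsto_intros\<close>)
      have "\<forall>\<^sub>F n in sequentially. \<Phi> (angle_vec e \<theta> + \<zeta> n) \<in> D"
        using topological_tendstoD[OF lim W(1) x]
      proof eventually_elim
        case (elim n)
        let ?y = "\<Phi> (angle_vec e \<theta> + \<zeta> n)"
        have "\<rho>' s ?y = \<Phi> (angle_vec e (\<theta> + s) + \<zeta> n)" for s using shift \<zeta>(1) by blast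
        then have "range (\<lambda>s. \<rho> s ?y) \<subseteq> range (\<lambda>\<theta>. \<Phi> (angle_vec e \<theta> + \<zeta> n))"
          unfolding same_orbit[OF elim] by auto
        also have "\<dots> \<subseteq> closure (orbit A (X 1) ?y)" using \<zeta>(1)[of n] by blast
        finally show ?case using elim by (simp add: D_def)
      qed
      then have "\<forall>\<^sub>F n in sequentially. \<Phi> (angle_vec e \<theta> + \<zeta> n) \<in> closure D"
        by eventually_elim (rule subsetD[OF closure_subset])
      from Lim_in_closed_set[OF closed_closure this sequentially_bot lim] show ?thesis .
    qed
    then have carries: "carries_into s x" if "x \<in> W" for s x
    proof (rule carries_into_closure[rotated 2])
      show "x \<in> W" by (rule that)
      show "x \<in> U" using that W(3) by blast
      show "y \<in> U \<and> carries_into s y" if "y \<in> D" for y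
        using carries_D[OF that] that W(3) by (auto simp: D_def)
    qed
    have "\<rho> s ` W = W" for s
    proof
      show "W \<subseteq> \<rho> s ` W"
      proof
        fix x assume x: "x \<in> W"
        then have "x = \<rho> s (\<rho> (- s) x)" using act_neg(2)[of x s] W(3) by auto
        then show "x \<in> \<rho> s ` W" using orbit_W[OF x] by (rule image_eqI)
      qed
    qed (use orbit_W in blast)
    moreover have "preserves_subbundle_on A E V W (\<rho> s)" for s
      by (rule preserves[OF carries orbit_W W(3)])
    ultimately show "\<exists>W. open W \<and> N \<subseteq> W \<and> W \<subseteq> U \<and> (\<forall>s. \<rho> s ` W = W) \<and>
                 (\<forall>s. preserves_subbundle_on A E V W (\<rho> s))"
      by (intro exI[of _ W] conjI allI W)
  qed
qed

end
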